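(* There is an algorithm which, given a connected $\Delta$-regular graph $G$ with $n$ vertices and $m$ edges, where $\Delta \ge 3$ and $G$ is distinct from the complete graph $K_{\Delta+1}$, and given two integers $0 \le p_A \le p_B$ with $p_A + p_B = \Delta - 2$, outputs in time $O(n+m)$ a partition of $V(G)$ into two sets $A$ and $B$ such that $G[A]$ is $p_A$-degenerate and $G[B]$ is $p_B$-degenerate.
   Context: A graph is $d$-degenerate if every non-empty subgraph contains a vertex of degree at most $d$. $G[S]$ denotes the subgraph induced by $S$. *)

theory Defs
  imports "Graph_Theory.Graph_Theory"
begin

section \<open>Graphs\<close>

text \<open>
  As in the session Graph_Theory, a finite simple graph is a finite, symmetric, loop-free digraph
  without parallel arcs (\<^const>\<open>graph\<close>, \<^const>\<open>pair_graph\<close>). An undirected edge corresponds to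
  two opposite arcs, so the degree of a vertex is its out-degree.
\<close>

definition num_edges :: "('a, 'b) pre_digraph \<Rightarrow> nat" where
  "num_edges G = card {{u, v} | u v. (u, v) \<in> arcs_ends G}"

definition regular :: "nat \<Rightarrow> ('a, 'b) pre_digraph \<Rightarrow> bool" where
  "regular d G \<longleftrightarrow> (\<forall>v\<in>verts G. out_degree G v = d)"

text \<open>
  The conjunct \<^term>\<open>graph H\<close> restricts the sub-digraphs of the library to those that are
  undirected graphs themselves.
\<close>

definition degenerate :: "nat \<Rightarrow> ('a, 'b) pre_digraph \<Rightarrow> bool" where
  "degenerate d G \<longleftrightarrow>
     (\<forall>H. subgraph H G \<and> graph H \<and> verts H \<noteq> {} \<longrightarrow> (\<exists>v\<in>verts H. out_degree H v \<le> d))"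


section \<open>Algorithms: programs of a random access machine\<close>

text \<open>
  Programs are finite syntactic objects. The memory consists of registers and of arrays, both
  named by natural numbers and holding natural numbers. Every arithmetic operation, memory access,
  comparison and connective costs one time unit, and so does every command that is executed and
  every test of a conditional or a loop.
\<close>

record state =
  regs :: "nat \<Rightarrow> nat"
  arrs :: "nat \<Rightarrow> nat \<Rightarrow> nat"

datatype aexp =
    Num nat
  | Reg nat
  | Cell nat aexp
  | Plus aexp aexp
  | Minus aexp aexp

datatype bexp =
    Less aexp aexp
  | Equal aexp aexp
  | Neg bexp
  | Conj bexp bexp

datatype com =
    Skip
  | Assign nat aexp
  | Store nat aexp aexp
  | Seq com com
  | Cond bexp com com
  | While bexp com

fun aval :: "aexp \<Rightarrow> state \<Rightarrow> nat" where
  "aval (Num k) s = k"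
| "aval (Reg x) s = regs s x"
| "aval (Cell a i) s = arrs s a (aval i s)"
| "aval (Plus e f) s = aval e s + aval f s"
| "aval (Minus e f) s = aval e s - aval f s"

fun acost :: "aexp \<Rightarrow> nat" where
  "acost (Num k) = 1"
| "acost (Reg x) = 1"
| "acost (Cell a i) = acost i + 1"
| "acost (Plus e f) = acost e + acost f + 1"
| "acost (Minus e f) = acost e + acost f + 1"

fun bval :: "bexp \<Rightarrow> state \<Rightarrow> bool" where
  "bval (Less e f) s \<longleftrightarrow> aval e s < aval f s"
| "bval (Equal e f) s \<longleftrightarrow> aval e s = aval f s"
| "bval (Neg b) s \<longleftrightarrow> \<not> bval b s"
| "bval (Conj b c) s \<longleftrightarrow> bval b s \<and> bval c s"

fun bcost :: "bexp \<Rightarrow> nat" where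
  "bcost (Less e f) = acost e + acost f + 1"
| "bcost (Equal e f) = acost e + acost f + 1"
| "bcost (Neg b) = bcost b + 1"
| "bcost (Conj b c) = bcost b + bcost c + 1"

text \<open>
  \<open>exec W c s t s'\<close>: started in \<open>s\<close>, the program \<open>c\<close> halts in \<open>s'\<close> after exactly \<open>t\<close> time units,
  on a machine whose memory cells hold the numbers \<open>0, \<dots>, W\<close> only. A command that would write a
  number above \<open>W\<close>, or write to an index above \<open>W\<close>, has no execution. This bound excludes the
  abuse of unit-cost arithmetic on very long numbers. It is imposed on writes only: the
  intermediate values in an expression of a fixed program exceed \<open>W\<close> at most by a constant factor
  and an additive constant.
\<close>

inductive exec :: "nat \<Rightarrow> com \<Rightarrow> state \<Rightarrow> nat \<Rightarrow> state \<Rightarrow> bool" for W :: nat where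
  Skip: "exec W Skip s 1 s"
| Assign: "aval e s \<le> W \<Longrightarrow>
    exec W (Assign x e) s (1 + acost e) (s\<lparr>regs := (regs s)(x := aval e s)\<rparr>)"
| Store: "aval i s \<le> W \<Longrightarrow> aval e s \<le> W \<Longrightarrow>
    exec W (Store a i e) s (1 + acost i + acost e)
      (s\<lparr>arrs := (arrs s)(a := (arrs s a)(aval i s := aval e s))\<rparr>)"
| Seq: "exec W c1 s t1 s' \<Longrightarrow> exec W c2 s' t2 s'' \<Longrightarrow> exec W (Seq c1 c2) s (t1 + t2) s''"
| CondT: "bval b s \<Longrightarrow> exec W c1 s t s' \<Longrightarrow> exec W (Cond b c1 c2) s (1 + bcost b + t) s'"
| CondF: "\<not> bval b s \<Longrightarrow> exec W c2 s t s' \<Longrightarrow> exec W (Cond b c1 c2) s (1 + bcost b + t) s'"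
| WhileF: "\<not> bval b s \<Longrightarrow> exec W (While b c) s (1 + bcost b) s"
| WhileT: "bval b s \<Longrightarrow> exec W c s t1 s' \<Longrightarrow> exec W (While b c) s' t2 s'' \<Longrightarrow>
    exec W (While b c) s (1 + bcost b + t1 + t2) s''"

inductive_cases SkipE: "exec W Skip s t s'"
inductive_cases AssignE: "exec W (Assign x e) s t s'"
inductive_cases StoreE: "exec W (Store a i e) s t s'"
inductive_cases SeqE: "exec W (Seq c1 c2) s t s'"
inductive_cases CondE: "exec W (Cond b c1 c2) s t s'"
inductive_cases WhileE: "exec W (While b c) s t s'"

lemma exec_deterministic:
  "exec W c s t s' \<Longrightarrow> exec W c s u r \<Longrightarrow> u = t \<and> r = s'"
proof (induction arbitrary: u r rule: exec.induct)
  case Skip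
  then show ?case by (auto elim: SkipE)
next
  case Assign
  then show ?case by (auto elim: AssignE)
next
  case Store
  then show ?case by (auto elim: StoreE)
next
  case (Seq c1 s t1 s' c2 t2 s'')
  from Seq.prems show ?case
    by (rule SeqE) (metis Seq.IH)
next
  case (CondT b s c1 t s' c2)
  from CondT.prems show ?case
    by (rule CondE) (use CondT.hyps in \<open>auto dest: CondT.IH\<close>)
next
  case (CondF b s c2 t s' c1)
  from CondF.prems show ?case
    by (rule CondE) (use CondF.hyps in \<open>auto dest: CondF.IH\<close>)
next
  case (WhileF b s c)
  from WhileF.prems show ?case
    by (rule WhileE) (simp_all add: WhileF.hyps)
next
  case (WhileT b s c t1 s' t2 s'')
  from WhileT.prems show ?case
  proof (rule WhileE)
    assume "\<not> bval b s"
    then show ?thesis using WhileT.hyps by simp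
  next
    fix u1 r' u2
    assume "u = Suc (bcost b + u1 + u2)" and "exec W c s u1 r'" "exec W (While b c) r' u2 r"
    then show ?thesis using WhileT.IH(1)[of u1 r'] WhileT.IH(2)[of u2 r] by simp
  qed
qed


section \<open>Input and output\<close>

text \<open>
  \<open>L ! v\<close> lists the neighbours of vertex \<open>v\<close>, each once, in arbitrary order.
\<close>

definition adjacency_lists :: "nat pair_pre_digraph \<Rightarrow> nat list list \<Rightarrow> bool" where
  "adjacency_lists G L \<longleftrightarrow>
     pverts G = {..<length L} \<and>
     (\<forall>v<length L. distinct (L ! v) \<and> set (L ! v) = {u. (v, u) \<in> parcs G})"

text \<open>
  Registers 0, 1, 2 hold the number of vertices and the two integers. Array 1 holds the
  concatenation of the adjacency lists and array 0 their starting positions, so that the list of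
  \<open>v\<close> occupies the positions from \<open>arrs s 0 v\<close> up to, but excluding, \<open>arrs s 0 (v + 1)\<close>. All other
  memory is zero.
\<close>

definition input_state :: "nat list list \<Rightarrow> nat \<Rightarrow> nat \<Rightarrow> state" where
  "input_state L pA pB = \<lparr>
     regs = (\<lambda>_. 0)(0 := length L, 1 := pA, 2 := pB),
     arrs = (\<lambda>_ _. 0)(
       0 := (\<lambda>v. if v \<le> length L then length (concat (take v L)) else 0),
       1 := (\<lambda>i. if i < length (concat L) then concat L ! i else 0)) \<rparr>"

text \<open>
  The output is the characteristic function of the second part, in array 2.
\<close>

definition outputs_partition :: "state \<Rightarrow> nat set \<Rightarrow> nat set \<Rightarrow> nat set \<Rightarrow> bool" where
  "outputs_partition s V A B \<longleftrightarrow>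
     A \<union> B = V \<and> A \<inter> B = {} \<and> (\<forall>v\<in>A. arrs s 2 v = 0) \<and> (\<forall>v\<in>B. arrs s 2 v = 1)"

end

theory Submission
  imports Defs
begin

text \<open>
  Let \<open>v\<close> be a vertex such that \<open>G - v\<close> is connected, for instance the last vertex of a
  breadth-first search. Colouring greedily towards \<open>v\<close> leaves only \<open>v\<close> (the hole) uncoloured, and
  \<open>v\<close> is stuck only if it is tight: it has exactly \<open>pA + 1\<close> neighbours in \<open>A\<close> and \<open>pB + 1\<close> in \<open>B\<close>. A
  tight hole can be moved to any neighbour, whose colour it takes; if it ever is not tight, it can
  be coloured.

  Move the hole around an induced cycle through \<open>v\<close>. If it stays tight for two rounds, then
  the colours along the cycle are 2-periodic. If moreover the two neighbours of \<open>v\<close> on the cycle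
  have different colours, then the colours alternate, and a further round exchanges the two colours
  on the cycle. This exchange contradicts the 2-periodicity, or the tightness, along a second
  induced cycle through \<open>v\<close> that shares with the first one a proper part besides \<open>v\<close>. Hence a
  constant number of rounds along two such cycles succeeds.

  Let \<open>N\<close> be the neighbourhood of \<open>v\<close>; it is not a clique. If \<open>N\<close> contains an edge between
  the two colours, the first cycle is a triangle, and the second one comes from a shortest path
  in \<open>G - v\<close> between such an edge, together with the common neighbours of its ends in \<open>N\<close>, and
  the rest of \<open>N\<close>. Otherwise the first cycle comes from a shortest path between the two colours
  of \<open>N\<close>, and the second one from a shortest path between the first cycle and the rest of \<open>N\<close>.
\<close>

section \<open>Degenerate partitions with a hole\<close>

text \<open>A round along a cycle of length k rotates the k - 1 colours off the hole by one place.
  Two tight rounds give two equations at each vertex whose off-cycle terms agree; their difference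
  is the 2-periodicity, and then two rounds restore the colouring. Hence the schedule c, c, d, d, c,
  d, d: the first two pairs change nothing off the hole, the single round exchanges the colours on
  c, and the last pair tests d again.

  The exchange is visible on d only if d meets c suitably: of two vertices at distance two along d
  just one is on c, or d is a triangle whose vertex off c has just one neighbour on c besides v.
  Securing this without chords is the hard part. A search whose parents are first neighbours in the
  queue yields induced paths and also makes the order of the sources matter.

  If no neighbourhood is a clique, an edge of N between the colours can be chosen with an end that
  misses a vertex of N; and \<Delta> \<ge> 3 puts a vertex of N outside the first cycle in the other
  case. Both guarantee that the second search finds a new vertex of N.

  A round counts neighbours at each of at most n positions. By regularity this costs O(n \<Delta>) =
  O(m).\<close>

locale regular_adjacency =
  fixes L :: "nat list list" and \<Delta> pA pB :: nat
  assumes length_adj: "u < length L \<Longrightarrow> length (L ! u) = \<Delta>"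
    and distinct_adj: "u < length L \<Longrightarrow> distinct (L ! u)"
    and adj_less: "u < length L \<Longrightarrow> y \<in> set (L ! u) \<Longrightarrow> y < length L"
    and adj_irrefl: "u < length L \<Longrightarrow> u \<notin> set (L ! u)"
    and adj_sym: "u < length L \<Longrightarrow> y \<in> set (L ! u) \<Longrightarrow> u \<in> set (L ! y)"
    \<comment> \<open>Connectedness in the form in which a finished search uses it: the set of
      reached vertices is closed under neighbours.\<close>
    and closed_eq_all: "S \<subseteq> {..<length L} \<Longrightarrow> S \<noteq> {} \<Longrightarrow>
          (\<And>u y. u \<in> S \<Longrightarrow> y \<in> set (L ! u) \<Longrightarrow> y \<in> S) \<Longrightarrow> S = {..<length L}"
    \<comment> \<open>This is where \<open>G\<close> differing from the complete graph
      enters.\<close>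
    and adj_not_clique: "u < length L \<Longrightarrow>
          \<exists>x\<in>set (L ! u). \<exists>z\<in>set (L ! u). x \<noteq> z \<and> z \<notin> set (L ! x)"
    and degree_sum: "pA + pB + 2 = \<Delta>"
    and degree_ge: "3 \<le> \<Delta>"
    and nonempty: "L \<noteq> []"
begin

abbreviation n :: nat where "n \<equiv> length L"

abbreviation nb :: "nat \<Rightarrow> nat set" where "nb u \<equiv> set (L ! u)"

lemma card_nb: "u < n \<Longrightarrow> card (nb u) = \<Delta>"
  by (simp add: distinct_card distinct_adj length_adj)

lemma adj_commute: "u < n \<Longrightarrow> y < n \<Longrightarrow> y \<in> nb u \<longleftrightarrow> u \<in> nb y"
  using adj_sym by blast

lemma degree_less: "\<Delta> < n"
proof -
  have 0: "0 < n" using nonempty by simp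
  have "nb 0 \<subseteq> {..<n} - {0}" using adj_less[OF 0] adj_irrefl[OF 0] by auto
  from card_mono[OF _ this] card_nb[OF 0] 0 have "\<Delta> \<le> n - 1" by simp
  then show ?thesis using 0 by linarith
qed

text \<open>Degeneracy of an induced subgraph, tested on vertex sets only: removing edges lowers
  degrees, so induced subgraphs are the worst case.\<close>

definition degen :: "nat \<Rightarrow> nat set \<Rightarrow> bool" where
  "degen p S \<longleftrightarrow> (\<forall>T\<subseteq>S. T \<noteq> {} \<longrightarrow> (\<exists>u\<in>T. card (T \<inter> nb u) \<le> p))"

lemma degen_mono: "degen p S \<Longrightarrow> T \<subseteq> S \<Longrightarrow> degen p T"
  unfolding degen_def by blast

lemma degen_empty: "degen p {}"
  by (simp add: degen_def)

text \<open>A subset containing \<open>h\<close> has \<open>h\<close> itself as its vertex of low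
  degree; any other subset already lies in \<open>S\<close>.\<close>

lemma degen_insert:
  assumes "degen p S" "h < n" "card (S \<inter> nb h) \<le> p"
  shows "degen p (insert h S)"
  unfolding degen_def
proof (intro allI impI)
  fix T assume T: "T \<subseteq> insert h S" "T \<noteq> {}"
  show "\<exists>u\<in>T. card (T \<inter> nb u) \<le> p"
  proof (cases "h \<in> T")
    case True
    have "T \<inter> nb h \<subseteq> S \<inter> nb h" using T adj_irrefl[OF assms(2)] by auto
    from card_mono[OF _ this] assms(3) have "card (T \<inter> nb h) \<le> p" by simp
    with True show ?thesis by blast
  next
    case False
    with T assms(1) show ?thesis unfolding degen_def by blast
  qed
qed

text \<open>A sum of values rather than a cardinality: it counts the neighbours of colour 1, the
  program accumulates it, and it is linear in the colouring, so tightness conditions can be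
  subtracted.\<close>

definition cnt :: "(nat \<Rightarrow> nat) \<Rightarrow> nat \<Rightarrow> nat" where
  "cnt x u = sum_list (map x (L ! u))"

lemma cnt_eq_sum: "u < n \<Longrightarrow> cnt x u = (\<Sum>y\<in>nb u. x y)"
  unfolding cnt_def by (simp add: sum_list_distinct_conv_sum_set distinct_adj)

definition part :: "(nat \<Rightarrow> nat) \<Rightarrow> nat \<Rightarrow> nat set" where
  "part x k = {u. u < n \<and> x u = k}"

text \<open>Colour 0 stands for \<open>A\<close> and colour 1 for \<open>B\<close>.\<close>

definition full :: "(nat \<Rightarrow> nat) \<Rightarrow> bool" where
  "full x \<longleftrightarrow> (\<forall>u<n. x u \<le> 1) \<and> degen pA (part x 0) \<and> degen pB (part x 1)"

text \<open>The array keeps a stale value at the hole \<open>h\<close>, so \<open>h\<close> is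
  removed from both parts.\<close>

definition valid :: "(nat \<Rightarrow> nat) \<Rightarrow> nat \<Rightarrow> bool" where
  "valid x h \<longleftrightarrow> (\<forall>u<n. x u \<le> 1) \<and> degen pA (part x 0 - {h}) \<and> degen pB (part x 1 - {h})"

lemma card_part1:
  assumes "h < n" "\<forall>u<n. x u \<le> 1"
  shows "card (part x 1 \<inter> nb h) = cnt x h"
proof -
  have "cnt x h = (\<Sum>y\<in>nb h. if x y = 1 then 1 else 0)"
    unfolding cnt_eq_sum[OF assms(1)]
  proof (rule sum.cong[OF refl])
    fix y assume "y \<in> nb h"
    then have "x y \<le> 1" using assms adj_less by blast
    then show "x y = (if x y = 1 then 1 else 0)" by auto
  qed
  also have "\<dots> = card {y \<in> nb h. x y = 1}" by (simp add: sum.If_cases Int_def)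
  also have "{y \<in> nb h. x y = 1} = part x 1 \<inter> nb h"
    unfolding part_def using adj_less[OF assms(1)] by auto
  finally show ?thesis by simp
qed

lemma card_part0:
  assumes "h < n" "\<forall>u<n. x u \<le> 1"
  shows "card (part x 0 \<inter> nb h) + cnt x h = \<Delta>"
proof -
  have e: "nb h = (part x 0 \<inter> nb h) \<union> (part x 1 \<inter> nb h)"
  proof (intro equalityI subsetI)
    fix y assume y: "y \<in> nb h"
    with assms have "y < n" "x y \<le> 1" using adj_less by blast+
    then have "x y = 0 \<or> x y = 1" by linarith
    with y \<open>y < n\<close> show "y \<in> (part x 0 \<inter> nb h) \<union> (part x 1 \<inter> nb h)"
      by (auto simp: part_def)
  qed auto
  have "card (nb h) = card (part x 0 \<inter> nb h) + card (part x 1 \<inter> nb h)"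
    by (subst e, subst card_Un_disjoint) (auto simp: part_def)
  then show ?thesis using card_part1[OF assms] card_nb[OF assms(1)] by simp
qed

lemma full_place1:
  assumes "valid x h" "h < n" "cnt x h \<le> pB"
  shows "full (x(h := 1))"
proof -
  have x1: "\<forall>u<n. x u \<le> 1" using assms(1) by (simp add: valid_def)
  have "part (x(h := 1)) 0 = part x 0 - {h}" "part (x(h := 1)) 1 = insert h (part x 1 - {h})"
    using assms(2) by (auto simp: part_def)
  moreover have "card ((part x 1 - {h}) \<inter> nb h) \<le> pB"
  proof -
    have "(part x 1 - {h}) \<inter> nb h = part x 1 \<inter> nb h" using adj_irrefl[OF assms(2)] by auto
    then show ?thesis using card_part1[OF assms(2) x1] assms(3) by simp
  qed
  ultimately show ?thesis
    using assms(1,2) degen_insert by (simp add: full_def valid_def del: insert_Diff_single)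
qed

text \<open>At least \<open>pB + 2\<close> neighbours of colour 1 leave at most
  \<open>\<Delta> - (pB + 2) = pA\<close> of colour 0. With \<open>full_place1\<close>, the only
  count that blocks the hole is \<open>pB + 1\<close>.\<close>

lemma full_place0:
  assumes "valid x h" "h < n" "pB + 1 < cnt x h"
  shows "full (x(h := 0))"
proof -
  have x1: "\<forall>u<n. x u \<le> 1" using assms(1) by (simp add: valid_def)
  have "part (x(h := 0)) 1 = part x 1 - {h}" "part (x(h := 0)) 0 = insert h (part x 0 - {h})"
    using assms(2) by (auto simp: part_def)
  moreover have "card ((part x 0 - {h}) \<inter> nb h) \<le> pA"
  proof -
    have "(part x 0 - {h}) \<inter> nb h = part x 0 \<inter> nb h" using adj_irrefl[OF assms(2)] by auto
    then show ?thesis using card_part0[OF assms(2) x1] assms(3) degree_sum by simp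
  qed
  ultimately show ?thesis
    using assms(1,2) degen_insert by (simp add: full_def valid_def del: insert_Diff_single)
qed

text \<open>A tight hole has \<open>p + 1\<close> neighbours of the colour it takes over, and one of
  them is the new hole \<open>g\<close>, which leaves that part. So \<open>p\<close> remain and
  \<open>degen_insert\<close> applies.\<close>

lemma valid_move:
  assumes "valid x h" "h < n" "cnt x h = pB + 1" "g \<in> nb h"
  shows "valid (x(h := x g)) g"
proof -
  have x1: "\<forall>u<n. x u \<le> 1" using assms(1) by (simp add: valid_def)
  have g: "g < n" "g \<noteq> h" using adj_less adj_irrefl assms by blast+
  have c: "card (part x 1 \<inter> nb h) = pB + 1" "card (part x 0 \<inter> nb h) = pA + 1"
    using card_part0[OF assms(2) x1] card_part1[OF assms(2) x1] assms(3) degree_sum by auto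
  have ins: "degen p (insert h (part x k - {h} - {g}))"
    if "degen p (part x k - {h})" "card (part x k \<inter> nb h) = p + 1" "x g = k" for p k
  proof (rule degen_insert[OF _ assms(2)])
    show "degen p (part x k - {h} - {g})" using that(1) by (rule degen_mono) auto
    have "(part x k - {h} - {g}) \<inter> nb h = part x k \<inter> nb h - {g}"
      using adj_irrefl[OF assms(2)] by auto
    moreover have "g \<in> part x k \<inter> nb h" using g that assms(4) by (simp add: part_def)
    ultimately show "card ((part x k - {h} - {g}) \<inter> nb h) \<le> p"
      using that(2) by (simp add: card_Diff_singleton)
  qed
  have "x g = 0 \<or> x g = 1" using x1 g by (metis le_neq_implies_less less_one)
  then show ?thesis
  proof
    assume xg: "x g = 0"
    have "part (x(h := x g)) 0 - {g} = insert h (part x 0 - {h} - {g})"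
      "part (x(h := x g)) 1 - {g} = part x 1 - {h}"
      using g assms(2) xg by (auto simp: part_def)
    then show ?thesis using ins[of pA 0] assms(1) xg c x1 by (simp add: valid_def)
  next
    assume xg: "x g = 1"
    have "part (x(h := x g)) 1 - {g} = insert h (part x 1 - {h} - {g})"
      "part (x(h := x g)) 0 - {g} = part x 0 - {h}"
      using g assms(2) xg by (auto simp: part_def)
    then show ?thesis using ins[of pB 1] assms(1) xg c x1 by (simp add: valid_def)
  qed
qed

end

section \<open>Moving the hole around induced cycles\<close>

context regular_adjacency
begin

text \<open>
  The value of a colouring at the hole itself is meaningless; moving the hole from \<open>w j\<close> to
  \<open>w (Suc j)\<close> hands the colour of the latter to the former.
\<close>

primrec slide :: "(nat \<Rightarrow> nat) \<Rightarrow> (nat \<Rightarrow> nat) \<Rightarrow> nat \<Rightarrow> nat \<Rightarrow> nat" where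
  "slide x w 0 = x"
| "slide x w (Suc j) = (slide x w j)(w j := slide x w j (w (Suc j)))"

definition tight :: "(nat \<Rightarrow> nat) \<Rightarrow> (nat \<Rightarrow> nat) \<Rightarrow> nat \<Rightarrow> bool" where
  "tight x w k \<longleftrightarrow> (\<forall>j<k. cnt (slide x w j) (w j) = pB + 1)"

text \<open>An induced cycle of length \<open>k\<close>. The equation \<open>w k = w 0\<close>
  closes it, so that \<open>k\<close> slides bring the hole back to its start.\<close>

definition icycle :: "(nat \<Rightarrow> nat) \<Rightarrow> nat \<Rightarrow> bool" where
  "icycle w k \<longleftrightarrow> 3 \<le> k \<and> inj_on w {..<k} \<and> w k = w 0 \<and> (\<forall>i<k. w i < n) \<and>
     (\<forall>i<k. \<forall>j<k. w j \<in> nb (w i) \<longleftrightarrow>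
        j = Suc i \<or> i = Suc j \<or> i = 0 \<and> Suc j = k \<or> j = 0 \<and> Suc i = k)"

lemma icycle_second: "icycle w k \<Longrightarrow> w 1 \<noteq> w 0"
  unfolding icycle_def by (metis One_nat_def inj_on_eq_iff lessThan_iff less_le_trans
      zero_less_numeral one_less_numeral_iff semiring_norm(77) zero_neq_one)

lemma slide_other: "(\<And>i. i < j \<Longrightarrow> w i \<noteq> u) \<Longrightarrow> slide x w j u = x u"
  by (induction j) auto

lemma slide_less:
  assumes "inj_on w {..<k}"
  shows "j < k \<Longrightarrow> i < k \<Longrightarrow> slide x w j (w i) = (if i < j then x (w (Suc i)) else x (w i))"
proof (induction j arbitrary: i)
  case (Suc j)
  have "w i = w j \<longleftrightarrow> i = j" using assms Suc.prems by (auto simp: inj_on_def)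
  then show ?case using Suc by (auto simp: less_Suc_eq)
qed simp

text \<open>The last move hands \<open>w (k - 1)\<close> the value stored at \<open>w 0\<close>,
  which the first move had set to \<open>x (w 1)\<close>. So the colours at the positions 1 to k - 1
  are rotated cyclically by one place.\<close>

lemma slide_round:
  assumes "icycle w k" "i < k"
  shows "slide x w k (w i) = (if Suc i < k then x (w (Suc i)) else x (w 1))"
proof -
  obtain m where k: "k = Suc m" and m: "0 < m" using assms by (cases k) (auto simp: icycle_def)
  have inj: "inj_on w {..<k}" and w0: "w (Suc m) = w 0" using assms k by (auto simp: icycle_def)
  have "w i = w m \<longleftrightarrow> i = m" using inj assms(2) k by (auto simp: inj_on_def)
  then show ?thesis
    using slide_less[OF inj, of m 0 x] slide_less[OF inj, of m i x] assms(2) k m w0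
    by (auto simp: less_Suc_eq)
qed

lemma slide_off: "u \<notin> w ` {..<k} \<Longrightarrow> j \<le> k \<Longrightarrow> slide x w j u = x u"
  by (rule slide_other) auto

text \<open>The contribution of the neighbours outside the cycle. Sliding along the cycle never
  changes it, so it cancels between two rounds.\<close>

definition off :: "(nat \<Rightarrow> nat) \<Rightarrow> (nat \<Rightarrow> nat) \<Rightarrow> nat \<Rightarrow> nat \<Rightarrow> nat" where
  "off x w k u = (\<Sum>y\<in>nb u - w ` {..<k}. x y)"

lemma off_cong: "(\<And>y. y \<in> nb u \<Longrightarrow> y \<notin> w ` {..<k} \<Longrightarrow> x y = x' y) \<Longrightarrow> off x w k u = off x' w k u"
  unfolding off_def by (rule sum.cong) auto

text \<open>Chordlessness enters here: a vertex of an induced cycle has just its two cyclic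
  neighbours on the cycle.\<close>

lemma cnt_cycle:
  assumes c: "icycle w k" and j: "j < k"
  shows "cnt y (w j) = y (w (if j = 0 then k - 1 else j - 1)) + y (w (Suc j)) + off y w k (w j)"
proof -
  define p where "p = (if j = 0 then k - 1 else j - 1)"
  define s where "s = (if Suc j = k then 0 else Suc j)"
  have k3: "3 \<le> k" and inj: "inj_on w {..<k}" and wk: "w k = w 0" and wn: "w j < n"
    and adj: "\<And>i. i < k \<Longrightarrow> w i \<in> nb (w j) \<longleftrightarrow>
        i = Suc j \<or> j = Suc i \<or> j = 0 \<and> Suc i = k \<or> i = 0 \<and> Suc j = k"
    using c j by (auto simp: icycle_def)
  have ps: "p < k" "s < k" "p \<noteq> s" using j k3 by (auto simp: p_def s_def split: if_splits)
  have ws: "w s = w (Suc j)" using wk by (auto simp: s_def)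
  have "nb (w j) \<inter> w ` {..<k} = {w p, w s}"
  proof (intro equalityI subsetI)
    fix y assume "y \<in> nb (w j) \<inter> w ` {..<k}"
    then obtain i where "i < k" "y = w i" "w i \<in> nb (w j)" by auto
    then show "y \<in> {w p, w s}" using adj[of i] j by (auto simp: p_def s_def)
  next
    fix y assume "y \<in> {w p, w s}"
    moreover have "w p \<in> nb (w j)" using adj[OF ps(1)] j k3 by (auto simp: p_def)
    moreover have "w s \<in> nb (w j)" using adj[OF ps(2)] j by (auto simp: s_def)
    ultimately show "y \<in> nb (w j) \<inter> w ` {..<k}" using ps by auto
  qed
  moreover have "w p \<noteq> w s" using inj ps by (auto simp: inj_on_def)
  ultimately have "(\<Sum>u\<in>nb (w j) \<inter> w ` {..<k}. y u) = y (w p) + y (w s)" by simp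
  moreover have "(\<Sum>u\<in>nb (w j). y u) = (\<Sum>u\<in>nb (w j) \<inter> w ` {..<k}. y u) + off y w k (w j)"
    unfolding off_def by (rule sum.Int_Diff) simp
  ultimately show ?thesis using cnt_eq_sum[OF wn] ws by (simp add: p_def)
qed

lemma tight_first:
  assumes c: "icycle w k" and t: "tight x w k"
  shows "x (w (k - 1)) + x (w 1) + off x w k (w 0) = pB + 1"
proof -
  have k: "0 < k" using c by (simp add: icycle_def)
  then have "cnt x (w 0) = pB + 1" using t by (auto simp: tight_def dest!: spec[of _ 0])
  then show ?thesis using cnt_cycle[OF c k, of x] by simp
qed

text \<open>When the hole reaches \<open>w j\<close>, its predecessor already holds
  \<open>x (w j)\<close>, while its successor still holds its own colour. The last position is
  excluded because its successor \<open>w 0\<close> has changed.\<close>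

lemma tight_middle:
  assumes c: "icycle w k" and t: "tight x w k" and j: "0 < j" "Suc j < k"
  shows "x (w j) + x (w (Suc j)) + off x w k (w j) = pB + 1"
proof -
  have inj: "inj_on w {..<k}" using c by (simp add: icycle_def)
  have "cnt (slide x w j) (w j) = pB + 1" using t j by (simp add: tight_def)
  moreover have "slide x w j (w (j - 1)) = x (w j)" "slide x w j (w (Suc j)) = x (w (Suc j))"
    using slide_less[OF inj, of j "j - 1" x] slide_less[OF inj, of j "Suc j" x] j by auto
  moreover have "off (slide x w j) w k (w j) = off x w k (w j)"
    by (rule off_cong) (use slide_off j in auto)
  ultimately show ?thesis using cnt_cycle[OF c, of j "slide x w j"] j by simp
qed

section \<open>Consequences of two consecutive tight rounds\<close>

context
  fixes w :: "nat \<Rightarrow> nat" and k :: nat and x :: "nat \<Rightarrow> nat"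
  assumes c: "icycle w k" and t1: "tight x w k" and t2: "tight (slide x w k) w k"
begin

private lemma off_round: "off (slide x w k) w k u = off x w k u"
  by (rule off_cong) (simp add: slide_off)

text \<open>The equation of \<open>tight_middle\<close> at \<open>w j\<close> reads
  \<open>x (w j) + x (w (j + 1))\<close> in the first round and
  \<open>x (w (j + 1)) + x (w (j + 2))\<close> in the second, with the same remainder.\<close>

lemma two_periodic:
  assumes "0 < j" "j + 2 < k"
  shows "x (w j) = x (w (j + 2))"
  using tight_middle[OF c t1, of j] tight_middle[OF c t2, of j] assms
    slide_round[OF c, of j x] slide_round[OF c, of "Suc j" x] off_round by simp

text \<open>This and \<open>two_periodic_last\<close> are the wrap-around cases: with them the k - 1
  colours off the hole are 2-periodic as a cyclic sequence.\<close>

lemma two_periodic_first: "x (w 2) = x (w (k - 1))"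
proof -
  have "3 \<le> k" using c by (simp add: icycle_def)
  then show ?thesis
    using tight_first[OF c t1] tight_first[OF c t2] slide_round[OF c, of 1 x]
      slide_round[OF c, of "k - 1" x] off_round by (simp add: numeral_2_eq_2)
qed

lemma two_periodic_last: "x (w (k - 2)) = x (w 1)"
proof -
  have k: "3 \<le> k" using c by (simp add: icycle_def)
  then have "Suc (k - 2) = k - 1" by simp
  then show ?thesis
    using tight_middle[OF c t1, of "k - 2"] tight_middle[OF c t2, of "k - 2"] k
      slide_round[OF c, of "k - 2" x] slide_round[OF c, of "k - 1" x] off_round by simp
qed

text \<open>Two rounds rotate the colours by two places, and a rotation by a period is the
  identity.\<close>

lemma slide_two_rounds:
  assumes "u \<noteq> w 0"
  shows "slide (slide x w k) w k u = x u"
proof (cases "u \<in> w ` {..<k}")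
  case True
  then obtain i where i: "i < k" "u = w i" "0 < i" using assms by (metis gr0I imageE lessThan_iff)
  have k: "3 \<le> k" using c by (simp add: icycle_def)
  consider "i + 2 < k" | "i = k - 2" | "i = k - 1" using i by linarith
  then show ?thesis
  proof cases
    case 1
    then show ?thesis
      using i two_periodic[of i] slide_round[OF c, of i "slide x w k"] slide_round[OF c, of "Suc i" x]
      by simp
  next
    case 2
    then have "Suc i < k" "\<not> Suc (Suc i) < k" using k by auto
    then show ?thesis
      using 2 i k two_periodic_last slide_round[OF c, of i "slide x w k"] slide_round[OF c, of "Suc i" x]
      by simp
  next
    case 3
    then show ?thesis
      using i k two_periodic_first slide_round[OF c, of i "slide x w k"] slide_round[OF c, of 1 x]
      by (simp add: numeral_2_eq_2)
  qed
qed (simp add: slide_off)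

text \<open>\<open>two_periodic_first\<close> turns the assumption into
  \<open>x (w 1) \<noteq> x (w 2)\<close>, which 2-periodicity carries along the cycle.\<close>

lemma alternating:
  assumes "x (w 1) \<noteq> x (w (k - 1))"
  shows "0 < i \<Longrightarrow> Suc i < k \<Longrightarrow> x (w (Suc i)) \<noteq> x (w i)"
proof (induction i)
  case (Suc i)
  show ?case
  proof (cases "i = 0")
    case True
    then show ?thesis using assms two_periodic_first by (simp add: numeral_2_eq_2)
  next
    case False
    then show ?thesis using Suc two_periodic[of i] by simp
  qed
qed simp

text \<open>Rotating an alternating sequence by one place changes every colour; at the last position
  the assumption on the two ends gives the change. As there are two colours, the round exchanges
  them.\<close>

lemma slide_flip:
  assumes "x (w 1) \<noteq> x (w (k - 1))" "\<And>u. u < n \<Longrightarrow> x u \<le> 1" "0 < i" "i < k"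
  shows "slide x w k (w i) \<noteq> x (w i)"
proof (cases "Suc i < k")
  case True
  then show ?thesis using slide_round[OF c, of i x] alternating[OF assms(1)] assms by simp
next
  case False
  then have "i = k - 1" using assms by simp
  then show ?thesis using slide_round[OF c, of i x] assms by simp
qed

end

text \<open>The first move overwrites the value at the hole with that of another vertex, so later
  values do not depend on it.\<close>

lemma slide_hole:
  assumes "\<And>u. u \<noteq> w 0 \<Longrightarrow> x u = x' u" "w 1 \<noteq> w 0"
  shows "slide x w (Suc j) = slide x' w (Suc j)"
proof (induction j)
  case 0
  then show ?case using assms by auto
next
  case (Suc j)
  then show ?case by (simp only: slide.simps(2)[of _ _ "Suc j"])
qed

text \<open>By \<open>slide_two_rounds\<close>, \<open>x2\<close> and \<open>x4\<close> agree with
  \<open>x\<close> off the hole, so \<open>x5\<close> is \<open>x\<close> with the colours of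
  \<open>c\<close> exchanged. Both \<open>x2\<close> and \<open>x5\<close> satisfy the conditions
  that two tight rounds along \<open>d\<close> impose, but \<open>cond\<close> makes the exchange
  alter one side of such a condition only.\<close>

lemma not_all_rounds_tight:
  assumes c: "icycle c k" and d: "icycle d r" and v: "d 0 = c 0"
    and x1: "\<And>u. u < n \<Longrightarrow> x u \<le> 1" and ends: "x (c 1) \<noteq> x (c (k - 1))"
    and t1: "tight x c k" and t2: "tight (slide x c k) c k"
    and x2: "x2 = slide (slide x c k) c k"
    and t3: "tight x2 d r" and t4: "tight (slide x2 d r) d r"
    and x4: "x4 = slide (slide x2 d r) d r" and x5: "x5 = slide x4 c k"
    and t5: "tight x5 d r" and t6: "tight (slide x5 d r) d r"
    and cond: "(\<exists>i. 0 < i \<and> i + 2 < r \<and> (d i \<in> c ` {..<k}) \<noteq> (d (i + 2) \<in> c ` {..<k})) \<or>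
      r = 3 \<and> d 1 \<notin> c ` {..<k} \<and> d 2 \<in> c ` {..<k} \<and> nb (d 1) \<inter> c ` {..<k} = {c 0, d 2}"
  shows False
proof -
  have e2: "x2 u = x u" if "u \<noteq> c 0" for u
    unfolding x2 using slide_two_rounds[OF c t1 t2] that by simp
  have e4: "x4 u = x u" if "u \<noteq> c 0" for u
    unfolding x4 using slide_two_rounds[OF d t3 t4] that e2 v by simp
  have k: "3 \<le> k" and c1: "c 1 \<noteq> c 0" using c icycle_second by (auto simp: icycle_def)
  have e5: "x5 = slide x c k"
    unfolding x5 using slide_hole[of c x4 x "k - 1", OF e4 c1] k by simp
  have flip: "x5 u \<noteq> x u" if "u \<in> c ` {..<k}" "u \<noteq> c 0" for u
  proof -
    obtain i where "i < k" "u = c i" "0 < i" using \<open>u \<in> c ` {..<k}\<close> \<open>u \<noteq> c 0\<close> by (metis gr0I imageE lessThan_iff)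
    then show ?thesis unfolding e5 using slide_flip[OF c t1 t2 ends x1] by simp
  qed
  have same: "x5 u = x u" if "u \<notin> c ` {..<k}" for u
    unfolding e5 using that by (simp add: slide_off)
  have dinj: "d i \<noteq> c 0" if "0 < i" "i < r" for i
    using d that v by (metis icycle_def inj_on_eq_iff lessThan_iff less_nat_zero_code neq0_conv order_less_trans)
  have dn: "d i < n" if "i < r" for i using d that by (simp add: icycle_def)
  from cond show False
  proof
    assume "\<exists>i. 0 < i \<and> i + 2 < r \<and> (d i \<in> c ` {..<k}) \<noteq> (d (i + 2) \<in> c ` {..<k})"
    then obtain i where i: "0 < i" "i + 2 < r" "(d i \<in> c ` {..<k}) \<noteq> (d (i + 2) \<in> c ` {..<k})"
      by blast
    have "x (d i) = x (d (i + 2))"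
      using two_periodic[OF d t3 t4 i(1,2)] e2 dinj[of i] dinj[of "i + 2"] i by simp
    moreover have "x5 (d i) = x5 (d (i + 2))" using two_periodic[OF d t5 t6 i(1,2)] .
    ultimately show False
      using i(3) flip[of "d i"] flip[of "d (i + 2)"] same[of "d i"] same[of "d (i + 2)"]
        dinj[of i] dinj[of "i + 2"] i by auto
  next
    assume r: "r = 3 \<and> d 1 \<notin> c ` {..<k} \<and> d 2 \<in> c ` {..<k} \<and> nb (d 1) \<inter> c ` {..<k} = {c 0, d 2}"
    have d12: "d 1 \<noteq> c 0" "d 2 \<noteq> c 0" using dinj r by auto
    have "x2 (d 1) + x2 (d 2) + off x2 d r (d 1) = pB + 1"
      using tight_middle[OF d t3, of 1] r by (simp add: numeral_2_eq_2)
    moreover have "x5 (d 1) + x5 (d 2) + off x5 d r (d 1) = pB + 1"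
      using tight_middle[OF d t5, of 1] r by (simp add: numeral_2_eq_2)
    moreover have "off x2 d r (d 1) = off x5 d r (d 1)"
    proof (rule off_cong)
      fix y assume y: "y \<in> nb (d 1)" "y \<notin> d ` {..<r}"
      \<comment> \<open>The two neighbours of \<open>d 1\<close> on \<open>c\<close> also lie on
        \<open>d\<close>. Its other neighbours are thus off \<open>c\<close> and keep their colours,
        so the exchange alters the count at \<open>d 1\<close> through \<open>d 2\<close>
        alone.\<close>
      have "c 0 \<in> d ` {..<r}" "d 2 \<in> d ` {..<r}" using r v by (auto intro!: image_eqI[of _ d 0])
      then have "y \<notin> {c 0, d 2}" using y by auto
      then have "y \<notin> c ` {..<k}" "y \<noteq> c 0" using y r by auto
      then show "x2 y = x5 y" using e2 same by simp
    qed
    moreover have "x2 (d 1) = x5 (d 1)" using e2 same r d12 by simp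
    moreover have "x2 (d 2) \<noteq> x5 (d 2)" using e2[of "d 2"] flip[of "d 2"] r d12 by auto
    ultimately show False by simp
  qed
qed

end

section \<open>Breadth-first search trees and the choice of the two cycles\<close>

context regular_adjacency
begin

text \<open>
  The parent of a vertex is its first neighbour in the queue. Hence the tree path from a vertex to
  a source is induced, and no vertex of the path before the last two is adjacent to a source.
\<close>

definition bfs_tree :: "(nat \<Rightarrow> nat) \<Rightarrow> (nat \<Rightarrow> nat) \<Rightarrow> nat \<Rightarrow> nat \<Rightarrow> bool" where
  "bfs_tree q p T t0 \<longleftrightarrow> inj_on q {..<T} \<and> (\<forall>i<T. q i < n) \<and> t0 \<le> T \<and>
     (\<forall>i. t0 \<le> i \<longrightarrow> i < T \<longrightarrow> p i < i \<and> q i \<in> nb (q (p i)) \<and> (\<forall>j<p i. q i \<notin> nb (q j)))"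

lemma bfs_treeD:
  assumes "bfs_tree q p T t0"
  shows "inj_on q {..<T}" "t0 \<le> T" "\<And>i. i < T \<Longrightarrow> q i < n"
    "\<And>i. t0 \<le> i \<Longrightarrow> i < T \<Longrightarrow> p i < i"
    "\<And>i. t0 \<le> i \<Longrightarrow> i < T \<Longrightarrow> q i \<in> nb (q (p i))"
    "\<And>i j. t0 \<le> i \<Longrightarrow> i < T \<Longrightarrow> j < p i \<Longrightarrow> q i \<notin> nb (q j)"
  using assms unfolding bfs_tree_def by blast+

text \<open>Connectedness of \<open>G - v\<close>, again by closed sets: \<open>S\<close> may have
  neighbours outside itself only at \<open>v\<close>.\<close>

definition noncut :: "nat \<Rightarrow> bool" where
  "noncut v \<longleftrightarrow> (\<forall>S. S \<subseteq> {..<n} - {v} \<longrightarrow> S \<noteq> {} \<longrightarrow> (\<forall>u\<in>S. nb u \<subseteq> S \<union> {v}) \<longrightarrow> S = {..<n} - {v})"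

text \<open>Parents precede their children in the queue, so the last vertex is nobody's parent. The
  tree without it still joins all other vertices to the root, and \<open>S\<close> contains a vertex
  exactly if it contains its parent.\<close>

lemma noncut_last:
  assumes t: "bfs_tree q p n 1" and all: "q ` {..<n} = {..<n}"
  shows "noncut (q (n - 1))"
  unfolding noncut_def
proof (intro allI impI)
  fix S assume S: "S \<subseteq> {..<n} - {q (n - 1)}" "S \<noteq> {}" "\<forall>u\<in>S. nb u \<subseteq> S \<union> {q (n - 1)}"
  note inj = bfs_treeD(1)[OF t] and qn = bfs_treeD(3)[OF t]
  have p: "p i < i \<and> q i \<in> nb (q (p i))" if "0 < i" "i < n" for i
  proof -
    have "1 \<le> i" using that(1) by simp
    then show ?thesis using bfs_treeD(4,5)[OF t _ that(2)] by (intro conjI)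
  qed
  have ne: "q i \<noteq> q (n - 1)" if "i < n - 1" for i
  proof
    assume "q i = q (n - 1)"
    moreover have "i \<in> {..<n}" "n - 1 \<in> {..<n}" using that by simp_all
    ultimately have "i = n - 1" by (rule inj_onD[OF inj])
    then show False using that by simp
  qed
  have step: "q i \<in> S \<longleftrightarrow> q (p i) \<in> S" if "0 < i" "i < n - 1" for i
  proof -
    have pi: "p i < i" "q i \<in> nb (q (p i))" using p[of i] that by simp_all
    have "q (p i) < n" by (rule qn) (use pi that in linarith)
    then have "q (p i) \<in> nb (q i)" by (rule adj_sym) (rule pi(2))
    moreover have "q i \<noteq> q (n - 1)" "q (p i) \<noteq> q (n - 1)" using ne pi(1) that by simp_all
    ultimately show ?thesis using S(3) pi(2) by blast
  qed
  have eq: "q i \<in> S \<longleftrightarrow> q 0 \<in> S" if "i < n - 1" for i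
    using that
  proof (induction i rule: less_induct)
    case (less i)
    show ?case
    proof (cases "i = 0")
      case False
      then have "p i < i" using p[of i] less.prems by simp
      then show ?thesis using step[of i] less.IH[of "p i"] less.prems False by simp
    qed simp
  qed
  have idx: "\<exists>i<n - 1. y = q i" if "y < n" "y \<noteq> q (n - 1)" for y
  proof -
    have "y \<in> q ` {..<n}" unfolding all using that(1) by simp
    then obtain i where "i < n" "y = q i" by auto
    moreover from this have "i \<noteq> n - 1" using that by auto
    ultimately show ?thesis by (intro exI[of _ i]) auto
  qed
  obtain y where "y \<in> S" using S(2) by blast
  moreover from this have "y < n" "y \<noteq> q (n - 1)" using S(1) by auto
  then obtain i where "i < n - 1" "y = q i" using idx by blast
  ultimately have q0: "q 0 \<in> S" using eq[of i] by simp
  have "y \<in> S" if y: "y < n" "y \<noteq> q (n - 1)" for y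
  proof -
    obtain i where "i < n - 1" "y = q i" using idx[OF y] by blast
    then show ?thesis using eq[of i] q0 by simp
  qed
  then show "S = {..<n} - {q (n - 1)}" using S(1) by blast
qed

lemma icycleI:
  assumes "3 \<le> r" "w 0 = v" "w r = v" "v < n"
    and "\<And>i. 0 < i \<Longrightarrow> i < r \<Longrightarrow> w i < n \<and> w i \<noteq> v"
    and "\<And>i j. 0 < i \<Longrightarrow> i < j \<Longrightarrow> j < r \<Longrightarrow> w i \<noteq> w j"
    and "\<And>i j. 0 < i \<Longrightarrow> i < j \<Longrightarrow> j < r \<Longrightarrow> w j \<in> nb (w i) \<longleftrightarrow> j = Suc i"
    and "\<And>i. 0 < i \<Longrightarrow> i < r \<Longrightarrow> w i \<in> nb v \<longleftrightarrow> i = 1 \<or> Suc i = r"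
  shows "icycle w r"
proof -
  have wn: "w i < n" if "i < r" for i
  proof (cases "i = 0")
    case True
    then show ?thesis using assms(2,4) by simp
  next
    case False
    then show ?thesis using assms(5) that by simp
  qed
  have ne: "w i \<noteq> w j" if "i < j" "j < r" for i j
  proof (cases "i = 0")
    case True
    have "w j \<noteq> v" using assms(5) that by simp
    then show ?thesis using True assms(2) by simp
  next
    case False
    then show ?thesis using assms(6) that by simp
  qed
  have adj: "w j \<in> nb (w i) \<longleftrightarrow> j = Suc i \<or> i = 0 \<and> Suc j = r" if "i < j" "j < r" for i j
  proof (cases "i = 0")
    case True
    then show ?thesis using assms(2) assms(8)[of j] that by auto
  next
    case False
    then show ?thesis using assms(7)[of i j] that by simp
  qed
  have "inj_on w {..<r}"
    by (rule inj_onI) (metis lessThan_iff linorder_neqE_nat ne)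
  moreover have "w j \<in> nb (w i) \<longleftrightarrow>
        j = Suc i \<or> i = Suc j \<or> i = 0 \<and> Suc j = r \<or> j = 0 \<and> Suc i = r" if "i < r" "j < r" for i j
  proof -
    consider "i < j" | "i = j" | "j < i" by linarith
    then show ?thesis
    proof cases
      case 1
      then show ?thesis using adj[of i j] that by auto
    next
      case 2
      then show ?thesis using adj_irrefl[OF wn] that assms(1) by auto
    next
      case 3
      have "w j \<in> nb (w i) \<longleftrightarrow> w i \<in> nb (w j)" using adj_commute wn that by blast
      also have "\<dots> \<longleftrightarrow> i = Suc j \<or> j = 0 \<and> Suc i = r" using adj 3 that by blast
      finally show ?thesis using 3 by auto
    qed
  qed
  moreover have "w r = w 0" using assms(2,3) by simp
  ultimately show ?thesis using assms(1) wn unfolding icycle_def by blast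
qed

end

text \<open>A search of \<open>G - v\<close> from the sources \<open>q 0\<close>, ...,
  \<open>q (t0 - 1)\<close>. Here \<open>k0\<close> is the queue position of the first neighbour of
  \<open>v\<close> that is not a source, and \<open>l\<close> is the length of its tree path to a
  source. As indices fall along this path, the choice of \<open>k0\<close> keeps its inner vertices
  away from \<open>v\<close>.\<close>

locale hole_tree =
  regular_adjacency +
  fixes q p :: "nat \<Rightarrow> nat" and T t0 v k0 l :: nat
  assumes tree: "bfs_tree q p T t0" and v: "v < n" and all: "q ` {..<T} = {..<n} - {v}"
    and k0: "t0 \<le> k0" "k0 < T" "q k0 \<in> nb v"
    and first: "\<And>i. t0 \<le> i \<Longrightarrow> i < k0 \<Longrightarrow> q i \<notin> nb v"
    and l: "(p ^^ l) k0 < t0" "\<And>a. a < l \<Longrightarrow> t0 \<le> (p ^^ a) k0"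

context hole_tree
begin

abbreviation pp :: "nat \<Rightarrow> nat" where "pp a \<equiv> (p ^^ a) k0"

lemma q_inj: "i < T \<Longrightarrow> j < T \<Longrightarrow> q i = q j \<longleftrightarrow> i = j"
  using tree unfolding bfs_tree_def by (meson inj_onD lessThan_iff)

lemma q_less: "i < T \<Longrightarrow> q i < n"
  using tree unfolding bfs_tree_def by blast

lemma q_neq: "i < T \<Longrightarrow> q i \<noteq> v"
  using all by blast

lemma t0_le: "t0 \<le> T"
  using tree unfolding bfs_tree_def by blast

lemma tree_p:
  assumes "t0 \<le> i" "i < T"
  shows "p i < i" "q i \<in> nb (q (p i))" "\<And>j. j < p i \<Longrightarrow> q i \<notin> nb (q j)"
  using bfs_treeD[OF tree] assms by blast+

lemma pp_le: "a \<le> l \<Longrightarrow> pp a \<le> k0"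
proof (induction a)
  case (Suc a)
  then have "pp a \<le> k0" "t0 \<le> pp a" using l(2)[of a] by auto
  then show ?case using tree_p(1)[of "pp a"] k0 by simp
qed simp

lemma pp_less_T: "a \<le> l \<Longrightarrow> pp a < T"
  using pp_le[of a] k0 by simp

lemma l_pos: "0 < l"
  using l(1) k0(1) by (cases l) auto

lemma pp_decr: "a < b \<Longrightarrow> b \<le> l \<Longrightarrow> pp b < pp a"
proof (induction b)
  case (Suc b)
  have "pp (Suc b) < pp b" using tree_p(1)[of "pp b"] l(2)[of b] pp_less_T[of b] Suc by simp
  then show ?case using Suc by (cases "a = b") auto
qed simp

lemma pp_adj:
  assumes "a < b" "b \<le> l"
  shows "q (pp b) \<in> nb (q (pp a)) \<longleftrightarrow> b = Suc a"
proof -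
  have a: "t0 \<le> pp a" "pp a < T" using l(2) pp_less_T assms by auto
  have "q (pp b) \<in> nb (q (pp a)) \<longleftrightarrow> q (pp a) \<in> nb (q (pp b))"
    using adj_commute q_less pp_less_T assms by simp
  also have "\<dots> \<longleftrightarrow> b = Suc a"
  proof
    assume "q (pp a) \<in> nb (q (pp b))"
    then have "\<not> pp b < p (pp a)" using tree_p(3)[OF a] by blast
    then show "b = Suc a" using pp_decr[of "Suc a" b] assms by fastforce
  next
    assume "b = Suc a"
    then show "q (pp a) \<in> nb (q (pp b))" using tree_p(2)[OF a] by simp
  qed
  finally show ?thesis .
qed

text \<open>A vertex has no neighbour before its parent in the queue, so a vertex adjacent to a
  source has a source as parent. In particular \<open>pp l\<close> is the earliest source adjacent
  to \<open>pp (l - 1)\<close>; this is why the order of the sources matters later.\<close>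

lemma source_adj:
  assumes "j < t0" "a < l" "q (pp a) \<in> nb (q j)"
  shows "a = l - 1" "pp l \<le> j"
proof -
  have a: "t0 \<le> pp a" "pp a < T" using l(2) pp_less_T assms by auto
  have "\<not> j < p (pp a)" using tree_p(3)[OF a] assms(3) by blast
  then have *: "pp (Suc a) \<le> j" by simp
  show "a = l - 1"
  proof (rule ccontr)
    assume "a \<noteq> l - 1"
    then have "Suc a < l" using assms(2) by simp
    then show False using l(2)[of "Suc a"] * assms(1) by simp
  qed
  then show "pp l \<le> j" using * assms(2) by simp
qed

lemma last_adj: "q (pp l) \<in> nb (q (pp (l - 1)))"
  using pp_adj[of "l - 1" l] l_pos by simp

lemma pp_nb: "a < l \<Longrightarrow> q (pp a) \<in> nb v \<longleftrightarrow> a = 0"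
  using first[of "pp a"] l(2)[of a] pp_decr[of 0 a] k0(3) by (cases "a = 0") auto

lemma k0_idx: "q i = q k0 \<Longrightarrow> i < T \<Longrightarrow> i = k0"
  using q_inj k0 by simp

definition tcyc :: "nat \<Rightarrow> nat" where
  "tcyc i = (if i = 0 \<or> i = l + 2 then v else q (pp (i - 1)))"

lemma icycle_tcyc:
  assumes "q (pp l) \<in> nb v"
  shows "icycle tcyc (l + 2)"
proof (rule icycleI[where v = v])
  show "3 \<le> l + 2" using l_pos by simp
  show "tcyc i < n \<and> tcyc i \<noteq> v" if "0 < i" "i < l + 2" for i
    using that q_less q_neq pp_less_T[of "i - 1"] by (auto simp: tcyc_def)
  show "tcyc i \<noteq> tcyc j" if "0 < i" "i < j" "j < l + 2" for i j
  proof -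
    have "i - 1 < j - 1" "j - 1 \<le> l" using that by auto
    then have "q (pp (i - 1)) \<noteq> q (pp (j - 1))"
      using q_inj[of "pp (i - 1)" "pp (j - 1)"] pp_less_T[of "i - 1"] pp_less_T[of "j - 1"]
        pp_decr[of "i - 1" "j - 1"] by simp
    then show ?thesis using that by (simp add: tcyc_def)
  qed
  show "tcyc j \<in> nb (tcyc i) \<longleftrightarrow> j = Suc i" if "0 < i" "i < j" "j < l + 2" for i j
    using that pp_adj[of "i - 1" "j - 1"] by (auto simp: tcyc_def)
  show "tcyc i \<in> nb v \<longleftrightarrow> i = 1 \<or> Suc i = l + 2" if "0 < i" "i < l + 2" for i
    using that pp_nb[of "i - 1"] assms by (cases "i = l + 1") (auto simp: tcyc_def)
qed (use v in \<open>auto simp: tcyc_def\<close>)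

end

section \<open>Pairs of cycles along which some round must fail to be tight\<close>

context regular_adjacency
begin

text \<open>
  One more round on \<open>c\<close> flips the colours of \<open>c\<close>. This destroys the 2-periodicity of \<open>d\<close> in the
  first case, and the tightness of the vertex \<open>d 1\<close> of the triangle \<open>d\<close> in the second.
\<close>

definition crossing :: "(nat \<Rightarrow> nat) \<Rightarrow> nat \<Rightarrow> (nat \<Rightarrow> nat) \<Rightarrow> nat \<Rightarrow> bool" where
  "crossing c k d r \<longleftrightarrow>
     (\<exists>i. 0 < i \<and> i + 2 < r \<and> (d i \<in> c ` {..<k}) \<noteq> (d (i + 2) \<in> c ` {..<k})) \<or>
     r = 3 \<and> d 1 \<notin> c ` {..<k} \<and> d 2 \<in> c ` {..<k} \<and> nb (d 1) \<inter> c ` {..<k} = {c 0, d 2}"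

definition good :: "nat \<Rightarrow> (nat \<Rightarrow> nat) \<Rightarrow> (nat \<Rightarrow> nat) \<Rightarrow> nat \<Rightarrow> (nat \<Rightarrow> nat) \<Rightarrow> nat \<Rightarrow> bool" where
  "good v x c k d r \<longleftrightarrow> icycle c k \<and> icycle d r \<and> c 0 = v \<and> d 0 = v \<and>
     x (c 1) \<noteq> x (c (k - 1)) \<and> crossing c k d r"

text \<open>This allows the search for a two-coloured edge \<open>w y\<close> of N to insist that
  \<open>w\<close> misses some vertex of N. Otherwise both ends of such an edge see all of N. Given
  nonadjacent \<open>a\<close> and \<open>z\<close> in N, the colour of \<open>a\<close> differs
  from that of \<open>w\<close> or of \<open>y\<close>, so \<open>a\<close> ends a two-coloured edge
  and must see \<open>z\<close>.\<close>

lemma no_mixed_edges: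
  assumes v: "v < n"
    and none: "\<And>w y z. w \<in> nb v \<Longrightarrow> y \<in> nb v \<Longrightarrow> y \<in> nb w \<Longrightarrow> x y \<noteq> x w \<Longrightarrow>
      z \<in> nb v \<Longrightarrow> z \<noteq> w \<Longrightarrow> z \<in> nb w"
    and wy: "w \<in> nb v" "y \<in> nb v" "y \<in> nb w"
  shows "x y = x w"
proof (rule ccontr)
  assume ne: "x y \<noteq> x w"
  have wn: "w < n" "y < n" using wy adj_less v by auto
  have wy': "w \<in> nb y" using adj_sym wn wy by simp
  have w: "z \<in> nb w" if "z \<in> nb v" "z \<noteq> w" for z using none[OF wy ne that] .
  have y: "z \<in> nb y" if "z \<in> nb v" "z \<noteq> y" for z
    by (rule none[OF wy(2,1) wy' _ that]) (use ne in simp)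
  obtain a z where a: "a \<in> nb v" "z \<in> nb v" "a \<noteq> z" "z \<notin> nb a"
    using adj_not_clique[OF v] by blast
  have an: "a < n" "z < n" using a adj_less v by auto
  have aw: "a \<noteq> w" "a \<noteq> y" using w[OF a(2)] y[OF a(2)] a(3,4) by blast+
  have wa: "w \<in> nb a" "y \<in> nb a" using adj_sym wn w[OF a(1) aw(1)] y[OF a(1) aw(2)] by blast+
  have "x w \<noteq> x a \<or> x y \<noteq> x a" using ne by auto
  then have "z \<in> nb a"
    using none[OF a(1) wy(1) wa(1) _ a(2)] none[OF a(1) wy(2) wa(2) _ a(2)] a(3) by blast
  then show False using a(4) by contradiction
qed

end

context hole_tree
begin

text \<open>On a path of length at least two, the source and the vertex two steps before it stand at
  the positions \<open>l + 1\<close> and \<open>l - 1\<close> of \<open>d\<close>, and only the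
  source is on \<open>c\<close>.\<close>

lemma crossing_long:
  assumes "2 \<le> l" "\<And>i. i \<le> l + 1 \<Longrightarrow> d i = tcyc i" "l + 1 < r"
    and "q (pp (l - 2)) \<notin> c ` {..<k}" "q (pp l) \<in> c ` {..<k}"
  shows "crossing c k d r"
proof -
  have "d (l - 1) = q (pp (l - 2))" "d (l - 1 + 2) = q (pp l)"
    using assms(1,2) by (auto simp: tcyc_def numeral_2_eq_2)
  then show ?thesis unfolding crossing_def using assms by (intro disjI1 exI[of _ "l - 1"]) simp
qed

definition tri :: "nat \<Rightarrow> nat \<Rightarrow> nat" where
  "tri u i = (if i = 1 then q (pp l) else if i = 2 then u else v)"

text \<open>The path ends in a source \<open>t\<close> that is \<open>w\<close>, \<open>w'\<close>
  or a common neighbour of both. Taking for \<open>u\<close> the one of \<open>w\<close>,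
  \<open>w'\<close> whose colour is not that of \<open>t\<close> makes \<open>v\<close>,
  \<open>t\<close>, \<open>u\<close> a triangle with differently coloured ends.\<close>

lemma good_triangle:
  assumes w: "w \<in> nb v" "w' \<in> nb v" "w' \<in> nb w" "x w \<noteq> x w'"
    and src: "2 \<le> t0" "q 0 = w" "q 1 = w'" "q ` {..<t0} = {w, w'} \<union> (nb v \<inter> nb w \<inter> nb w')"
    and u: "u = (if x (q (pp l)) = x w then w' else w)"
  shows "good v x (tri u) 3 tcyc (l + 2)"
proof -
  define t where "t = q (pp l)"
  have n: "w < n" "w' < n" using w adj_less v by auto
  have ww: "w \<in> nb w'" using adj_sym n w by simp
  have ts: "t \<in> q ` {..<t0}" using l(1) by (simp add: t_def)
  have tW: "t \<in> nb v" using ts src(4) w by auto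
  then have tn: "t < n" using adj_less v by blast
  have "t = w \<or> t = w' \<or> t \<in> nb w \<and> t \<in> nb w'" using ts src(4) by auto
  then have "t = w \<or> t = w' \<or> w \<in> nb t \<and> w' \<in> nb t" using adj_sym n by blast
  then have ut: "u \<in> nb t" using u w(3,4) ww by (auto simp: t_def)
  have uv: "u \<in> nb v" using u w by auto
  have un: "u < n" using uv adj_less v by blast
  have xu: "x t \<noteq> x u" using u w(4) by (auto simp: t_def)
  have vv: "t \<noteq> v" "u \<noteq> v" using tW uv adj_irrefl[OF v] by auto
  have c: "icycle (tri u) 3"
  proof (rule icycleI[where v = v])
    fix i :: nat assume i: "0 < i" "i < 3"
    then have "i = 1 \<or> i = 2" by auto
    then show "tri u i < n \<and> tri u i \<noteq> v" "(tri u i \<in> nb v) = (i = 1 \<or> Suc i = 3)"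
      using tn un vv tW uv by (auto simp: tri_def t_def)
  next
    fix i j :: nat assume "0 < i" "i < j" "j < 3"
    then have "i = 1" "j = 2" by auto
    then show "tri u i \<noteq> tri u j" "(tri u j \<in> nb (tri u i)) = (j = Suc i)"
      using xu ut by (auto simp: tri_def t_def)
  qed (use v in \<open>auto simp: tri_def\<close>)
  have d: "icycle tcyc (l + 2)" using icycle_tcyc tW by (simp add: t_def)
  have C: "tri u ` {..<3} = {v, t, u}"
    by (auto simp: tri_def t_def lessThan_Suc numeral_3_eq_3 numeral_2_eq_2)
  have us: "u \<in> q ` {..<t0}" using u src(4) by auto
  have off: "q (pp a) \<notin> {v, t, u}" if "a < l" for a
  proof -
    have a: "t0 \<le> pp a" "pp a < T" using l(2) pp_less_T that by auto
    have "q (pp a) \<noteq> q j" if "j < t0" for j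
      using q_inj[of "pp a" j] a that t0_le by auto
    then have "q (pp a) \<notin> q ` {..<t0}" by auto
    then show ?thesis using us ts q_neq[OF a(2)] by auto
  qed
  have "crossing (tri u) 3 tcyc (l + 2)"
  proof (cases "2 \<le> l")
    case True
    show ?thesis by (rule crossing_long[OF True]) (use off[of "l - 2"] True in \<open>auto simp: C t_def\<close>)
  next
    case False
    then have l1: "l = 1" using l_pos by simp
    have e: "tcyc 1 = q k0" "tcyc 2 = t" unfolding tcyc_def t_def using l1 by auto
    have kT: "k0 < T" "q k0 < n" using k0 q_less by auto
    \<comment> \<open>Since \<open>w\<close> and \<open>w'\<close> head the queue and
      \<open>pp l\<close> is the earliest source adjacent to \<open>q k0\<close>, an edge from
      \<open>q k0\<close> to \<open>u\<close> puts \<open>t\<close> among \<open>w\<close>,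
      \<open>w'\<close> as well. Then \<open>q k0\<close> is adjacent to \<open>v\<close>,
      \<open>w\<close> and \<open>w'\<close>, hence itself a source.\<close>
    have nu: "u \<notin> nb (q k0)"
    proof
      assume "u \<in> nb (q k0)"
      then have uk: "q k0 \<in> nb u" using adj_sym kT by blast
      have tk: "q k0 \<in> nb t" using last_adj l1 adj_sym kT by (simp add: t_def)
      have *: "pp l \<le> j" if "j < t0" "q k0 \<in> nb (q j)" for j
        using source_adj(2)[of j 0] that l1 by simp
      have u01: "u = q 0 \<or> u = q 1" using u src by auto
      then have pl: "pp l \<le> 1" using *[of 0] *[of 1] uk src(1) by auto
      moreover have "pp l \<noteq> 1" if "u = q 0"
        using *[of 0] uk that src(1) by auto
      ultimately have "t = w \<and> u = w' \<or> t = w' \<and> u = w"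
        using u01 src xu by (auto simp: t_def le_Suc_eq)
      then have "q k0 \<in> nb w \<inter> nb w'" using uk tk by auto
      then have "q k0 \<in> q ` {..<t0}" using k0 src(4) by auto
      then obtain j where "j < t0" "q j = q k0" by auto
      then show False using k0_idx[of j] k0(1) t0_le by simp
    qed
    have "nb (q k0) \<inter> {v, t, u} = {v, t}"
      using nu last_adj l1 k0(3) adj_sym v by (auto simp: t_def)
    moreover have "tri u 0 = v" by (simp add: tri_def)
    ultimately show ?thesis unfolding crossing_def C e using l1 off[of 0] by simp
  qed
  then show ?thesis unfolding good_def using c d xu by (simp add: tri_def tcyc_def t_def)
qed

text \<open>The first cycle when no edge of N joins the two colours. Its path leaves the sources, so
  it starts at a vertex of N of the other colour. By \<open>source_adj\<close> only its last vertex
  before the source can see a source; this gives the final claim.\<close>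

lemma mixed_tcyc:
  assumes src: "q ` {..<t0} = {y \<in> nb v. x y = 0}"
  shows "icycle tcyc (l + 2)" "x (tcyc 1) \<noteq> 0" "x (tcyc (l + 1)) = 0"
    "y \<in> nb v \<Longrightarrow> x y = 0 \<Longrightarrow> 0 < i \<Longrightarrow> i < l \<Longrightarrow> tcyc i \<notin> nb y"
proof -
  have ts: "q (pp l) \<in> {y \<in> nb v. x y = 0}" using l(1) src by auto
  then show "icycle tcyc (l + 2)" "x (tcyc (l + 1)) = 0" using icycle_tcyc by (auto simp: tcyc_def)
  have "q k0 \<noteq> q j" if "j < t0" for j using q_inj[of k0 j] k0 t0_le that by simp
  then have "q k0 \<notin> q ` {..<t0}" by auto
  then show "x (tcyc 1) \<noteq> 0" using src k0 l_pos by (auto simp: tcyc_def)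
  assume y: "y \<in> nb v" "x y = 0" and i: "0 < i" "i < l"
  then obtain j where "j < t0" "y = q j" using src by (metis (mono_tags, lifting) imageE lessThan_iff mem_Collect_eq)
  moreover have "i - 1 < l" "i - 1 \<noteq> l - 1" using i by auto
  ultimately show "tcyc i \<notin> nb y"
    using source_adj(1)[of j "i - 1"] i by (auto simp: tcyc_def)
qed

text \<open>Here the sources are the first cycle without \<open>v\<close>, in path order. The ear
  follows the tree path to the source \<open>pp l\<close> and continues along the first cycle, down
  the queue to \<open>q 0\<close>, which is adjacent to \<open>v\<close>.\<close>

definition ear :: "nat \<Rightarrow> nat" where
  "ear i = (if i = 0 \<or> i = l + 2 + pp l then v
     else if i \<le> l + 1 then q (pp (i - 1)) else q (pp l - (i - (l + 1))))"

text \<open>The first cycle with \<open>q 0\<close> replaced by \<open>q k0\<close>, traversed in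
  the opposite direction.\<close>

definition fan :: "nat \<Rightarrow> nat" where
  "fan i = (if i = 0 \<or> i = t0 + 1 then v else if i = 1 then q k0 else q (i - 1))"

context
  fixes c x :: "nat \<Rightarrow> nat"
  assumes c: "icycle c (Suc t0)" "c 0 = v"
    and src: "\<And>i. i < t0 \<Longrightarrow> q i = c (t0 - i)"
    and ends: "x (c t0) = 0" "x (c 1) \<noteq> 0"
    and far: "\<And>y i. y \<in> nb v \<Longrightarrow> x y = 0 \<Longrightarrow> 0 < i \<Longrightarrow> Suc i < t0 \<Longrightarrow> c i \<notin> nb y"
    and same: "\<And>y w. y \<in> nb v \<Longrightarrow> w \<in> nb v \<Longrightarrow> w \<in> nb y \<Longrightarrow> x w = x y"
begin

private lemma c_adj: "i \<le> t0 \<Longrightarrow> j \<le> t0 \<Longrightarrow> c j \<in> nb (c i) \<longleftrightarrow>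
    j = Suc i \<or> i = Suc j \<or> i = 0 \<and> j = t0 \<or> j = 0 \<and> i = t0"
  using c(1) unfolding icycle_def by auto

text \<open>With two sources the first cycle would be a triangle, and \<open>c 1\<close>,
  \<open>c 2\<close> an edge of N between the colours. Three sources make \<open>q 2\<close>
  available to the fan.\<close>

private lemma t0_ge: "3 \<le> t0"
proof (rule ccontr)
  assume "\<not> 3 \<le> t0"
  then have t: "t0 = 2" using c(1) by (auto simp: icycle_def)
  have "c 1 \<in> nb v" "c 2 \<in> nb v" "c 2 \<in> nb (c 1)"
    using c_adj[of 0 1] c_adj[of 0 2] c_adj[of 1 2] t c(2) by (simp_all add: numeral_2_eq_2)
  then show False using same[of "c 1" "c 2"] ends t by simp
qed

private lemma q_adj:
  assumes "i < t0" "j < t0"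
  shows "q j \<in> nb (q i) \<longleftrightarrow> j = Suc i \<or> i = Suc j"
proof -
  have "t0 - j = Suc (t0 - i) \<longleftrightarrow> i = Suc j" "t0 - i = Suc (t0 - j) \<longleftrightarrow> j = Suc i"
    "t0 - i \<noteq> 0" "t0 - j \<noteq> 0" "t0 - i \<le> t0" "t0 - j \<le> t0"
    using assms by linarith+
  then show ?thesis
    unfolding src[OF assms(1)] src[OF assms(2)] using c_adj[of "t0 - i" "t0 - j"] by metis
qed

private lemma q_nb: "i < t0 \<Longrightarrow> q i \<in> nb v \<longleftrightarrow> i = 0 \<or> Suc i = t0"
proof -
  assume i: "i < t0"
  have "t0 - i = Suc 0 \<longleftrightarrow> Suc i = t0" "t0 - i = t0 \<longleftrightarrow> i = 0" "t0 - i \<noteq> 0" "t0 - i \<le> t0"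
    using i by linarith+
  then show ?thesis unfolding src[OF i] using c_adj[of 0 "t0 - i"] c(2) by auto
qed

private lemma in_c: "y \<in> c ` {..<Suc t0} \<longleftrightarrow> y = v \<or> (\<exists>i<t0. y = q i)"
proof
  assume "y \<in> c ` {..<Suc t0}"
  then obtain i where i: "i \<le> t0" "y = c i" by (auto simp: less_Suc_eq_le)
  show "y = v \<or> (\<exists>i<t0. y = q i)"
  proof (cases "i = 0")
    case False
    then have "t0 - i < t0" "y = q (t0 - i)" using i src[of "t0 - i"] by auto
    then show ?thesis by blast
  qed (use i c in simp)
next
  assume "y = v \<or> (\<exists>i<t0. y = q i)"
  then show "y \<in> c ` {..<Suc t0}"
  proof
    assume "y = v"
    then show ?thesis by (intro image_eqI[of _ _ 0]) (simp_all add: c(2))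
  next
    assume "\<exists>i<t0. y = q i"
    then obtain i where "i < t0" "y = q i" by blast
    then show ?thesis by (intro image_eqI[of _ _ "t0 - i"]) (simp_all add: src)
  qed
qed

private lemma off_c: "t0 \<le> i \<Longrightarrow> i < T \<Longrightarrow> q i \<notin> c ` {..<Suc t0}"
  unfolding in_c using q_neq[of i] q_inj[of i] t0_le by (metis leD less_le_trans)

private lemma q_in_c: "i < t0 \<Longrightarrow> q i \<in> c ` {..<Suc t0}"
  unfolding in_c by blast

text \<open>Both \<open>q k0\<close> and \<open>q 0\<close> lie in N and are adjacent, so
  \<open>q k0\<close> inherits colour 0 from \<open>q 0 = c t0\<close>. Then \<open>far\<close>
  forbids most chords from \<open>q k0\<close> to the first cycle.\<close>

private lemma start_color:
  assumes "l = 1" "pp l = 0"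
  shows "x (q k0) = 0"
proof -
  have t: "0 < t0" using t0_ge by simp
  have "q 0 \<in> nb (q k0)" using last_adj assms by simp
  moreover have "q 0 \<in> nb v" using q_nb[OF t] by simp
  ultimately have "x (q 0) = x (q k0)" using same k0(3) by blast
  then show ?thesis using src[OF t] ends by simp
qed

private lemma start_far:
  assumes "l = 1" "pp l = 0" "1 < j" "j < t0"
  shows "q j \<notin> nb (q k0)"
  using far[OF k0(3) start_color[OF assms(1,2)], of "t0 - j"] src[of j] assms by simp

text \<open>The exceptional case: \<open>q k0\<close> sees both \<open>q 0\<close> and
  \<open>q 1\<close>, so the triangle on \<open>v\<close>, \<open>q k0\<close>, \<open>q 0\<close>
  fails the condition on its neighbours on \<open>c\<close>. The fan is chordless by
  \<open>start_far\<close>; its position 1 is off \<open>c\<close> and its position 3,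
  \<open>q 2\<close>, is on it.\<close>

lemma good_fan:
  assumes "l = 1" "pp l = 0" "q 1 \<in> nb (q k0)"
  shows "good v x c (Suc t0) fan (Suc t0)"
proof -
  have kT: "k0 < T" "t0 \<le> k0" using k0 by auto
  have "icycle fan (Suc t0)"
  proof (rule icycleI[where v = v])
    fix i assume i: "0 < i" "i < Suc t0"
    show "fan i < n \<and> fan i \<noteq> v"
      using i q_less q_neq kT by (auto simp: fan_def)
    show "fan i \<in> nb v \<longleftrightarrow> i = 1 \<or> Suc i = Suc t0"
      using i q_nb[of "i - 1"] k0 by (auto simp: fan_def)
  next
    fix i j assume ij: "0 < i" "i < j" "j < Suc t0"
    show "fan i \<noteq> fan j"
      using ij q_inj[of "i - 1" "j - 1"] q_inj[of k0 "j - 1"] kT by (auto simp: fan_def)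
    show "fan j \<in> nb (fan i) \<longleftrightarrow> j = Suc i"
    proof (cases "i = 1")
      case True
      then show ?thesis
        using ij start_far[OF assms(1,2), of "j - 1"] assms(3) by (cases "j = 2") (auto simp: fan_def)
    next
      case False
      then show ?thesis using ij q_adj[of "i - 1" "j - 1"] by (auto simp: fan_def)
    qed
  qed (use v t0_ge in \<open>auto simp: fan_def\<close>)
  moreover have "crossing c (Suc t0) fan (Suc t0)"
    unfolding crossing_def
  proof (intro disjI1 exI[of _ 1] conjI)
    have "fan 1 = q k0" "fan (1 + 2) = q 2" using t0_ge by (auto simp: fan_def numeral_2_eq_2)
    then show "(fan 1 \<in> c ` {..<Suc t0}) \<noteq> (fan (1 + 2) \<in> c ` {..<Suc t0})"
      using off_c[OF kT(2,1)] q_in_c[of 2] t0_ge by simp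
  qed (use t0_ge in auto)
  ultimately show ?thesis unfolding good_def using c ends by (simp add: fan_def)
qed

private lemma crossing_ear:
  assumes l1: "l = 1" and sp: "\<not> (pp l = 0 \<and> q 1 \<in> nb (q k0))"
    and d: "d 1 = q k0" "d 2 = q (pp l)"
    and r: "pp l = 0 \<or> Suc (pp l) = t0 \<Longrightarrow> r = 3"
      "0 < pp l \<Longrightarrow> Suc (pp l) < t0 \<Longrightarrow> 3 < r \<and> d 3 = q (pp l - 1)"
  shows "crossing c (Suc t0) d r"
proof -
  have kT: "k0 < T" "t0 \<le> k0" using k0 by auto
  have pl: "pp l < t0" using l(1) .
  show ?thesis
  proof (cases "0 < pp l \<and> Suc (pp l) < t0")
    case True
    then have "q (pp l - 1) \<in> c ` {..<Suc t0}" by (intro q_in_c) linarith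
    then show ?thesis
      unfolding crossing_def using True r(2) d off_c[OF kT(2,1)]
      by (intro disjI1 exI[of _ 1]) (simp add: numeral_3_eq_3)
  next
    case False
    then have e: "pp l = 0 \<or> Suc (pp l) = t0" using pl by auto
    have "j = pp l" if "j < t0" "q j \<in> nb (q k0)" for j
    proof -
      have "q k0 \<in> nb (q j)" using adj_sym q_less[OF kT(1)] that by blast
      then have "pp l \<le> j" using source_adj(2)[of j 0] that l1 by simp
      moreover have "j = 0" if p: "pp l = 0"
      proof -
        have "j \<noteq> 1" using sp p \<open>q j \<in> nb (q k0)\<close> by auto
        moreover have "j \<le> 1" using start_far[OF l1 p, of j] \<open>j < t0\<close> \<open>q j \<in> nb (q k0)\<close> by linarith
        ultimately show ?thesis by simp
      qed
      ultimately show ?thesis using e that(1) by linarith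
    qed
    moreover have "q (pp l) \<in> nb (q k0)" using last_adj l1 by simp
    moreover have "v \<in> nb (q k0)" by (rule adj_sym[OF v k0(3)])
    ultimately have "nb (q k0) \<inter> c ` {..<Suc t0} = {v, q (pp l)}"
      using pl unfolding set_eq_iff Int_iff in_c by blast
    then show ?thesis
      unfolding crossing_def using r(1)[OF e] d off_c[OF kT(2,1)] q_in_c[OF pl] c(2) by simp
  qed
qed

text \<open>The source \<open>q (t0 - 1) = c 1\<close> is adjacent to \<open>v\<close>, so the tree
  path closes without an extension.\<close>

lemma good_ear_end:
  assumes sp: "\<not> (l = 1 \<and> pp l = 0 \<and> q 1 \<in> nb (q k0))" and e: "Suc (pp l) = t0"
  shows "good v x c (Suc t0) tcyc (l + 2)"
proof -
  have pl: "pp l < t0" using l(1) .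
  have "icycle tcyc (l + 2)" using icycle_tcyc q_nb[OF pl] e by simp
  moreover have "crossing c (Suc t0) tcyc (l + 2)"
  proof (cases "2 \<le> l")
    case True
    show ?thesis
      by (rule crossing_long[OF True])
        (use off_c[of "pp (l - 2)"] l(2)[of "l - 2"] pp_less_T[of "l - 2"] q_in_c[OF pl] True in auto)
  next
    case False
    then have l1: "l = 1" using l_pos by simp
    have "tcyc 1 = q k0" "tcyc 2 = q (pp l)" unfolding tcyc_def using l1 by auto
    then show ?thesis using crossing_ear[OF l1, of tcyc "l + 2"] sp e l1 by simp
  qed
  ultimately show ?thesis unfolding good_def using c ends by (simp add: tcyc_def)
qed

text \<open>Assumption \<open>e\<close> keeps \<open>q (t0 - 1)\<close> off the ear, so the ear
  returns to \<open>v\<close> only at \<open>q 0\<close>.\<close>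

lemma good_ear:
  assumes sp: "\<not> (l = 1 \<and> pp l = 0 \<and> q 1 \<in> nb (q k0))" and e: "Suc (pp l) < t0"
  shows "good v x c (Suc t0) ear (l + 2 + pp l)"
proof -
  have pl: "pp l < t0" using l(1) .
  \<comment> \<open>Queue indices along the ear. They decrease strictly, first from child to parent
    and then one by one, which gives distinctness.\<close>
  define ix where "ix i = (if i \<le> l + 1 then pp (i - 1) else pp l - (i - (l + 1)))" for i
  have ear: "ear i = q (ix i)" if "0 < i" "i < l + 2 + pp l" for i
    using that by (simp add: ear_def ix_def)
  have ix2: "ix i = pp l - (i - (l + 1))" if "l + 1 \<le> i" for i
    using that by (cases "i = l + 1") (auto simp: ix_def)
  have ixs: "ix i < t0" if "l + 1 \<le> i" for i using ix2[OF that] pl by simp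
  have ixT: "ix i < T" if "0 < i" for i
    using that pp_less_T[of "i - 1"] pl t0_le by (auto simp: ix_def)
  have decr: "ix j < ix i" if "0 < i" "i < j" "j < l + 2 + pp l" for i j
  proof -
    consider "j \<le> l + 1" | "i \<le> l" "l + 1 < j" | "l + 1 \<le> i" using that by linarith
    then show ?thesis
    proof cases
      case 1
      then have "i - 1 < j - 1" "j - 1 \<le> l" using that by auto
      then show ?thesis using pp_decr 1 that by (simp add: ix_def)
    next
      case 2
      then have "i - 1 < l" using that by auto
      then have "t0 \<le> ix i" using l(2) 2 by (simp add: ix_def)
      then show ?thesis using ixs[of j] 2 by simp
    next
      case 3
      then show ?thesis using ix2[of i] ix2[of j] that by simp
    qed
  qed
  have "icycle ear (l + 2 + pp l)"
  proof (rule icycleI[where v = v])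
    fix i assume i: "0 < i" "i < l + 2 + pp l"
    show "ear i < n \<and> ear i \<noteq> v" using ear[OF i] q_less q_neq ixT i by simp
    show "ear i \<in> nb v \<longleftrightarrow> i = 1 \<or> Suc i = l + 2 + pp l"
    proof (cases "i \<le> l")
      case True
      then have "i - 1 < l" using i by simp
      then show ?thesis using pp_nb ear[OF i] True i by (auto simp: ix_def)
    next
      case False
      then have "ix i = pp l - (i - (l + 1))" "ix i < t0" using ix2 ixs by auto
      then show ?thesis using q_nb[of "ix i"] ear[OF i] False i e l_pos by auto
    qed
  next
    fix i j assume ij: "0 < i" "i < j" "j < l + 2 + pp l"
    have ei: "ear i = q (ix i)" "ear j = q (ix j)" using ear ij by auto
    show "ear i \<noteq> ear j" using ei q_inj ixT decr[OF ij] ij by auto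
    consider "j \<le> l + 1" | "i \<le> l" "l + 1 < j" | "l + 1 \<le> i" using ij by linarith
    then show "ear j \<in> nb (ear i) \<longleftrightarrow> j = Suc i"
    proof cases
      case 1
      then have "i - 1 < j - 1" "j - 1 \<le> l" using ij by auto
      from pp_adj[OF this] show ?thesis using ei 1 ij by (auto simp: ix_def)
    next
      case 2
      have a: "i - 1 < l" using 2 ij by auto
      have j: "ix j < t0" "ix j < pp l" using ixs[of j] ix2[of j] 2 ij by linarith+
      \<comment> \<open>Such a chord would join a path vertex to a source earlier than
        \<open>pp l\<close>.\<close>
      have "ear j \<notin> nb (ear i)"
      proof
        assume "ear j \<in> nb (ear i)"
        then have "q (ix i) \<in> nb (q (ix j))"
          unfolding ei by (rule adj_sym[OF q_less[OF ixT[OF ij(1)]]])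
        then have "q (pp (i - 1)) \<in> nb (q (ix j))" using 2 by (simp add: ix_def)
        then show False using source_adj(2)[OF j(1) a] j by simp
      qed
      then show ?thesis using 2 by simp
    next
      case 3
      then have e: "ix i = pp l - (i - (l + 1))" "ix j = pp l - (j - (l + 1))" using ix2 ij by auto
      have "ix j = Suc (ix i) \<or> ix i = Suc (ix j) \<longleftrightarrow> j = Suc i"
        unfolding e using 3 ij by linarith
      then show ?thesis unfolding ei using q_adj[of "ix i" "ix j"] ixs[of i] ixs[of j] 3 ij by simp
    qed
  qed (use v l_pos in \<open>auto simp: ear_def\<close>)
  moreover have "crossing c (Suc t0) ear (l + 2 + pp l)"
  proof (cases "2 \<le> l")
    case True
    show ?thesis
      by (rule crossing_long[OF True])
        (use off_c[of "pp (l - 2)"] l(2)[of "l - 2"] pp_less_T[of "l - 2"] q_in_c[OF pl] True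
          in \<open>auto simp: ear_def tcyc_def\<close>)
  next
    case False
    then have l1: "l = 1" using l_pos by simp
    have "ear 1 = q k0" "ear 2 = q (pp l)" using ear[of 1] ear[of 2] l1 by (auto simp: ix_def)
    moreover have "ear 3 = q (pp l - 1)" if "0 < pp l" using ear[of 3] that l1 by (auto simp: ix_def)
    ultimately show ?thesis using crossing_ear[OF l1, of ear "l + 2 + pp l"] sp e l1 by simp
  qed
  ultimately show ?thesis unfolding good_def using c ends by (simp add: ear_def)
qed

end

end

section \<open>Timed total correctness\<close>

definition run :: "nat \<Rightarrow> com \<Rightarrow> state \<Rightarrow> nat \<Rightarrow> (state \<Rightarrow> bool) \<Rightarrow> bool" where
  "run W c s T Q \<longleftrightarrow> (\<exists>t s'. exec W c s t s' \<and> t \<le> T \<and> Q s')"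

fun wr :: "com \<Rightarrow> nat set" where
  "wr Skip = {}"
| "wr (Assign x e) = {x}"
| "wr (Store a i e) = {}"
| "wr (Seq c1 c2) = wr c1 \<union> wr c2"
| "wr (Cond b c1 c2) = wr c1 \<union> wr c2"
| "wr (While b c) = wr c"

fun wa :: "com \<Rightarrow> nat set" where
  "wa Skip = {}"
| "wa (Assign x e) = {}"
| "wa (Store a i e) = {a}"
| "wa (Seq c1 c2) = wa c1 \<union> wa c2"
| "wa (Cond b c1 c2) = wa c1 \<union> wa c2"
| "wa (While b c) = wa c"

text \<open>The frame condition. Every rule for \<open>run\<close> supplies it for free, so
  postconditions need only mention what a command writes.\<close>

definition same :: "com \<Rightarrow> state \<Rightarrow> state \<Rightarrow> bool" where
  "same c s s' \<longleftrightarrow> (\<forall>x. x \<notin> wr c \<longrightarrow> regs s' x = regs s x) \<and> (\<forall>a. a \<notin> wa c \<longrightarrow> arrs s' a = arrs s a)"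

lemma same_regs: "same c s s' \<Longrightarrow> x \<notin> wr c \<Longrightarrow> regs s' x = regs s x"
  and same_arrs: "same c s s' \<Longrightarrow> a \<notin> wa c \<Longrightarrow> arrs s' a = arrs s a"
  by (auto simp: same_def)

lemma same_refl: "same c s s"
  by (simp add: same_def)

lemma same_trans: "same c s s' \<Longrightarrow> same c s' s'' \<Longrightarrow> same c s s''"
  by (simp add: same_def)

lemma exec_same: "exec W c s t s' \<Longrightarrow> same c s s'"
  by (induction rule: exec.induct) (auto simp: same_def)

lemma run_conseq: "run W c s T Q \<Longrightarrow> (\<And>s'. Q s' \<Longrightarrow> same c s s' \<Longrightarrow> Q' s') \<Longrightarrow> T \<le> T' \<Longrightarrow> run W c s T' Q'"
  unfolding run_def by (meson exec_same le_trans)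

lemma run_seq:
  assumes "run W c1 s T1 Q1" "\<And>s'. Q1 s' \<Longrightarrow> same c1 s s' \<Longrightarrow> run W c2 s' T2 Q" "T1 + T2 \<le> T"
  shows "run W (Seq c1 c2) s T Q"
proof -
  obtain t1 s1 where 1: "exec W c1 s t1 s1" "t1 \<le> T1" "Q1 s1" using assms(1) by (auto simp: run_def)
  then obtain t2 s2 where "exec W c2 s1 t2 s2" "t2 \<le> T2" "Q s2"
    using assms(2)[OF 1(3) exec_same[OF 1(1)]] by (auto simp: run_def)
  then show ?thesis using 1 assms(3) unfolding run_def by (meson add_mono exec.Seq le_trans)
qed

lemma run_cond:
  assumes "bval b s \<Longrightarrow> run W c1 s T1 Q" "\<not> bval b s \<Longrightarrow> run W c2 s T1 Q" "1 + bcost b + T1 \<le> T"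
  shows "run W (Cond b c1 c2) s T Q"
proof (cases "bval b s")
  case True
  then obtain t s' where "exec W c1 s t s'" "t \<le> T1" "Q s'" using assms(1) by (auto simp: run_def)
  then show ?thesis using exec.CondT[of b s W c1 t s' c2] True assms(3) unfolding run_def
    by (meson add_left_mono le_trans)
next
  case False
  then obtain t s' where "exec W c2 s t s'" "t \<le> T1" "Q s'" using assms(2) by (auto simp: run_def)
  then show ?thesis using exec.CondF[of b s W c2 t s' c1] False assms(3) unfolding run_def
    by (meson add_left_mono le_trans)
qed

text \<open>The invariant carries the iteration number, which must stay below \<open>N\<close> while
  the guard holds. The extra summand in \<open>N + 1\<close> pays for the final, failing
  test.\<close>

lemma run_while:
  assumes I0: "I 0 s0"
    and step: "\<And>j s. I j s \<Longrightarrow> same c s0 s \<Longrightarrow> bval b s \<Longrightarrow> j < N \<and> run W c s Tb (I (Suc j))"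
    and post: "\<And>j s. I j s \<Longrightarrow> same c s0 s \<Longrightarrow> \<not> bval b s \<Longrightarrow> Q s"
    and T: "(N + 1) * (1 + bcost b + Tb) \<le> T"
  shows "run W (While b c) s0 T Q"
proof -
  have "run W (While b c) s ((N - j + 1) * (1 + bcost b + Tb)) Q"
    if "I j s" "same c s0 s" "j \<le> N" for j s
    using that
  proof (induction "N - j" arbitrary: j s rule: less_induct)
    case less
    show ?case
    proof (cases "bval b s")
      case False
      then have "exec W (While b c) s (1 + bcost b) s" by (rule exec.WhileF)
      then show ?thesis using post[OF less.prems(1,2) False] unfolding run_def
        by (intro exI[of _ "1 + bcost b"] exI[of _ s]) (simp add: algebra_simps)
    next
      case True
      from step[OF less.prems(1,2) True] obtain t1 s1 where
        1: "j < N" "exec W c s t1 s1" "t1 \<le> Tb" "I (Suc j) s1" by (auto simp: run_def)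
      have "same c s0 s1" using same_trans[OF less.prems(2) exec_same[OF 1(2)]] .
      then have "run W (While b c) s1 ((N - Suc j + 1) * (1 + bcost b + Tb)) Q"
        using 1 by (intro less.hyps) auto
      then obtain t2 s2 where
        2: "exec W (While b c) s1 t2 s2" "t2 \<le> (N - Suc j + 1) * (1 + bcost b + Tb)" "Q s2"
        unfolding run_def by blast
      have "N - j + 1 = Suc (N - Suc j + 1)" using 1(1) by simp
      then have "1 + bcost b + t1 + t2 \<le> (N - j + 1) * (1 + bcost b + Tb)" using 1(3) 2(2) by simp
      then show ?thesis unfolding run_def using exec.WhileT[OF True 1(2) 2(1)] 2(3) by blast
    qed
  qed
  from this[OF I0 same_refl] T show ?thesis unfolding run_def by (fastforce intro: le_trans)
qed

text \<open>Meant for loop-free code. A loop gets \<open>False\<close>, so the value 0 that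
  \<open>ccost\<close> gives to loops is never charged.\<close>

fun wp :: "nat \<Rightarrow> com \<Rightarrow> (state \<Rightarrow> bool) \<Rightarrow> state \<Rightarrow> bool" where
  "wp W Skip Q s = Q s"
| "wp W (Assign x e) Q s = (aval e s \<le> W \<and> Q (s\<lparr>regs := (regs s)(x := aval e s)\<rparr>))"
| "wp W (Store a i e) Q s = (aval i s \<le> W \<and> aval e s \<le> W \<and>
     Q (s\<lparr>arrs := (arrs s)(a := (arrs s a)(aval i s := aval e s))\<rparr>))"
| "wp W (Seq c1 c2) Q s = wp W c1 (wp W c2 Q) s"
| "wp W (Cond b c1 c2) Q s = (if bval b s then wp W c1 Q s else wp W c2 Q s)"
| "wp W (While b c) Q s = False"

fun ccost :: "com \<Rightarrow> nat" where
  "ccost Skip = 1"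
| "ccost (Assign x e) = 1 + acost e"
| "ccost (Store a i e) = 1 + acost i + acost e"
| "ccost (Seq c1 c2) = ccost c1 + ccost c2"
| "ccost (Cond b c1 c2) = 1 + bcost b + max (ccost c1) (ccost c2)"
| "ccost (While b c) = 0"

lemma wp_run: "wp W c Q s \<Longrightarrow> run W c s (ccost c) Q"
proof (induction c arbitrary: Q s)
  case Skip
  then show ?case using exec.Skip unfolding run_def by fastforce
next
  case (Assign x e)
  then show ?case using exec.Assign unfolding run_def by fastforce
next
  case (Store a i e)
  then show ?case using exec.Store unfolding run_def by fastforce
next
  case (Seq c1 c2)
  then have "run W c1 s (ccost c1) (wp W c2 Q)" by simp
  then show ?case by (rule run_seq) (use Seq in auto)
next
  case (Cond b c1 c2)
  show ?case
  proof (rule run_cond[where ?T1.0 = "max (ccost c1) (ccost c2)"])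
    assume "bval b s"
    then have "run W c1 s (ccost c1) Q" using Cond by simp
    then show "run W c1 s (max (ccost c1) (ccost c2)) Q" by (rule run_conseq) auto
  next
    assume "\<not> bval b s"
    then have "run W c2 s (ccost c2) Q" using Cond by simp
    then show "run W c2 s (max (ccost c1) (ccost c2)) Q" by (rule run_conseq) auto
  qed simp
qed simp

lemma run_wp: "wp W c Q s \<Longrightarrow> ccost c \<le> T \<Longrightarrow> run W c s T Q"
  using run_conseq[OF wp_run] by blast

section \<open>The program\<close>

text \<open>
  Registers: 0 and 2 input; 3--5 and 14--16 the loops over adjacency lists (position, end,
  neighbour); 6, 7 head and tail of the queue; 9 the vertex \<open>v\<close>; 10 the number of neighbours of
  colour 1; 11 the hole; 12 set once every vertex is coloured; 20, 21 the lengths of the two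
  cycles; 22 a queue index; 23 the number of sources; 24, 25 an adjacent pair of neighbours of \<open>v\<close>
  of different colours. Arrays: 0, 1 input; 2 the colours; 3 the queue; 4 the queue index of the
  parent; 5 the visited vertices; 6, 7 the two cycles, closed by a second copy of \<open>v\<close>; 8 marks the
  neighbours of \<open>v\<close>; 9--11 scratch marks. Arrays 8--11 rely on being zero initially.
\<close>

definition fadj :: "nat \<Rightarrow> nat \<Rightarrow> nat \<Rightarrow> nat \<Rightarrow> com \<Rightarrow> com" where
  "fadj i e y u body =
     Seq (Assign i (Cell 0 (Reg u)))
    (Seq (Assign e (Cell 0 (Plus (Reg u) (Num 1))))
    (While (Less (Reg i) (Reg e))
      (Seq (Assign y (Cell 1 (Reg i))) (Seq body (Assign i (Plus (Reg i) (Num 1)))))))"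

lemma wr_fadj [simp]: "wr (fadj i e y u body) = {i, e, y} \<union> wr body"
  and wa_fadj [simp]: "wa (fadj i e y u body) = wa body"
  by (auto simp: fadj_def)

locale machine = regular_adjacency +
  fixes W :: nat
  \<comment> \<open>The products bound positions in the adjacency array, \<open>n\<close> bounds
    vertices and queue positions, and 10 leaves room for small constants and off-by-ones.\<close>
  assumes W: "n * \<Delta> + n + 10 \<le> W"
begin

definition inp :: "state \<Rightarrow> bool" where
  "inp s \<longleftrightarrow> regs s 0 = n \<and> regs s 2 = pB \<and> (\<forall>u\<le>n. arrs s 0 u = u * \<Delta>) \<and>
     (\<forall>u<n. \<forall>j<\<Delta>. arrs s 1 (u * \<Delta> + j) = L ! u ! j)"

lemma inp_same:
  assumes "same c s s'" "inp s" "wr c \<inter> {0, 2} = {}" "wa c \<inter> {0, 1} = {}"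
  shows "inp s'"
proof -
  have "regs s' 0 = regs s 0" "regs s' 2 = regs s 2" "arrs s' 0 = arrs s 0" "arrs s' 1 = arrs s 1"
    using assms by (auto simp: same_def)
  then show ?thesis using assms(2) by (simp add: inp_def)
qed

lemma adj_idx:
  assumes "u < n" "j < \<Delta>"
  shows "u * \<Delta> + j < n * \<Delta>" "u * \<Delta> + j < W"
proof -
  have "u * \<Delta> + j < Suc u * \<Delta>" using assms by simp
  also have "\<dots> \<le> n * \<Delta>" using assms by (intro mult_le_mono1) simp
  finally show "u * \<Delta> + j < n * \<Delta>" .
  then show "u * \<Delta> + j < W" using W by simp
qed

lemma nth_less: "u < n \<Longrightarrow> j < \<Delta> \<Longrightarrow> L ! u ! j < n"
  using adj_less length_adj nth_mem by metis

text \<open>\<open>I\<close> counts the neighbours already treated; by \<open>Iins\<close> it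
  ignores the three loop registers. An iteration costs 11 besides the body (test 4, fetch 3,
  increment 4), and the set-up costs 8; hence 19.\<close>

lemma run_fadj:
  assumes inp: "inp s" and u: "regs s u < n"
    and dist: "distinct [i, e, y, u]" "i \<notin> {0, 2}" "e \<notin> {0, 2}" "y \<notin> {0, 2}"
    and body: "wr body \<inter> {0, 2, i, e, u} = {}" "wa body \<inter> {0, 1} = {}"
    and I0: "I 0 s"
    and Iins: "\<And>j s f. I j s \<Longrightarrow> (\<And>x. x \<noteq> i \<Longrightarrow> x \<noteq> e \<Longrightarrow> x \<noteq> y \<Longrightarrow> f x = regs s x) \<Longrightarrow> I j (s\<lparr>regs := f\<rparr>)"
    and step: "\<And>j s'. j < \<Delta> \<Longrightarrow> I j s' \<Longrightarrow> inp s' \<Longrightarrow> regs s' y = L ! (regs s u) ! j \<Longrightarrow>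
      same (fadj i e y u body) s s' \<Longrightarrow> run W body s' Tb (I (Suc j))"
    and T: "(\<Delta> + 1) * (Tb + 19) \<le> T"
  shows "run W (fadj i e y u body) s T (\<lambda>s'. I \<Delta> s' \<and> inp s')"
proof -
  define v where "v = regs s u"
  define lp where "lp = Seq (Assign y (Cell 1 (Reg i))) (Seq body (Assign i (Plus (Reg i) (Num 1))))"
  have ne: "i \<noteq> e" "i \<noteq> y" "e \<noteq> y" "u \<noteq> i" "u \<noteq> e" "u \<noteq> y" using dist by auto
  have v: "v < n" using u by (simp add: v_def)
  have vb: "v * \<Delta> + j \<le> n * \<Delta>" if "j \<le> \<Delta>" for j
  proof -
    have "v * \<Delta> + j \<le> Suc v * \<Delta>" using that by simp
    also have "\<dots> \<le> n * \<Delta>" using v by (intro mult_le_mono1) simp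
    finally show ?thesis .
  qed
  define J where "J j s' \<longleftrightarrow> I j s' \<and> inp s' \<and> j \<le> \<Delta> \<and> regs s' i = v * \<Delta> + j \<and>
    regs s' e = v * \<Delta> + \<Delta> \<and> regs s' u = v" for j s'
  define s1 where "s1 = s\<lparr>regs := (regs s)(i := v * \<Delta>, e := v * \<Delta> + \<Delta>)\<rparr>"
  have J0: "J 0 s1"
    unfolding J_def s1_def using ne dist Iins[OF I0] inp
    by (auto simp: inp_def v_def)
  have loop: "run W (While (Less (Reg i) (Reg e)) lp) s1 ((\<Delta> + 1) * (Tb + 11)) (\<lambda>s'. I \<Delta> s' \<and> inp s')"
  proof (rule run_while[where I = J and N = \<Delta> and Tb = "Tb + 7"])
    show "J 0 s1" by (rule J0)
  next
    fix j s' assume J: "J j s'" and sm: "same lp s1 s'" and b: "bval (Less (Reg i) (Reg e)) s'"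
    have j: "j < \<Delta>" using J b by (simp add: J_def)
    define s2 where "s2 = s'\<lparr>regs := (regs s')(y := L ! v ! j)\<rparr>"
    have a1: "arrs s' (Suc 0) (v * \<Delta> + j) = L ! v ! j"
      using J v j by (simp add: J_def inp_def)
    have 1: "run W (Assign y (Cell 1 (Reg i))) s' 3 (\<lambda>s''. s'' = s2)"
      by (rule run_wp) (use J a1 nth_less[OF v j] W in \<open>auto simp: J_def s2_def\<close>)
    have I2: "I j s2" unfolding s2_def by (rule Iins) (use J in \<open>auto simp: J_def\<close>)
    have in2: "inp s2" using J dist ne by (auto simp: J_def s2_def inp_def)
    have sm2: "same (fadj i e y u body) s s2"
      using sm by (auto simp: same_def s2_def s1_def lp_def)
    have 2: "run W body s2 Tb (I (Suc j))"
      by (rule step[OF j I2 in2 _ sm2]) (simp add: s2_def v_def)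
    have 3: "run W (Assign i (Plus (Reg i) (Num 1))) s3 4 (J (Suc j))"
      if I3: "I (Suc j) s3" and sm3: "same body s2 s3" for s3
    proof (rule run_wp)
      have r: "regs s3 i = v * \<Delta> + j" "regs s3 e = v * \<Delta> + \<Delta>" "regs s3 u = v"
        using same_regs[OF sm3] body J ne by (auto simp: J_def s2_def)
      have in3: "inp s3" by (rule inp_same[OF sm3 in2]) (use body in auto)
      have "I (Suc j) (s3\<lparr>regs := (regs s3)(i := v * \<Delta> + Suc j)\<rparr>)"
        by (rule Iins[OF I3]) auto
      then show "wp W (Assign i (Plus (Reg i) (Num 1))) (J (Suc j)) s3"
        using r in3 ne j dist vb[of "Suc j"] W by (auto simp: J_def inp_def)
    qed simp
    have "run W lp s' (Tb + 7) (J (Suc j))"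
      unfolding lp_def
      apply (rule run_seq[OF 1, where ?T2.0 = "Tb + 4"])
       apply (simp only:)
       apply (rule run_seq[OF 2 3])
      by auto
    then show "j < \<Delta> \<and> run W lp s' (Tb + 7) (J (Suc j))" using j by simp
  next
    fix j s' assume "J j s'" "\<not> bval (Less (Reg i) (Reg e)) s'"
    then show "I \<Delta> s' \<and> inp s'" by (auto simp: J_def)
  qed simp
  have e1: "arrs s 0 v = v * \<Delta>" "arrs s 0 (Suc v) = v * \<Delta> + \<Delta>"
    using inp v by (auto simp: inp_def)
  show ?thesis
    unfolding fadj_def lp_def[symmetric]
  proof (rule run_seq[where ?T1.0 = 3 and ?T2.0 = "5 + (\<Delta> + 1) * (Tb + 11)" and ?Q1.0 = "\<lambda>s'. s' = s\<lparr>regs := (regs s)(i := v * \<Delta>)\<rparr>"])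
    show "run W (Assign i (Cell 0 (Reg u))) s 3 (\<lambda>s'. s' = s\<lparr>regs := (regs s)(i := v * \<Delta>)\<rparr>)"
    proof (rule run_wp)
      have "v * \<Delta> \<le> W" using vb[of 0] W by linarith
      then show "wp W (Assign i (Cell 0 (Reg u))) (\<lambda>s'. s' = s\<lparr>regs := (regs s)(i := v * \<Delta>)\<rparr>) s"
        using e1 by (simp add: v_def)
    qed simp
    fix s' assume s': "s' = s\<lparr>regs := (regs s)(i := v * \<Delta>)\<rparr>"
    have "run W (Assign e (Cell 0 (Plus (Reg u) (Num 1)))) s' 5 (\<lambda>s'. s' = s1)"
      by (rule run_wp) (use e1 vb[of \<Delta>] W ne in \<open>auto simp: v_def s1_def s'\<close>)
    then show "run W (Seq (Assign e (Cell 0 (Plus (Reg u) (Num 1)))) (While (Less (Reg i) (Reg e)) lp)) s'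
        (5 + (\<Delta> + 1) * (Tb + 11)) (\<lambda>s'. I \<Delta> s' \<and> inp s')"
      by (rule run_seq) (use loop in auto)
  next
    show "3 + (5 + (\<Delta> + 1) * (Tb + 11)) \<le> T" using T by (simp add: algebra_simps)
  qed
qed

end

section \<open>Rounds of the hole along stored cycles\<close>

fun seqs :: "com list \<Rightarrow> com" where
  "seqs [] = Skip"
| "seqs [c] = c"
| "seqs (c # d # cs) = Seq c (seqs (d # cs))"

definition count :: "nat \<Rightarrow> com" where
  "count u = seqs [Assign 10 (Num 0), fadj 3 4 5 u (Assign 10 (Plus (Reg 10) (Cell 2 (Reg 5))))]"

lemma wr_count [simp]: "wr (count u) = {3, 4, 5, 10}"
  and wa_count [simp]: "wa (count u) = {}"
  by (auto simp: count_def)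

definition settle :: com where
  "settle = Cond (Less (Reg 10) (Plus (Reg 2) (Num 1)))
      (Seq (Store 2 (Reg 11) (Num 1)) (Assign 12 (Num 1)))
      (Cond (Less (Plus (Reg 2) (Num 1)) (Reg 10))
        (Seq (Store 2 (Reg 11) (Num 0)) (Assign 12 (Num 1))) Skip)"

definition place :: com where
  "place = Seq (count 11) settle"

lemma wr_place [simp]: "wr place = {3, 4, 5, 10, 12}"
  and wa_place [simp]: "wa place = {2}"
  by (auto simp: place_def settle_def)

definition shift :: "nat \<Rightarrow> com" where
  "shift a = Seq (Cond (Equal (Reg 12) (Num 0))
      (Store 2 (Reg 11) (Cell 2 (Cell a (Plus (Reg 6) (Num 1))))) Skip)
      (Assign 6 (Plus (Reg 6) (Num 1)))"

definition rot :: "nat \<Rightarrow> nat \<Rightarrow> com" where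
  "rot a lr = Seq (Assign 6 (Num 0))
    (While (Conj (Less (Reg 6) (Reg lr)) (Equal (Reg 12) (Num 0)))
      (seqs [Assign 11 (Cell a (Reg 6)), place, shift a]))"

lemma wr_rot [simp]: "wr (rot a lr) = {3, 4, 5, 6, 10, 11, 12}"
  and wa_rot [simp]: "wa (rot a lr) = {2}"
  by (auto simp: rot_def shift_def)

text \<open>The schedule c, c, d, d, c, d, d refuted by \<open>not_all_rounds_tight\<close>.\<close>

definition rots :: com where
  "rots = seqs [rot 6 20, rot 6 20, rot 7 21, rot 7 21, rot 6 20, rot 7 21, rot 7 21]"

context machine
begin

text \<open>The common unit of the time bounds, proportional to a sweep over all adjacency lists; as
  twice the edge count is \<open>n * \<Delta>\<close>, it is O(n + m).\<close>

abbreviation U :: nat where "U \<equiv> (n + 1) * (\<Delta> + 1)"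

lemma run_count:
  assumes inp: "inp s" and u: "regs s u < n" "u \<notin> {3, 4, 5, 10}"
    and x: "\<forall>w<n. arrs s 2 w \<le> 1"
  shows "run W (count u) s (26 * (\<Delta> + 1)) (\<lambda>s'. regs s' 10 = cnt (arrs s 2) (regs s u))"
proof -
  define v where "v = regs s u"
  define x where "x = arrs s 2"
  define s1 where "s1 = s\<lparr>regs := (regs s)(10 := 0)\<rparr>"
  define body where "body = Assign 10 (Plus (Reg 10) (Cell 2 (Reg 5)))"
  define I where "I j s' \<longleftrightarrow> regs s' 10 = sum_list (map x (take j (L ! v))) \<and> arrs s' 2 = x" for j and s' :: state
  have v: "v < n" using u by (simp add: v_def)
  \<comment> \<open>The partial sums stay within the word bound, since \<open>j\<close> is at most
    \<open>\<Delta>\<close>, which is less than \<open>n\<close>.\<close>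
  have le: "sum_list (map x (take j (L ! v))) \<le> j" for j
  proof -
    have "sum_list (map x (take j (L ! v))) \<le> sum_list (map (\<lambda>_. 1) (take j (L ! v)))"
      by (rule sum_list_mono) (use assms(4) adj_less[OF v] in \<open>auto simp: x_def dest: in_set_takeD\<close>)
    also have "\<dots> \<le> j" by (simp add: sum_list_triv)
    finally show ?thesis .
  qed
  have "run W (fadj 3 4 5 u body) s1 (24 * (\<Delta> + 1)) (\<lambda>s'. I \<Delta> s' \<and> inp s')"
  proof (rule run_fadj[where Tb = 5])
    show "inp s1" "regs s1 u < n" "distinct [3, 4, 5, u]" using inp u
      by (auto simp: s1_def inp_def)
    show "I 0 s1" by (simp add: I_def s1_def x_def)
    show "I j (s'\<lparr>regs := f\<rparr>)" if "I j s'" "\<And>y. y \<noteq> 3 \<Longrightarrow> y \<noteq> 4 \<Longrightarrow> y \<noteq> 5 \<Longrightarrow> f y = regs s' y" for j s' f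
      using that by (simp add: I_def)
    show "run W body s' 5 (I (Suc j))"
      if j: "j < \<Delta>" and I: "I j s'" and "inp s'" and y: "regs s' 5 = L ! regs s1 u ! j" for j s'
    proof (rule run_wp)
      have "regs s1 u = v" using u by (simp add: s1_def v_def)
      moreover have "take (Suc j) (L ! v) = take j (L ! v) @ [L ! v ! j]"
        using j length_adj[OF v] by (simp add: take_Suc_conv_app_nth)
      ultimately have e: "regs s' 10 + x (regs s' 5) = sum_list (map x (take (Suc j) (L ! v)))"
        using I y by (simp add: I_def)
      then have "regs s' 10 + x (regs s' 5) \<le> W" using le[of "Suc j"] j W degree_less by linarith
      then show "wp W body (I (Suc j)) s'"
        using I e by (simp add: I_def body_def)
    qed (simp add: body_def)
  qed (use u in \<open>auto simp: body_def\<close>)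
  then show ?thesis
    unfolding count_def seqs.simps body_def[symmetric]
    apply (intro run_seq[OF run_wp, where ?Q1.0 = "\<lambda>s'. s' = s1" and ?T1.0 = 2])
       apply (simp add: s1_def)
      apply simp
     apply (simp only:)
     apply (erule run_conseq)
    using length_adj[OF v] by (auto simp: I_def cnt_def x_def v_def)
qed

lemma run_place:
  assumes inp: "inp s" and h: "regs s 11 < n" and val: "valid (arrs s 2) (regs s 11)" and d: "regs s 12 = 0"
  shows "run W place s (50 * (\<Delta> + 1)) (\<lambda>s'. inp s' \<and>
    (regs s' 12 = 1 \<and> full (arrs s' 2) \<or>
     regs s' 12 = 0 \<and> arrs s' 2 = arrs s 2 \<and> cnt (arrs s 2) (regs s 11) = pB + 1))"
proof -
  have "\<forall>w<n. arrs s 2 w \<le> 1" using val by (simp add: valid_def)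
  note cnt = run_count[OF inp h _ this]
  have W': "n \<le> W" "1 \<le> W" using W by auto
  show ?thesis
    unfolding place_def
  proof (rule run_seq[where ?T2.0 = 20])
    show "run W (count 11) s (26 * (\<Delta> + 1)) (\<lambda>s'. regs s' 10 = cnt (arrs s 2) (regs s 11))"
      by (rule cnt) simp
    fix s' assume c: "regs s' 10 = cnt (arrs s 2) (regs s 11)" and sm: "same (count 11) s s'"
    have r: "regs s' 11 = regs s 11" "regs s' 12 = 0" "arrs s' 2 = arrs s 2" "inp s'" "regs s' 2 = pB"
      using sm d inp_same[OF sm inp] inp by (auto simp: same_def inp_def)
    show "run W settle s' 20 (\<lambda>s'. inp s' \<and>
      (regs s' 12 = 1 \<and> full (arrs s' 2) \<or>
       regs s' 12 = 0 \<and> arrs s' 2 = arrs s 2 \<and> cnt (arrs s 2) (regs s 11) = pB + 1))"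
    proof (rule run_wp)
      show "wp W settle (\<lambda>s'. inp s' \<and>
        (regs s' 12 = 1 \<and> full (arrs s' 2) \<or>
         regs s' 12 = 0 \<and> arrs s' 2 = arrs s 2 \<and> cnt (arrs s 2) (regs s 11) = pB + 1)) s'"
        using r c h W' full_place1[OF val h] full_place0[OF val h]
        by (auto simp: settle_def inp_def)
    qed (simp add: settle_def)
  qed simp
qed

lemma icycle_le: "icycle w k \<Longrightarrow> k \<le> n"
proof -
  assume c: "icycle w k"
  have "card (w ` {..<k}) = k" using c by (simp add: icycle_def card_image)
  moreover have "w ` {..<k} \<subseteq> {..<n}" using c by (auto simp: icycle_def)
  ultimately show ?thesis by (metis card_lessThan card_mono finite_lessThan)
qed

lemma icycle_step: "icycle w k \<Longrightarrow> j < k \<Longrightarrow> w (Suc j) \<in> nb (w j)"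
proof -
  assume c: "icycle w k" and j: "j < k"
  then have adj: "\<And>i. i < k \<Longrightarrow> w i \<in> nb (w j) \<longleftrightarrow>
      i = Suc j \<or> j = Suc i \<or> j = 0 \<and> Suc i = k \<or> i = 0 \<and> Suc j = k" and w: "w k = w 0" "3 \<le> k"
    by (auto simp: icycle_def)
  show ?thesis using adj[of "Suc j"] adj[of 0] j w by (cases "Suc j = k") auto
qed

definition done_or :: "(state \<Rightarrow> bool) \<Rightarrow> state \<Rightarrow> bool" where
  "done_or P s \<longleftrightarrow> regs s 12 = 1 \<and> full (arrs s 2) \<or> regs s 12 = 0 \<and> P s"

lemma run_rot:
  assumes inp: "inp s" and a: "a \<notin> {0, 1, 2}" and lr: "lr \<notin> {3, 4, 5, 6, 10, 11, 12}"
    and w: "\<forall>i\<le>k. arrs s a i = w i" "regs s lr = k" "icycle w k"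
    and st: "done_or (\<lambda>s. arrs s 2 = x \<and> valid x (w 0)) s"
  shows "run W (rot a lr) s (80 * U) (\<lambda>s'. inp s' \<and>
    done_or (\<lambda>s'. regs s 12 = 0 \<and> arrs s' 2 = slide x w k \<and> tight x w k \<and> valid (slide x w k) (w 0)) s')"
proof -
  define b where "b = Conj (Less (Reg 6) (Reg lr)) (Equal (Reg 12) (Num 0))"
  define lp where "lp = seqs [Assign 11 (Cell a (Reg 6)), place, shift a]"
  define P where "P j s' \<longleftrightarrow> regs s' 6 = j \<and> arrs s' 2 = slide x w j \<and>
    (\<forall>i<j. cnt (slide x w i) (w i) = pB + 1) \<and> valid (slide x w j) (w j)" for j and s' :: state
  \<comment> \<open>The flag in register 12 never decreases; if it is still 0 after the round, it
    was 0 before, as the postcondition records.\<close>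
  define J where "J j s' \<longleftrightarrow> inp s' \<and> j \<le> k \<and> regs s 12 \<le> regs s' 12 \<and> done_or (P j) s'" for j s'
  define s1 where "s1 = s\<lparr>regs := (regs s)(6 := 0)\<rparr>"
  have wn: "w j < n" if "j \<le> k" for j
    using w(3) that by (cases "j = k") (auto simp: icycle_def)
  have W': "n \<le> W" "1 \<le> W" using W by auto
  have k: "k \<le> n" using icycle_le[OF w(3)] .
  have wrlp: "wr lp = {3, 4, 5, 6, 10, 11, 12}" "wa lp = {2}" by (auto simp: lp_def shift_def)
  have "run W (While b lp) s1 (78 * U) (\<lambda>s'. inp s' \<and>
    done_or (\<lambda>s'. regs s 12 = 0 \<and> arrs s' 2 = slide x w k \<and> tight x w k \<and> valid (slide x w k) (w 0)) s')"
  proof (rule run_while[where I = J and N = n and Tb = "50 * (\<Delta> + 1) + 20"])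
    show "J 0 s1" using inp st by (auto simp: J_def P_def s1_def inp_def done_or_def)
  next
    fix j s' assume J: "J j s'" and sm: "same lp s1 s'" and bv: "bval b s'"
    have r: "regs s' 6 = j" "regs s' 12 = 0" "arrs s' 2 = slide x w j"
      and t: "\<forall>i<j. cnt (slide x w i) (w i) = pB + 1" and val: "valid (slide x w j) (w j)" and i': "inp s'"
      using J bv by (auto simp: J_def P_def b_def done_or_def)
    have u: "regs s' lr = k" "arrs s' a = arrs s a"
      using same_regs[OF sm] same_arrs[OF sm] wrlp a lr w by (auto simp: s1_def)
    have j: "j < k" using bv u r by (simp add: b_def)
    define s2 where "s2 = s'\<lparr>regs := (regs s')(11 := w j)\<rparr>"
    have 1: "run W (Assign 11 (Cell a (Reg 6))) s' 3 (\<lambda>s''. s'' = s2)"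
      by (rule run_wp) (use u r w j wn[of j] W' in \<open>auto simp: s2_def\<close>)
    have 2: "run W place s2 (50 * (\<Delta> + 1)) (\<lambda>s'. inp s' \<and> (regs s' 12 = 1 \<and> full (arrs s' 2) \<or>
     regs s' 12 = 0 \<and> arrs s' 2 = arrs s2 2 \<and> cnt (arrs s2 2) (regs s2 11) = pB + 1))"
      by (rule run_place) (use i' r val wn[of j] j in \<open>auto simp: s2_def inp_def\<close>)
    have 3: "run W (shift a) s3 17 (J (Suc j))"
      if Q: "inp s3 \<and> (regs s3 12 = 1 \<and> full (arrs s3 2) \<or>
     regs s3 12 = 0 \<and> arrs s3 2 = arrs s2 2 \<and> cnt (arrs s2 2) (regs s2 11) = pB + 1)"
        and sm3: "same place s2 s3" for s3
    proof (rule run_wp)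
      have r3: "regs s3 6 = j" "regs s3 11 = w j" "arrs s3 a = arrs s a"
        using same_regs[OF sm3] same_arrs[OF sm3] r u a by (auto simp: s2_def)
      have g: "w (Suc j) \<in> nb (w j)" using icycle_step[OF w(3) j] .
      have gn: "w (Suc j) < n" using wn j by simp
      have mv: "valid (slide x w (Suc j)) (w (Suc j))" if "cnt (slide x w j) (w j) = pB + 1"
        using valid_move[OF val wn[OF less_imp_le[OF j]] that g] by simp
      have le: "slide x w j (w (Suc j)) \<le> 1" using val gn by (simp add: valid_def)
      then have le: "slide x w j (w (Suc j)) \<le> W" using W' by simp
      have aw: "arrs s a (Suc j) = w (Suc j)" using w(1) j by simp
      have wj: "w j \<le> W" "Suc j \<le> W" using wn[of j] W' j k by auto
      have d: "regs s 12 = 0" using J r by (auto simp: J_def)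
      show "wp W (shift a) (J (Suc j)) s3"
      proof (cases "regs s3 12 = 0")
        case True
        then have c: "cnt (slide x w j) (w j) = pB + 1" and x3: "arrs s3 2 = slide x w j"
          using Q r by (auto simp: s2_def)
        then show ?thesis
          using True Q r3 aw wj le mv[OF c] t j d
          by (auto simp: shift_def J_def P_def inp_def done_or_def less_Suc_eq)
      next
        case False
        then show ?thesis using Q r3 wj j d
          by (auto simp: shift_def J_def P_def inp_def done_or_def)
      qed
    qed (simp add: shift_def)
    have "run W lp s' (50 * (\<Delta> + 1) + 20) (J (Suc j))"
      unfolding lp_def seqs.simps
      apply (rule run_seq[OF 1, where ?T2.0 = "50 * (\<Delta> + 1) + 17"])
       apply (simp only:)
       apply (rule run_seq[OF 2 3])
      by auto
    then show "j < n \<and> run W lp s' (50 * (\<Delta> + 1) + 20) (J (Suc j))" using j k by simp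
  next
    fix j s' assume J: "J j s'" and sm: "same lp s1 s'" and bv: "\<not> bval b s'"
    have u: "regs s' lr = k"
      using same_regs[OF sm] wrlp lr w by (auto simp: s1_def)
    have "w k = w 0" using w(3) by (simp add: icycle_def)
    then show "inp s' \<and> done_or (\<lambda>s'. regs s 12 = 0 \<and> arrs s' 2 = slide x w k \<and> tight x w k \<and> valid (slide x w k) (w 0)) s'"
      using J bv u by (auto simp: J_def P_def b_def tight_def done_or_def)
  next
    show "(n + 1) * (1 + bcost b + (50 * (\<Delta> + 1) + 20)) \<le> 78 * U"
      by (simp add: b_def algebra_simps)
  qed
  then show ?thesis
    unfolding rot_def b_def[symmetric] lp_def[symmetric]
    apply (intro run_seq[OF run_wp, where ?Q1.0 = "\<lambda>s'. s' = s1" and ?T1.0 = 2])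
       apply (simp add: s1_def)
      apply simp
     apply simp
    by simp
qed

lemma run_rots:
  assumes inp: "inp s" and good: "good v x c k d r" and x: "arrs s 2 = x" "valid x v"
    and c: "\<forall>i\<le>k. arrs s 6 i = c i" "regs s 20 = k"
    and d: "\<forall>i\<le>r. arrs s 7 i = d i" "regs s 21 = r"
    and st: "regs s 12 = 0"
  shows "run W rots s (560 * U) (\<lambda>s'. full (arrs s' 2))"
proof -
  have ic: "icycle c k" "icycle d r" "c 0 = v" "d 0 = v" using good by (auto simp: good_def)
  define A where "A s' \<longleftrightarrow> inp s' \<and> (\<forall>i\<le>k. arrs s' 6 i = c i) \<and> regs s' 20 = k \<and>
    (\<forall>i\<le>r. arrs s' 7 i = d i) \<and> regs s' 21 = r" for s'
  \<comment> \<open>\<open>X\<close> is the current colouring and \<open>Y\<close> collects the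
    tightness of all rounds so far. Both matter only while the flag is unset; after seven rounds
    \<open>Y\<close> is contradictory, so the flag is set.\<close>
  define B where "B X Y s' \<longleftrightarrow> A s' \<and> done_or (\<lambda>s'. arrs s' 2 = X \<and> valid X v \<and> Y) s'" for X Y s'
  have rc: "run W (rot 6 20) s' (80 * U) (B (slide X c k) (Y \<and> tight X c k))" if "B X Y s'" for X Y s'
  proof (rule run_conseq[OF run_rot[where w = c and k = k and x = X]])
    fix s'' assume "inp s'' \<and> done_or (\<lambda>s''. regs s' 12 = 0 \<and> arrs s'' 2 = slide X c k \<and> tight X c k \<and>
        valid (slide X c k) (c 0)) s''" and sm: "same (rot 6 20) s' s''"
    then show "B (slide X c k) (Y \<and> tight X c k) s''"
      using that same_regs[OF sm] same_arrs[OF sm] ic by (auto simp: B_def A_def done_or_def)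
  qed (use that ic in \<open>auto simp: B_def A_def done_or_def\<close>)
  have rd: "run W (rot 7 21) s' (80 * U) (B (slide X d r) (Y \<and> tight X d r))" if "B X Y s'" for X Y s'
  proof (rule run_conseq[OF run_rot[where w = d and k = r and x = X]])
    fix s'' assume "inp s'' \<and> done_or (\<lambda>s''. regs s' 12 = 0 \<and> arrs s'' 2 = slide X d r \<and> tight X d r \<and>
        valid (slide X d r) (d 0)) s''" and sm: "same (rot 7 21) s' s''"
    then show "B (slide X d r) (Y \<and> tight X d r) s''"
      using that same_regs[OF sm] same_arrs[OF sm] ic by (auto simp: B_def A_def done_or_def)
  qed (use that ic in \<open>auto simp: B_def A_def done_or_def\<close>)
  define x2 where "x2 = slide (slide x c k) c k"
  define x4 where "x4 = slide (slide x2 d r) d r"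
  define x5 where "x5 = slide x4 c k"
  have B0: "B x True s" using assms by (simp add: B_def A_def done_or_def)
  have "run W rots s (560 * U) (B (slide (slide x5 d r) d r) ((((((True \<and> tight x c k) \<and> tight (slide x c k) c k) \<and>
     tight x2 d r) \<and> tight (slide x2 d r) d r) \<and> tight x4 c k) \<and> tight x5 d r \<and> tight (slide x5 d r) d r))"
    unfolding rots_def seqs.simps x5_def x4_def x2_def
    apply (rule run_seq[OF rc[OF B0], where ?T2.0 = "480 * U"])
     apply (rule run_seq[OF rc, where ?T2.0 = "400 * U"], assumption)
      apply (rule run_seq[OF rd, where ?T2.0 = "320 * U"], assumption)
       apply (rule run_seq[OF rd, where ?T2.0 = "240 * U"], assumption)
        apply (rule run_seq[OF rc, where ?T2.0 = "160 * U"], assumption)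
         apply (rule run_seq[OF rd, where ?T2.0 = "80 * U"], assumption)
          apply (rule run_conseq[OF rd], assumption)
           apply (simp only: conj_assoc)
    by auto
  then show ?thesis
  proof (rule run_conseq)
    fix s' assume "B (slide (slide x5 d r) d r) ((((((True \<and> tight x c k) \<and> tight (slide x c k) c k) \<and>
     tight x2 d r) \<and> tight (slide x2 d r) d r) \<and> tight x4 c k) \<and> tight x5 d r \<and> tight (slide x5 d r) d r) s'"
    moreover have "\<not> (tight x c k \<and> tight (slide x c k) c k \<and>
     tight x2 d r \<and> tight (slide x2 d r) d r \<and> tight x4 c k \<and> tight x5 d r \<and> tight (slide x5 d r) d r)"
      using not_all_rounds_tight[OF ic(1,2), of x x2 x4 x5] good x(2) x2_def x4_def x5_def
      by (auto simp: good_def crossing_def valid_def)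
    ultimately show "full (arrs s' 2)" by (auto simp: B_def done_or_def)
  qed simp
qed

end

section \<open>Breadth-first search and the greedy colouring\<close>

definition clear :: com where
  "clear = Seq (Assign 6 (Num 0)) (While (Less (Reg 6) (Reg 0))
     (Seq (Store 5 (Reg 6) (Num 0)) (Assign 6 (Plus (Reg 6) (Num 1)))))"

lemma wr_clear [simp]: "wr clear = {6}" and wa_clear [simp]: "wa clear = {5}"
  by (auto simp: clear_def)

definition push :: "nat \<Rightarrow> com" where
  "push r = seqs [Store 3 (Reg 7) (Reg r), Store 5 (Reg r) (Num 1), Assign 7 (Plus (Reg 7) (Num 1))]"

lemma wr_push [simp]: "wr (push r) = {7}" and wa_push [simp]: "wa (push r) = {3, 5}"
  by (auto simp: push_def)

definition visit :: com where
  "visit = Cond (Equal (Cell 5 (Reg 5)) (Num 0)) (Seq (Store 4 (Reg 7) (Reg 6)) (push 5)) Skip"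

lemma wr_visit [simp]: "wr visit = {7}" and wa_visit [simp]: "wa visit = {3, 4, 5}"
  by (auto simp: visit_def)

definition bfs :: com where
  "bfs = Seq (Assign 6 (Num 0)) (While (Less (Reg 6) (Reg 7))
     (seqs [Assign 8 (Cell 3 (Reg 6)), fadj 3 4 5 8 visit, Assign 6 (Plus (Reg 6) (Num 1))]))"

lemma wr_bfs [simp]: "wr bfs = {3, 4, 5, 6, 7, 8}" and wa_bfs [simp]: "wa bfs = {3, 4, 5}"
  by (auto simp: bfs_def)

definition paint :: com where
  "paint = Seq (Cond (Less (Reg 10) (Plus (Reg 2) (Num 1))) (Store 2 (Reg 8) (Num 1)) Skip)
     (Assign 6 (Minus (Reg 6) (Num 1)))"

definition greedy :: com where
  "greedy = Seq (Assign 6 (Minus (Reg 0) (Num 1))) (While (Less (Num 0) (Reg 6))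
     (seqs [Assign 8 (Cell 3 (Reg 6)), count 8, paint]))"

lemma wr_greedy [simp]: "wr greedy = {3, 4, 5, 6, 8, 10}" and wa_greedy [simp]: "wa greedy = {2}"
  by (auto simp: greedy_def paint_def)

context machine
begin

lemma n_pos: "0 < n"
  using nonempty by simp

lemma run_clear:
  assumes inp: "inp s"
  shows "run W clear s (20 * U) (\<lambda>s'. inp s' \<and> (\<forall>y<n. arrs s' 5 y = 0))"
proof -
  define lp where "lp = Seq (Store 5 (Reg 6) (Num 0)) (Assign 6 (Plus (Reg 6) (Num 1)))"
  define s1 where "s1 = s\<lparr>regs := (regs s)(6 := 0)\<rparr>"
  define J where "J j s' \<longleftrightarrow> inp s' \<and> regs s' 6 = j \<and> j \<le> n \<and> (\<forall>y<j. arrs s' 5 y = 0)" for j and s' :: state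
  have "run W (While (Less (Reg 6) (Reg 0)) lp) s1 (18 * U) (\<lambda>s'. inp s' \<and> (\<forall>y<n. arrs s' 5 y = 0))"
  proof (rule run_while[where I = J and N = n and Tb = 9])
    show "J 0 s1" using inp by (auto simp: J_def s1_def inp_def)
  next
    fix j s' assume J: "J j s'" and b: "bval (Less (Reg 6) (Reg 0)) s'"
    then have j: "j < n" by (simp add: J_def inp_def)
    have "run W lp s' 9 (J (Suc j))"
      by (rule run_wp) (use J j W in \<open>auto simp: J_def inp_def lp_def less_Suc_eq\<close>)
    then show "j < n \<and> run W lp s' 9 (J (Suc j))" using j by simp
  next
    fix j s' assume "J j s'" "\<not> bval (Less (Reg 6) (Reg 0)) s'"
    then show "inp s' \<and> (\<forall>y<n. arrs s' 5 y = 0)" by (auto simp: J_def inp_def)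
  qed simp
  then show ?thesis
    unfolding clear_def lp_def[symmetric]
    apply (intro run_seq[OF run_wp, where ?Q1.0 = "\<lambda>s'. s' = s1" and ?T1.0 = 2])
       apply (simp add: s1_def)
      apply simp
     apply simp
    by simp
qed

text \<open>\<open>B\<close> holds vertices marked as visited without being queued. With
  \<open>B = {v}\<close> the search runs in \<open>G - v\<close>.\<close>

definition que :: "nat set \<Rightarrow> state \<Rightarrow> nat list \<Rightarrow> bool" where
  "que B s Q \<longleftrightarrow> regs s 7 = length Q \<and> (\<forall>i<length Q. arrs s 3 i = Q ! i) \<and> distinct Q \<and>
     set Q \<subseteq> {..<n} \<and> (\<forall>y<n. arrs s 5 y \<noteq> 0 \<longleftrightarrow> y \<in> set Q \<union> B) \<and> set Q \<inter> B = {}"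

lemma que_length:
  assumes "que B s Q"
  shows "length Q \<le> n"
proof -
  have "card (set Q) \<le> n" using card_mono[of "{..<n}" "set Q"] assms by (simp add: que_def)
  then show ?thesis using assms by (simp add: que_def distinct_card)
qed

lemma wp_push:
  assumes q: "que B s Q" and y: "regs s r < n" "regs s r \<notin> set Q \<union> B" and r: "r \<noteq> 7"
    and P: "\<And>s'. que B s' (Q @ [regs s r]) \<Longrightarrow> same (push r) s s' \<Longrightarrow> P s'"
  shows "wp W (push r) P s"
proof -
  have W': "regs s r \<le> W" "regs s 7 < W" "1 \<le> W" using y que_length[OF q] q W by (auto simp: que_def)
  let ?s' = "s\<lparr>arrs := (arrs s)(3 := (arrs s 3)(regs s 7 := regs s r), 5 := (arrs s 5)(regs s r := 1)),
      regs := (regs s)(7 := Suc (regs s 7))\<rparr>"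
  have "que B ?s' (Q @ [regs s r])"
    using q y by (auto simp: que_def nth_append less_Suc_eq)
  moreover have "same (push r) s ?s'" by (auto simp: same_def)
  ultimately have "P ?s'" by (rule P)
  then show ?thesis using W' r by (simp add: push_def fun_upd_def)
qed

text \<open>\<open>Q0\<close> lists the sources and \<open>h\<close> is the head. The penultimate
  conjunct, that processed vertices have all neighbours queued or blocked, keeps parents first
  neighbours.\<close>

definition binv :: "nat set \<Rightarrow> nat list \<Rightarrow> nat \<Rightarrow> state \<Rightarrow> nat list \<Rightarrow> bool" where
  "binv B Q0 h s Q \<longleftrightarrow> que B s Q \<and> length Q0 \<le> length Q \<and> take (length Q0) Q = Q0 \<and>
     (\<forall>i. length Q0 \<le> i \<longrightarrow> i < length Q \<longrightarrow> arrs s 4 i < i \<and> Q ! i \<in> nb (Q ! arrs s 4 i) \<and>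
       (\<forall>j<arrs s 4 i. Q ! i \<notin> nb (Q ! j))) \<and>
     (\<forall>i<h. \<forall>y\<in>nb (Q ! i). y \<in> set Q \<union> B) \<and> h \<le> length Q"

text \<open>The new vertex was neither queued nor blocked, so no processed vertex is adjacent to it
  and the head \<open>h\<close> is its first neighbour.\<close>

lemma binv_append:
  assumes b: "binv B Q0 h s Q" and h: "h < length Q" and y: "y \<in> nb (Q ! h)" "y \<notin> set Q \<union> B"
    and q: "que B s' (Q @ [y])" and p: "arrs s' 4 = (arrs s 4)(length Q := h)"
  shows "binv B Q0 h s' (Q @ [y])"
  unfolding binv_def
proof (intro conjI)
  show "\<forall>i. length Q0 \<le> i \<longrightarrow> i < length (Q @ [y]) \<longrightarrow> arrs s' 4 i < i \<and>
      (Q @ [y]) ! i \<in> nb ((Q @ [y]) ! arrs s' 4 i) \<and>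
      (\<forall>j<arrs s' 4 i. (Q @ [y]) ! i \<notin> nb ((Q @ [y]) ! j))"
  proof (intro allI impI)
    fix i assume i: "length Q0 \<le> i" "i < length (Q @ [y])"
    show "arrs s' 4 i < i \<and> (Q @ [y]) ! i \<in> nb ((Q @ [y]) ! arrs s' 4 i) \<and>
      (\<forall>j<arrs s' 4 i. (Q @ [y]) ! i \<notin> nb ((Q @ [y]) ! j))"
    proof (cases "i = length Q")
      case True
      have "y \<notin> nb (Q ! j)" if "j < h" for j using b y(2) that by (auto simp: binv_def)
      then show ?thesis using True h y p by (simp add: nth_append)
    next
      case False
      then have i': "i < length Q" using i by simp
      then have *: "arrs s 4 i < i \<and> Q ! i \<in> nb (Q ! arrs s 4 i) \<and> (\<forall>j<arrs s 4 i. Q ! i \<notin> nb (Q ! j))"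
        using b i(1) by (simp add: binv_def)
      then have "arrs s 4 i < length Q" using i' by simp
      then show ?thesis using * i' p False by (auto simp: nth_append)
    qed
  qed
  show "\<forall>i<h. \<forall>y'\<in>nb ((Q @ [y]) ! i). y' \<in> set (Q @ [y]) \<union> B"
    using b h by (auto simp: binv_def nth_append)
qed (use b q h in \<open>auto simp: binv_def\<close>)

lemma run_bfs:
  assumes inp: "inp s" and q: "que B s Q0"
  shows "run W bfs s (80 * U) (\<lambda>s'. inp s' \<and> (\<exists>Q. binv B Q0 (length Q) s' Q))"
proof -
  define lp where "lp = seqs [Assign 8 (Cell 3 (Reg 6)), fadj 3 4 5 8 visit, Assign 6 (Plus (Reg 6) (Num 1))]"
  define s1 where "s1 = s\<lparr>regs := (regs s)(6 := 0)\<rparr>"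
  define J where "J j s' \<longleftrightarrow> inp s' \<and> regs s' 6 = j \<and> (\<exists>Q. binv B Q0 j s' Q)" for j and s' :: state
  have "run W (While (Less (Reg 6) (Reg 7)) lp) s1 (75 * U) (\<lambda>s'. inp s' \<and> (\<exists>Q. binv B Q0 (length Q) s' Q))"
  proof (rule run_while[where I = J and N = n and Tb = "(\<Delta> + 1) * 50 + 7"])
    have "binv B Q0 0 s1 Q0" using q by (simp add: binv_def que_def s1_def)
    then show "J 0 s1" using inp by (auto simp: J_def s1_def inp_def)
  next
    fix h s' assume J: "J h s'" and b: "bval (Less (Reg 6) (Reg 7)) s'"
    then obtain Q where Q: "binv B Q0 h s' Q" and i': "inp s'" and r6: "regs s' 6 = h" by (auto simp: J_def)
    have q: "que B s' Q" using Q by (simp add: binv_def)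
    have h: "h < length Q" using b r6 q by (simp add: que_def)
    have hn: "h < n" using que_length[OF q] h by simp
    define u where "u = Q ! h"
    have "u \<in> set Q" using h by (simp add: u_def)
    then have u: "u < n" using q by (auto simp: que_def)
    define s2 where "s2 = s'\<lparr>regs := (regs s')(8 := u)\<rparr>"
    have a3: "arrs s' 3 h = u" using q h by (simp add: que_def u_def)
    have 1: "run W (Assign 8 (Cell 3 (Reg 6))) s' 3 (\<lambda>s''. s'' = s2)"
      by (rule run_wp) (use r6 a3 u W in \<open>auto simp: s2_def\<close>)
    define I where "I j s'' \<longleftrightarrow> (\<exists>Q. binv B Q0 h s'' Q \<and> h < length Q \<and> Q ! h = u \<and>
        (\<forall>i<j. L ! u ! i \<in> set Q \<union> B))" for j and s'' :: state
    have 2: "run W (fadj 3 4 5 8 visit) s2 ((\<Delta> + 1) * 50) (\<lambda>s'. I \<Delta> s' \<and> inp s')"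
    proof (rule run_fadj[where Tb = 30])
      show "inp s2" using i' by (simp add: s2_def inp_def)
      show "I 0 s2" unfolding I_def using Q h
        by (intro exI[of _ Q]) (simp add: binv_def que_def s2_def u_def)
      show "I j (s'\<lparr>regs := f\<rparr>)" if "I j s'" "\<And>y. y \<noteq> 3 \<Longrightarrow> y \<noteq> 4 \<Longrightarrow> y \<noteq> 5 \<Longrightarrow> f y = regs s' y" for j s' f
        using that by (simp add: I_def binv_def que_def)
      show "run W visit t 30 (I (Suc j))"
        if j: "j < \<Delta>" and I: "I j t" and it: "inp t" and y: "regs t 5 = L ! regs s2 8 ! j"
          and sm: "same (fadj 3 4 5 8 visit) s2 t" for j t
      proof (rule run_wp)
        obtain Q where Q: "binv B Q0 h t Q" "h < length Q" "Q ! h = u" "\<forall>i<j. L ! u ! i \<in> set Q \<union> B"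
          using I by (auto simp: I_def)
        have y5: "regs t 5 = L ! u ! j" using y by (simp add: s2_def)
        have yn: "regs t 5 < n" "regs t 5 \<in> nb u"
          using y5 nth_less[OF u j] length_adj[OF u] j nth_mem[of j "L ! u"] by auto
        have h6: "regs t 6 = h" using same_regs[OF sm, of 6] r6 by (simp add: s2_def)
        have qt: "que B t Q" using Q by (simp add: binv_def)
        show "wp W visit (I (Suc j)) t"
        proof (cases "arrs t 5 (regs t 5) = 0")
          case False
          then have "regs t 5 \<in> set Q \<union> B" using qt yn by (auto simp: que_def)
          then have "I (Suc j) t" unfolding I_def using Q y5 by (intro exI[of _ Q]) (auto simp: less_Suc_eq)
          then show ?thesis using False by (simp add: visit_def)
        next
          case True
          then have ny: "regs t 5 \<notin> set Q \<union> B" using qt yn by (auto simp: que_def)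
          define t1 where "t1 = t\<lparr>arrs := (arrs t)(4 := (arrs t 4)(length Q := h))\<rparr>"
          have q1: "que B t1 Q" using qt by (simp add: que_def t1_def)
          have "wp W (push 5) (I (Suc j)) t1"
          proof (rule wp_push[OF q1])
            fix t2 assume t2: "que B t2 (Q @ [regs t1 5])" and sm2: "same (push 5) t1 t2"
            have e5: "regs t1 5 = L ! u ! j" using y5 by (simp add: t1_def)
            have p4: "arrs t2 4 = (arrs t 4)(length Q := h)" using same_arrs[OF sm2, of 4] by (simp add: t1_def)
            have "binv B Q0 h t2 (Q @ [L ! u ! j])"
              by (rule binv_append[OF Q(1,2)]) (use yn ny y5 Q(3) t2 e5 p4 in auto)
            then show "I (Suc j) t2"
              unfolding I_def using Q by (intro exI[of _ "Q @ [L ! u ! j]"]) (auto simp: nth_append less_Suc_eq)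
          qed (use yn ny in \<open>auto simp: t1_def\<close>)
          moreover have "regs t 7 = length Q" using qt by (simp add: que_def)
          moreover have "h \<le> W" "length Q \<le> W" using hn que_length[OF qt] W by auto
          ultimately show ?thesis using True h6 by (simp add: visit_def t1_def)
        qed
      qed (simp add: visit_def push_def)
    qed (use u in \<open>auto simp: s2_def\<close>)
    have 3: "run W (Assign 6 (Plus (Reg 6) (Num 1))) t 4 (J (Suc h))"
      if I: "I \<Delta> t \<and> inp t" and sm: "same (fadj 3 4 5 8 visit) s2 t" for t
    proof (rule run_wp)
      obtain Q where Q: "binv B Q0 h t Q" "h < length Q" "Q ! h = u" "\<forall>i<\<Delta>. L ! u ! i \<in> set Q \<union> B"
        using I by (auto simp: I_def)
      have h6: "regs t 6 = h" using same_regs[OF sm, of 6] r6 by (simp add: s2_def)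
      have "\<forall>y\<in>nb u. y \<in> set Q \<union> B"
      proof
        fix y assume "y \<in> nb u"
        then obtain i where "i < \<Delta>" "y = L ! u ! i" using length_adj[OF u] by (auto simp: in_set_conv_nth)
        then show "y \<in> set Q \<union> B" using Q(4) by simp
      qed
      then have "binv B Q0 (Suc h) (t\<lparr>regs := (regs t)(6 := Suc h)\<rparr>) Q"
        using Q by (auto simp: binv_def que_def less_Suc_eq)
      then show "wp W (Assign 6 (Plus (Reg 6) (Num 1))) (J (Suc h)) t"
        using h6 hn W I by (auto simp: J_def inp_def)
    qed simp
    have "run W lp s' ((\<Delta> + 1) * 50 + 7) (J (Suc h))"
      unfolding lp_def seqs.simps
      apply (rule run_seq[OF 1, where ?T2.0 = "(\<Delta> + 1) * 50 + 4"])
       apply (simp only:)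
       apply (rule run_seq[OF 2 3])
      by auto
    then show "h < n \<and> run W lp s' ((\<Delta> + 1) * 50 + 7) (J (Suc h))" using hn by simp
  next
    fix h s' assume J: "J h s'" and b: "\<not> bval (Less (Reg 6) (Reg 7)) s'"
    then obtain Q where Q: "binv B Q0 h s' Q" "inp s'" "regs s' 6 = h" by (auto simp: J_def)
    then have "h = length Q" using b by (auto simp: binv_def que_def)
    then show "inp s' \<and> (\<exists>Q. binv B Q0 (length Q) s' Q)" using Q by blast
  qed (simp add: algebra_simps)
  then show ?thesis
    unfolding bfs_def lp_def[symmetric]
    apply (intro run_seq[OF run_wp, where ?Q1.0 = "\<lambda>s'. s' = s1" and ?T1.0 = 2])
       apply (simp add: s1_def)
      apply simp
     apply simp
    by simp
qed

lemma binv_tree: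
  assumes b: "binv B Q0 (length Q) s Q"
  shows "bfs_tree (arrs s 3) (arrs s 4) (length Q) (length Q0)"
    "\<And>i. i < length Q0 \<Longrightarrow> arrs s 3 i = Q0 ! i"
    "arrs s 3 ` {..<length Q} = set Q" "regs s 7 = length Q" "set Q \<inter> B = {}" "set Q \<subseteq> {..<n}"
    "\<And>u y. u \<in> set Q \<Longrightarrow> y \<in> nb u \<Longrightarrow> y \<in> set Q \<union> B"
proof -
  have q: "que B s Q" using b by (simp add: binv_def)
  have e: "arrs s 3 i = Q ! i" if "i < length Q" for i using q that by (simp add: que_def)
  show im: "arrs s 3 ` {..<length Q} = set Q"
    using e by (auto simp: in_set_conv_nth image_iff)
  show "regs s 7 = length Q" "set Q \<inter> B = {}" "set Q \<subseteq> {..<n}" using q by (auto simp: que_def)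
  show "arrs s 3 i = Q0 ! i" if i: "i < length Q0" for i
  proof -
    have "take (length Q0) Q ! i = Q0 ! i" "i < length Q" using b i by (auto simp: binv_def)
    then show ?thesis using e i by simp
  qed
  have cl: "\<forall>i<length Q. \<forall>y\<in>nb (Q ! i). y \<in> set Q \<union> B" using b unfolding binv_def by blast
  show "y \<in> set Q \<union> B" if "u \<in> set Q" "y \<in> nb u" for u y
  proof -
    obtain i where "i < length Q" "u = Q ! i" using \<open>u \<in> set Q\<close> by (metis in_set_conv_nth)
    then show ?thesis using cl \<open>y \<in> nb u\<close> by blast
  qed
  show "bfs_tree (arrs s 3) (arrs s 4) (length Q) (length Q0)"
    unfolding bfs_tree_def
  proof (intro conjI allI impI)
    show "inj_on (arrs s 3) {..<length Q}"
      using q e by (auto simp: inj_on_def que_def nth_eq_iff_index_eq)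
    show "arrs s 3 i < n" if "i < length Q" for i using q e[OF that] nth_mem[OF that] by (auto simp: que_def)
    show "length Q0 \<le> length Q" using b by (simp add: binv_def)
  next
    fix i assume i: "length Q0 \<le> i" "i < length Q"
    have *: "arrs s 4 i < i" "Q ! i \<in> nb (Q ! arrs s 4 i)" "\<forall>j<arrs s 4 i. Q ! i \<notin> nb (Q ! j)"
      using b i unfolding binv_def by blast+
    show "arrs s 4 i < i" by (rule *)
    have "arrs s 3 (arrs s 4 i) = Q ! arrs s 4 i" using e *(1) i(2) by simp
    then show "arrs s 3 i \<in> nb (arrs s 3 (arrs s 4 i))" using *(2) e[OF i(2)] by simp
    fix j assume j: "j < arrs s 4 i"
    then have "arrs s 3 j = Q ! j" using e *(1) i(2) by simp
    then show "arrs s 3 i \<notin> nb (arrs s 3 j)" using *(3) e[OF i(2)] j by simp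
  qed
qed

lemma binv_all:
  assumes b: "binv {} Q0 (length Q) s Q" and Q0: "Q0 \<noteq> []"
  shows "set Q = {..<n}" "length Q = n"
proof -
  have "length Q0 \<le> length Q" using b by (simp add: binv_def)
  then have "set Q \<noteq> {}" using Q0 by auto
  then show Q: "set Q = {..<n}" using binv_tree(6,7)[OF b] by (intro closed_eq_all) auto
  have "distinct Q" using b by (simp add: binv_def que_def)
  then show "length Q = n" using Q by (metis card_lessThan distinct_card)
qed

text \<open>The queued vertices are closed up to \<open>v\<close>, so the connectedness of
  \<open>G - v\<close> makes the search exhaustive.\<close>

lemma binv_noncut:
  assumes b: "binv {v} Q0 (length Q) s Q" and Q0: "Q0 \<noteq> []" and v: "noncut v"
  shows "set Q = {..<n} - {v}"
proof -
  have "length Q0 \<le> length Q" using b by (simp add: binv_def)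
  then have "set Q \<noteq> {}" using Q0 by auto
  moreover have "set Q \<subseteq> {..<n} - {v}" using binv_tree(5,6)[OF b] by auto
  moreover have "\<forall>u\<in>set Q. nb u \<subseteq> set Q \<union> {v}" using binv_tree(7)[OF b] by auto
  ultimately show ?thesis using v unfolding noncut_def by blast
qed

end

context regular_adjacency
begin

text \<open>Positions up to \<open>i\<close> are uncoloured but also hold 0. Hence part 0 is
  restricted to the later positions, while part 1 needs no restriction.\<close>

definition painted :: "(nat \<Rightarrow> nat) \<Rightarrow> nat \<Rightarrow> (nat \<Rightarrow> nat) \<Rightarrow> bool" where
  "painted q i x \<longleftrightarrow> (\<forall>u<n. x u \<le> 1) \<and> (\<forall>a\<le>i. x (q a) = 0) \<and>
     degen pA {u \<in> q ` {i<..<n}. x u = 0} \<and> degen pB (part x 1)"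

lemma painted_init:
  assumes "\<forall>u<n. x u = 0" "\<And>i. i < n \<Longrightarrow> q i < n"
  shows "painted q (n - 1) x"
proof -
  have "part x 1 = {}" "{n - 1<..<n} = {}" using assms(1) by (auto simp: part_def)
  moreover have "x (q a) = 0" if "a \<le> n - 1" for a
  proof -
    have "a < n" using that degree_less by linarith
    then show ?thesis using assms by blast
  qed
  ultimately show ?thesis using assms(1) degen_empty by (auto simp: painted_def)
qed

text \<open>
  Painting proceeds from the leaves to the root, so the parent of the current vertex is still
  uncoloured: at most \<open>\<Delta> - 1 = pA + pB + 1\<close> neighbours are coloured and one colour is available.
\<close>

lemma painted_step:
  assumes t: "bfs_tree q p n 1" and i: "0 < i" "i < n" and P: "painted q i x"
  shows "cnt x (q i) \<le> pB \<Longrightarrow> painted q (i - 1) (x(q i := 1))"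
    and "pB < cnt x (q i) \<Longrightarrow> painted q (i - 1) x"
proof -
  have inj: "q a = q b \<longleftrightarrow> a = b" if "a < n" "b < n" for a b
    using bfs_treeD(1)[OF t] that by (meson inj_onD lessThan_iff)
  have qn: "q i < n" by (rule bfs_treeD(3)[OF t i(2)])
  have x1: "\<forall>u<n. x u \<le> 1" and x0: "\<And>a. a \<le> i \<Longrightarrow> x (q a) = 0"
    and dA: "degen pA {u \<in> q ` {i<..<n}. x u = 0}" and dB: "degen pB (part x 1)"
    using P by (auto simp: painted_def)
  have iv: "{i - 1<..<n} = insert i {i<..<n}" using i by auto
  have ni: "q i \<notin> q ` {i<..<n}" using inj i by auto
  show "painted q (i - 1) (x(q i := 1))" if c: "cnt x (q i) \<le> pB"
  proof -
    have "part (x(q i := 1)) 1 = insert (q i) (part x 1)" using qn by (auto simp: part_def)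
    moreover have "degen pB (insert (q i) (part x 1))"
      by (rule degen_insert[OF dB qn]) (use card_part1[OF qn x1] c in simp)
    moreover have "{u \<in> q ` {i - 1<..<n}. (x(q i := 1)) u = 0} = {u \<in> q ` {i<..<n}. x u = 0}"
    proof -
      define S where "S = q ` {i<..<n}"
      have "q i \<notin> S" using ni by (simp add: S_def)
      then show ?thesis unfolding iv image_insert S_def[symmetric] by auto
    qed
    moreover have "(x(q i := 1)) (q a) = 0" if "a \<le> i - 1" for a
      using inj[of a i] x0[of a] that i by auto
    ultimately show ?thesis using dA x1 by (auto simp: painted_def)
  qed
  show "painted q (i - 1) x" if c: "pB < cnt x (q i)"
  proof -
    have pi: "p i < i" "q i \<in> nb (q (p i))"
      using bfs_treeD(4,5)[OF t _ i(2)] i(1) by simp_all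
    have pn: "q (p i) < n" by (rule bfs_treeD(3)[OF t]) (use pi i in linarith)
    have par: "q (p i) \<in> nb (q i)" by (rule adj_sym[OF pn pi(2)])
    have npi: "q (p i) \<notin> q ` {i<..<n}" using inj pi i by auto
    let ?A = "{u \<in> q ` {i<..<n}. x u = 0}"
    \<comment> \<open>\<open>part x 0\<close> also contains the uncoloured vertices, the parent
      among them. At most \<open>pA + 1\<close> neighbours hold 0, and dropping the parent leaves
      \<open>pA\<close>.\<close>
    have "?A \<inter> nb (q i) \<subseteq> (part x 0 \<inter> nb (q i)) - {q (p i)}"
    proof
      fix u assume u: "u \<in> ?A \<inter> nb (q i)"
      then have "u \<noteq> q (p i)" "u < n" "x u = 0" using npi adj_less[OF qn] by blast+
      then show "u \<in> (part x 0 \<inter> nb (q i)) - {q (p i)}" using u by (simp add: part_def)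
    qed
    then have "card (?A \<inter> nb (q i)) \<le> card ((part x 0 \<inter> nb (q i)) - {q (p i)})"
      by (intro card_mono) auto
    also have "\<dots> = card (part x 0 \<inter> nb (q i)) - 1"
      using par pn x0[of "p i"] pi by (intro card_Diff_singleton) (simp add: part_def)
    also have "\<dots> \<le> pA" using card_part0[OF qn x1] c degree_sum by linarith
    finally have "degen pA (insert (q i) ?A)" by (rule degen_insert[OF dA qn])
    moreover have "{u \<in> q ` {i - 1<..<n}. x u = 0} = insert (q i) ?A"
      unfolding iv using x0[of i] by auto
    ultimately show ?thesis using dB x1 x0 by (simp add: painted_def)
  qed
qed

lemma painted_end:
  assumes "painted q 0 x" "q ` {..<n} = {..<n}"
  shows "valid x (q 0)"
proof -
  have "part x 0 - {q 0} \<subseteq> {u \<in> q ` {0<..<n}. x u = 0}"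
  proof
    fix u assume u: "u \<in> part x 0 - {q 0}"
    then have "u \<in> q ` {..<n}" unfolding assms(2) by (simp add: part_def)
    then obtain a where a: "a < n" "u = q a" by auto
    have "0 < a"
    proof (rule ccontr)
      assume "\<not> 0 < a"
      then have "u = q 0" using a(2) by simp
      then show False using u by simp
    qed
    then show "u \<in> {u \<in> q ` {0<..<n}. x u = 0}" using u a by (auto simp: part_def)
  qed
  moreover have "degen pA {u \<in> q ` {0<..<n}. x u = 0}" "degen pB (part x 1)" "\<forall>u<n. x u \<le> 1"
    using assms(1) by (simp_all add: painted_def)
  ultimately show ?thesis unfolding valid_def by (meson Diff_subset degen_mono)
qed

end

context machine
begin

lemma run_greedy:
  assumes inp: "inp s" and t: "bfs_tree (arrs s 3) (arrs s 4) n 1"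
    and all: "arrs s 3 ` {..<n} = {..<n}" and x0: "\<forall>u<n. arrs s 2 u = 0"
  shows "run W greedy s (80 * U) (\<lambda>s'. inp s' \<and> valid (arrs s' 2) (arrs s 3 0))"
proof -
  define q where "q = arrs s 3"
  define lp where "lp = seqs [Assign 8 (Cell 3 (Reg 6)), count 8, paint]"
  define s1 where "s1 = s\<lparr>regs := (regs s)(6 := n - 1)\<rparr>"
  define J where "J j s' \<longleftrightarrow> inp s' \<and> j \<le> n - 1 \<and> regs s' 6 = n - 1 - j \<and> painted q (n - 1 - j) (arrs s' 2)"
    for j and s' :: state
  have t': "bfs_tree q (arrs s 4) n 1" using t by (simp add: q_def)
  note qn = bfs_treeD(3)[OF t']
  have W': "n \<le> W" "1 \<le> W" using W by auto
  have wrlp: "wr lp = {3, 4, 5, 6, 8, 10}" "wa lp = {2}" by (auto simp: lp_def paint_def)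
  have "run W (While (Less (Num 0) (Reg 6)) lp) s1 (60 * U) (\<lambda>s'. inp s' \<and> valid (arrs s' 2) (q 0))"
  proof (rule run_while[where I = J and N = n and Tb = "26 * (\<Delta> + 1) + 30"])
    show "J 0 s1" using inp painted_init[OF x0 qn] by (auto simp: J_def s1_def inp_def)
  next
    fix j s' assume J: "J j s'" and sm: "same lp s1 s'" and b: "bval (Less (Num 0) (Reg 6)) s'"
    define i where "i = n - 1 - j"
    have r: "regs s' 6 = i" "0 < i" "i < n" and P: "painted q i (arrs s' 2)" and i': "inp s'"
      using J b n_pos by (auto simp: J_def i_def)
    have a3: "arrs s' 3 = q" using same_arrs[OF sm, of 3] wrlp by (simp add: s1_def q_def)
    have qi: "q i < n" by (rule qn[OF r(3)])
    define s2 where "s2 = s'\<lparr>regs := (regs s')(8 := q i)\<rparr>"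
    have 1: "run W (Assign 8 (Cell 3 (Reg 6))) s' 3 (\<lambda>s''. s'' = s2)"
      by (rule run_wp) (use r a3 qi W' in \<open>auto simp: s2_def\<close>)
    have 2: "run W (count 8) s2 (26 * (\<Delta> + 1)) (\<lambda>s'. regs s' 10 = cnt (arrs s2 2) (regs s2 8))"
      by (rule run_count) (use i' qi P in \<open>auto simp: s2_def inp_def painted_def\<close>)
    have 3: "run W paint t 20 (J (Suc j))"
      if c: "regs t 10 = cnt (arrs s2 2) (regs s2 8)" and sm2: "same (count 8) s2 t" for t
    proof (rule run_wp)
      have rt: "regs t 8 = q i" "regs t 6 = i" "arrs t 2 = arrs s' 2" "inp t" "regs t 2 = pB"
        using same_regs[OF sm2] same_arrs[OF sm2, of 2] r i' inp_same[OF sm2]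
        by (auto simp: s2_def inp_def)
      have ct: "regs t 10 = cnt (arrs s' 2) (q i)" using c by (simp add: s2_def)
      have ij: "n - 1 - Suc j = i - 1" "Suc j \<le> n - 1" using r by (auto simp: i_def)
      show "wp W paint (J (Suc j)) t"
        using painted_step[OF t' r(2,3) P] rt ct ij qi r W'
        by (auto simp: paint_def J_def inp_def)
    qed (simp add: paint_def)
    have "run W lp s' (26 * (\<Delta> + 1) + 30) (J (Suc j))"
      unfolding lp_def seqs.simps
      apply (rule run_seq[OF 1, where ?T2.0 = "26 * (\<Delta> + 1) + 20"])
       apply (simp only:)
       apply (rule run_seq[OF 2 3])
      by auto
    moreover have "j < n" using r by (simp add: i_def)
    ultimately show "j < n \<and> run W lp s' (26 * (\<Delta> + 1) + 30) (J (Suc j))" by simp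
  next
    fix j s' assume "J j s'" "\<not> bval (Less (Num 0) (Reg 6)) s'"
    then have "inp s'" "painted q 0 (arrs s' 2)" by (auto simp: J_def)
    then show "inp s' \<and> valid (arrs s' 2) (q 0)"
      using painted_end all by (simp add: q_def)
  qed (simp add: algebra_simps)
  then show ?thesis
    unfolding greedy_def lp_def[symmetric] q_def[symmetric]
    apply (intro run_seq[OF run_wp, where ?Q1.0 = "\<lambda>s'. s' = s1" and ?T1.0 = 4])
    using inp W' by (auto simp: s1_def inp_def)
qed

end

section \<open>Search for an edge of N between the two colours\<close>

definition markv :: "nat \<Rightarrow> nat \<Rightarrow> nat \<Rightarrow> com" where
  "markv a u k = fadj 3 4 5 u (Store a (Reg 5) (Num k))"

lemma wr_markv [simp]: "wr (markv a u k) = {3, 4, 5}" and wa_markv [simp]: "wa (markv a u k) = {a}"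
  by (auto simp: markv_def)

text \<open>Array 9 marks the neighbours of the vertex in register 16. Register 18 stores a
  differently coloured common neighbour plus one, since 0 means none and is itself a vertex;
  register 17 flags a vertex of N that is missed.\<close>

definition probe :: com where
  "probe = Cond (Equal (Cell 9 (Reg 5)) (Num 1))
     (Cond (Equal (Cell 2 (Reg 5)) (Cell 2 (Reg 16))) Skip (Assign 18 (Plus (Reg 5) (Num 1))))
     (Cond (Equal (Reg 5) (Reg 16)) Skip (Assign 17 (Num 1)))"

definition record_pair :: com where
  "record_pair = Cond (Conj (Less (Num 0) (Reg 17)) (Less (Num 0) (Reg 18)))
     (seqs [Assign 13 (Num 1), Assign 24 (Reg 16), Assign 25 (Minus (Reg 18) (Num 1))]) Skip"

definition scan :: com where
  "scan = seqs [markv 9 16 1, Assign 17 (Num 0), Assign 18 (Num 0), fadj 3 4 5 9 probe,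
     markv 9 16 0, record_pair]"

lemma wr_scan [simp]: "wr scan = {3, 4, 5, 13, 17, 18, 24, 25}" and wa_scan [simp]: "wa scan = {9}"
  by (auto simp: scan_def probe_def record_pair_def)

definition detect :: com where
  "detect = Seq (Assign 13 (Num 0)) (fadj 14 15 16 9 scan)"

lemma wr_detect [simp]: "wr detect = {3, 4, 5, 13, 14, 15, 16, 17, 18, 24, 25}"
  and wa_detect [simp]: "wa detect = {9}"
  by (auto simp: detect_def)

lemma run_wp_seq: "wp W c1 (\<lambda>s'. run W c2 s' T2 Q) s \<Longrightarrow> ccost c1 + T2 \<le> T \<Longrightarrow> run W (Seq c1 c2) s T Q"
  using run_seq[OF wp_run] by blast

context machine
begin

lemma nb_conv: "u < n \<Longrightarrow> nb u = (\<lambda>i. L ! u ! i) ` {..<\<Delta>}"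
  using length_adj[of u] by (auto simp: in_set_conv_nth image_iff)

lemma run_markv:
  assumes inp: "inp s" and u: "regs s u < n" "u \<notin> {3, 4, 5}" and a: "a \<notin> {0, 1}" and k: "k \<le> 1"
  shows "run W (markv a u k) s (25 * (\<Delta> + 1))
    (\<lambda>s'. inp s' \<and> arrs s' a = (\<lambda>y. if y \<in> nb (regs s u) then k else arrs s a y))"
proof -
  define v where "v = regs s u"
  define I where "I j s' \<longleftrightarrow> arrs s' a = (\<lambda>y. if y \<in> (\<lambda>i. L ! v ! i) ` {..<j} then k else arrs s a y)"
    for j and s' :: state
  have v: "v < n" using u by (simp add: v_def)
  have "run W (markv a u k) s (25 * (\<Delta> + 1)) (\<lambda>s'. I \<Delta> s' \<and> inp s')"
    unfolding markv_def
  proof (rule run_fadj[where Tb = 3])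
    show "inp s" "regs s u < n" "distinct [3, 4, 5, u]" using inp u by auto
    show "I 0 s" by (simp add: I_def)
    show "I j (s'\<lparr>regs := f\<rparr>)" if "I j s'" for j s' f using that by (simp add: I_def)
    show "run W (Store a (Reg 5) (Num k)) s' 3 (I (Suc j))"
      if j: "j < \<Delta>" and I: "I j s'" and y: "regs s' 5 = L ! regs s u ! j" for j s'
      by (rule run_wp) (use I y k nth_less[OF v j] W in \<open>auto simp: I_def v_def less_Suc_eq fun_eq_iff\<close>)
  qed (use u a in auto)
  then show ?thesis
    by (rule run_conseq) (simp_all add: I_def nb_conv[OF v] flip: v_def)
qed

lemma run_scan:
  assumes inp: "inp s" and v: "regs s 9 < n" and w: "regs s 16 < n" and z: "\<forall>y. arrs s 9 y = 0"
    and k: "k = (\<lambda>w. (\<exists>z\<in>nb (regs s 9). z \<noteq> w \<and> z \<notin> nb w) \<and>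
        (\<exists>y\<in>nb (regs s 9) \<inter> nb w. arrs s 2 y \<noteq> arrs s 2 w))"
  shows "run W scan s (150 * (\<Delta> + 1)) (\<lambda>s'. inp s' \<and> (\<forall>y. arrs s' 9 y = 0) \<and>
    (if k (regs s 16) then regs s' 13 = 1 \<and> regs s' 24 = regs s 16 \<and>
        regs s' 25 \<in> nb (regs s 9) \<inter> nb (regs s 16) \<and> arrs s 2 (regs s' 25) \<noteq> arrs s 2 (regs s 16)
     else regs s' 13 = regs s 13 \<and> regs s' 24 = regs s 24 \<and> regs s' 25 = regs s 25))"
proof -
  define w where "w = regs s 16"
  define v where "v = regs s 9"
  define x where "x = arrs s 2"
  have wn: "w < n" and vn: "v < n" using assms by (auto simp: w_def v_def)
  have W': "n < W" "1 \<le> W" using W by auto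
  define I where "I j s' \<longleftrightarrow>
    (0 < regs s' 17 \<longleftrightarrow> (\<exists>i<j. L ! v ! i \<noteq> w \<and> L ! v ! i \<notin> nb w)) \<and>
    (0 < regs s' 18 \<longrightarrow> regs s' 18 - 1 \<in> nb v \<inter> nb w \<and> x (regs s' 18 - 1) \<noteq> x w) \<and>
    (0 < regs s' 18 \<longleftrightarrow> (\<exists>i<j. L ! v ! i \<in> nb w \<and> x (L ! v ! i) \<noteq> x w))" for j and s' :: state
  have 1: "run W (markv 9 16 1) s (25 * (\<Delta> + 1)) (\<lambda>s'. inp s' \<and> arrs s' 9 = (\<lambda>y. if y \<in> nb w then 1 else 0))"
    by (rule run_conseq[OF run_markv]) (use inp wn z in \<open>auto simp: w_def\<close>)
  have 2: "run W (fadj 3 4 5 9 probe) s2 (40 * (\<Delta> + 1)) (\<lambda>s'. I \<Delta> s' \<and> inp s')"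
    if i2: "inp s2" and a9: "arrs s2 9 = (\<lambda>y. if y \<in> nb w then 1 else 0)"
      and r: "regs s2 17 = 0" "regs s2 18 = 0" "regs s2 16 = w" "regs s2 9 = v" "arrs s2 2 = x" for s2
  proof (rule run_fadj[where Tb = 21])
    show "I 0 s2" using r by (simp add: I_def)
    show "I j (s'\<lparr>regs := f\<rparr>)" if "I j s'" "\<And>y. y \<noteq> 3 \<Longrightarrow> y \<noteq> 4 \<Longrightarrow> y \<noteq> 5 \<Longrightarrow> f y = regs s' y" for j s' f
      using that by (simp add: I_def)
    show "run W probe t 21 (I (Suc j))"
      if j: "j < \<Delta>" and I: "I j t" and y: "regs t 5 = L ! regs s2 9 ! j"
        and sm: "same (fadj 3 4 5 9 probe) s2 t" for j t
    proof (rule run_wp)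
      have rt: "regs t 16 = w" "arrs t 2 = x" "arrs t 9 = (\<lambda>y. if y \<in> nb w then 1 else 0)"
        using same_regs[OF sm] same_arrs[OF sm] r a9 by (auto simp: probe_def)
      have y5: "regs t 5 = L ! v ! j" using y r by simp
      have yv: "L ! v ! j \<in> nb v" using length_adj[OF vn] j by simp
      have yn: "L ! v ! j < n" using nth_less[OF vn j] .
      show "wp W probe (I (Suc j)) t"
        using I rt y5 yn yv W' by (auto simp: probe_def I_def less_Suc_eq)
    qed (simp add: probe_def)
  qed (use i2 vn r in \<open>auto simp: probe_def\<close>)
  have 3: "run W (markv 9 16 0) s3 (25 * (\<Delta> + 1)) (\<lambda>s'. inp s' \<and> (\<forall>y. arrs s' 9 y = 0))"
    if "inp s3" "arrs s3 9 = (\<lambda>y. if y \<in> nb w then 1 else 0)" "regs s3 16 = w" for s3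
    by (rule run_conseq[OF run_markv]) (use that wn in auto)
  define R where "R s' \<longleftrightarrow> inp s' \<and> (\<forall>y. arrs s' 9 y = 0) \<and>
    (if k (regs s 16) then regs s' 13 = 1 \<and> regs s' 24 = regs s 16 \<and>
        regs s' 25 \<in> nb (regs s 9) \<inter> nb (regs s 16) \<and> arrs s 2 (regs s' 25) \<noteq> arrs s 2 (regs s 16)
     else regs s' 13 = regs s 13 \<and> regs s' 24 = regs s 24 \<and> regs s' 25 = regs s 25)" for s'
  have 4: "run W record_pair s4 17 R"
    if I: "I \<Delta> s4" and i4: "inp s4" "\<forall>y. arrs s4 9 y = 0" and r: "regs s4 16 = w"
      "regs s4 13 = regs s 13" "regs s4 24 = regs s 24" "regs s4 25 = regs s 25" for s4
  proof (rule run_wp)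
    have nv: "nb v = (\<lambda>i. L ! v ! i) ` {..<\<Delta>}" using nb_conv[OF vn] .
    have e1: "0 < regs s4 17 \<longleftrightarrow> (\<exists>z\<in>nb v. z \<noteq> w \<and> z \<notin> nb w)"
      and e2: "0 < regs s4 18 \<longleftrightarrow> (\<exists>y\<in>nb v \<inter> nb w. x y \<noteq> x w)"
      using I unfolding I_def nv by auto
    have e3: "regs s4 18 - 1 \<in> nb v \<inter> nb w \<and> x (regs s4 18 - 1) \<noteq> x w" if "0 < regs s4 18"
      using I that by (simp add: I_def)
    have e4: "regs s4 18 - 1 < n" if "0 < regs s4 18" using e3[OF that] adj_less[OF vn] by blast
    have kk: "k w \<longleftrightarrow> 0 < regs s4 17 \<and> 0 < regs s4 18"
      unfolding k e1 e2 by (simp add: v_def x_def)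
    show "wp W record_pair R s4"
    proof (cases "k w")
      case True
      then have p: "0 < regs s4 17" "0 < regs s4 18" using kk by auto
      show ?thesis
        using p e3[OF p(2)] e4[OF p(2)] True r i4 wn W'
        by (simp add: record_pair_def R_def inp_def w_def[symmetric] v_def[symmetric] x_def[symmetric])
    next
      case False
      then have "\<not> (0 < regs s4 17 \<and> 0 < regs s4 18)" using kk by auto
      then show ?thesis
        using False r i4 by (auto simp: record_pair_def R_def w_def)
    qed
  qed (simp add: record_pair_def)
  have "run W scan s (150 * (\<Delta> + 1)) R"
    unfolding scan_def seqs.simps
  proof (rule run_seq[OF 1, where ?T2.0 = "100 * (\<Delta> + 1)"])
    fix s1 assume s1: "inp s1 \<and> arrs s1 9 = (\<lambda>y. if y \<in> nb w then 1 else 0)" and sm1: "same (markv 9 16 1) s s1"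
    define s2 where "s2 = s1\<lparr>regs := (regs s1)(17 := 0, 18 := 0)\<rparr>"
    have r2: "regs s2 17 = 0" "regs s2 18 = 0" "regs s2 16 = w" "regs s2 9 = v" "arrs s2 2 = x"
        "regs s2 13 = regs s 13" "regs s2 24 = regs s 24" "regs s2 25 = regs s 25" "inp s2"
        "arrs s2 9 = (\<lambda>y. if y \<in> nb w then 1 else 0)"
      using s1 same_regs[OF sm1] same_arrs[OF sm1] by (auto simp: s2_def w_def v_def x_def inp_def)
    have "run W (Seq (fadj 3 4 5 9 probe) (Seq (markv 9 16 0) record_pair)) s2 (85 * (\<Delta> + 1)) R"
    proof (rule run_seq[OF 2, where ?T2.0 = "45 * (\<Delta> + 1)"])
      fix s3 assume s3: "I \<Delta> s3 \<and> inp s3" and sm3: "same (fadj 3 4 5 9 probe) s2 s3"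
      have r3: "regs s3 16 = w" "regs s3 13 = regs s 13" "regs s3 24 = regs s 24" "regs s3 25 = regs s 25"
          "arrs s3 9 = (\<lambda>y. if y \<in> nb w then 1 else 0)"
        using same_regs[OF sm3] same_arrs[OF sm3] r2 by (auto simp: probe_def)
      show "run W (Seq (markv 9 16 0) record_pair) s3 (45 * (\<Delta> + 1)) R"
      proof (rule run_seq[OF 3])
        fix s4 assume s4: "inp s4 \<and> (\<forall>y. arrs s4 9 y = 0)" and sm4: "same (markv 9 16 0) s3 s4"
        have "I \<Delta> s4" using s3 same_regs[OF sm4] by (simp add: I_def)
        then show "run W record_pair s4 17 R"
          using s4 r3 same_regs[OF sm4] by (intro 4) auto
      qed (use s3 r3 in auto)
    qed (use r2 in auto)
    then have "run W (Seq (Assign 18 (Num 0)) (Seq (fadj 3 4 5 9 probe) (Seq (markv 9 16 0) record_pair)))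
        (s1\<lparr>regs := (regs s1)(17 := 0)\<rparr>) (90 * (\<Delta> + 1)) R"
      by (intro run_wp_seq[where ?T2.0 = "85 * (\<Delta> + 1)"]) (simp_all add: s2_def)
    then show "run W (Seq (Assign 17 (Num 0)) (Seq (Assign 18 (Num 0)) (Seq (fadj 3 4 5 9 probe)
          (Seq (markv 9 16 0) record_pair)))) s1 (100 * (\<Delta> + 1)) R"
      by (intro run_wp_seq[where ?T2.0 = "90 * (\<Delta> + 1)"]) simp_all
  qed simp
  then show ?thesis unfolding R_def .
qed

text \<open>A positive result is the input of the triangle construction; a negative one is the
  assumption \<open>none\<close> of \<open>no_mixed_edges\<close>.\<close>

definition detected :: "nat \<Rightarrow> (nat \<Rightarrow> nat) \<Rightarrow> state \<Rightarrow> bool" where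
  "detected v x s \<longleftrightarrow>
    (0 < regs s 13 \<longrightarrow> regs s 24 \<in> nb v \<and> regs s 25 \<in> nb v \<inter> nb (regs s 24) \<and>
        x (regs s 25) \<noteq> x (regs s 24) \<and> (\<exists>z\<in>nb v. z \<noteq> regs s 24 \<and> z \<notin> nb (regs s 24))) \<and>
    (regs s 13 = 0 \<longrightarrow> (\<forall>w\<in>nb v. \<forall>y\<in>nb v. \<forall>z\<in>nb v.
        y \<in> nb w \<longrightarrow> x y \<noteq> x w \<longrightarrow> z \<noteq> w \<longrightarrow> z \<in> nb w))"

lemma run_detect:
  assumes inp: "inp s" and v: "regs s 9 < n" and z: "\<forall>y. arrs s 9 y = 0"
  shows "run W detect s (180 * U) (\<lambda>s'. inp s' \<and>
    detected (regs s 9) (arrs s 2) s')"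
proof -
  define v where "v = regs s 9"
  define x where "x = arrs s 2"
  define k where "k w \<longleftrightarrow> (\<exists>z\<in>nb v. z \<noteq> w \<and> z \<notin> nb w) \<and> (\<exists>y\<in>nb v \<inter> nb w. x y \<noteq> x w)" for w
  define I where "I j s' \<longleftrightarrow> (\<forall>y. arrs s' 9 y = 0) \<and>
    (0 < regs s' 13 \<longrightarrow> regs s' 24 \<in> nb v \<and> regs s' 25 \<in> nb v \<inter> nb (regs s' 24) \<and>
        x (regs s' 25) \<noteq> x (regs s' 24) \<and> (\<exists>z\<in>nb v. z \<noteq> regs s' 24 \<and> z \<notin> nb (regs s' 24))) \<and>
    (regs s' 13 = 0 \<longrightarrow> (\<forall>i<j. \<not> k (L ! v ! i)))" for j and s' :: state
  have vn: "v < n" using v by (simp add: v_def)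
  define s1 where "s1 = s\<lparr>regs := (regs s)(13 := 0)\<rparr>"
  have "run W (fadj 14 15 16 9 scan) s1 (170 * U) (\<lambda>s'. I \<Delta> s' \<and> inp s')"
  proof (rule run_fadj[where Tb = "150 * (\<Delta> + 1)"])
    show "inp s1" "regs s1 9 < n" using inp v by (auto simp: s1_def inp_def)
    show "I 0 s1" using z by (simp add: I_def s1_def)
    show "I j (s'\<lparr>regs := f\<rparr>)" if "I j s'" "\<And>y. y \<noteq> 14 \<Longrightarrow> y \<noteq> 15 \<Longrightarrow> y \<noteq> 16 \<Longrightarrow> f y = regs s' y" for j s' f
      using that by (simp add: I_def)
    show "run W scan t (150 * (\<Delta> + 1)) (I (Suc j))"
      if j: "j < \<Delta>" and I: "I j t" and it: "inp t" and y: "regs t 16 = L ! regs s1 9 ! j"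
        and sm: "same (fadj 14 15 16 9 scan) s1 t" for j t
    proof -
      have rt: "regs t 9 = v" "arrs t 2 = x"
        using same_regs[OF sm] same_arrs[OF sm] by (auto simp: s1_def v_def x_def)
      have w: "regs t 16 = L ! v ! j" using y by (simp add: s1_def v_def)
      have wn: "L ! v ! j < n" using nth_less[OF vn j] .
      have wv: "L ! v ! j \<in> nb v" using length_adj[OF vn] j by simp
      have kk: "k = (\<lambda>w. (\<exists>z\<in>nb (regs t 9). z \<noteq> w \<and> z \<notin> nb w) \<and>
          (\<exists>y\<in>nb (regs t 9) \<inter> nb w. arrs t 2 y \<noteq> arrs t 2 w))"
        using rt by (auto simp: k_def fun_eq_iff)
      show ?thesis
      proof (rule run_conseq[OF run_scan[OF it _ _ _ kk]])
        fix t' assume t': "inp t' \<and> (\<forall>y. arrs t' 9 y = 0) \<and>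
          (if k (regs t 16) then regs t' 13 = 1 \<and> regs t' 24 = regs t 16 \<and>
            regs t' 25 \<in> nb (regs t 9) \<inter> nb (regs t 16) \<and> arrs t 2 (regs t' 25) \<noteq> arrs t 2 (regs t 16)
          else regs t' 13 = regs t 13 \<and> regs t' 24 = regs t 24 \<and> regs t' 25 = regs t 25)"
        show "I (Suc j) t'"
        proof (cases "k (L ! v ! j)")
          case True
          then have "\<exists>z\<in>nb v. z \<noteq> L ! v ! j \<and> z \<notin> nb (L ! v ! j)" by (simp add: k_def)
          then show ?thesis using t' True w rt wv by (simp add: I_def)
        next
          case False
          then show ?thesis using t' I w by (simp add: I_def less_Suc_eq)
        qed
      qed (use I rt w wn vn in \<open>auto simp: I_def\<close>)
    qed
  next
    \<comment> \<open>A scan of cost O(\<Delta>) for each of the \<Delta> neighbours is affordable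
      because \<Delta> < n.\<close>
    have "\<Delta> + 1 \<le> n + 1" using degree_less by simp
    then have "(\<Delta> + 1) * (150 * (\<Delta> + 1) + 19) \<le> (n + 1) * (150 * (\<Delta> + 1) + 19)" by (rule mult_le_mono1)
    also have "\<dots> \<le> 170 * U" by (simp add: algebra_simps)
    finally show "(\<Delta> + 1) * (150 * (\<Delta> + 1) + 19) \<le> 170 * U" .
  qed auto
  then have "run W detect s (180 * U) (\<lambda>s'. I \<Delta> s' \<and> inp s')"
    unfolding detect_def
    apply (intro run_seq[OF run_wp, where ?Q1.0 = "\<lambda>s'. s' = s1" and ?T1.0 = 2])
       apply (simp add: s1_def)
      apply simp
     apply simp
    by simp
  then show ?thesis
  proof (rule run_conseq)
    fix s' assume s': "I \<Delta> s' \<and> inp s'"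
    have "\<forall>w\<in>nb v. \<not> k w" if "regs s' 13 = 0"
      using s' that unfolding I_def nb_conv[OF vn] by auto
    then show "inp s' \<and>
    detected (regs s 9) (arrs s 2) s'"
      using s' unfolding detected_def I_def k_def v_def[symmetric] x_def[symmetric] by blast
  qed simp
qed

end

section \<open>Searching \<open>G - v\<close> and extracting a path\<close>

definition block :: com where
  "block = seqs [clear, Assign 7 (Num 0), Store 5 (Reg 9) (Num 1)]"

lemma wr_block [simp]: "wr block = {6, 7}" and wa_block [simp]: "wa block = {5}"
  by (auto simp: block_def)

definition collect :: "bexp \<Rightarrow> com" where
  "collect b = fadj 3 4 5 9 (Cond b (push 5) Skip)"

lemma wr_collect [simp]: "wr (collect b) = {3, 4, 5, 7}" and wa_collect [simp]: "wa (collect b) = {3, 5}"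
  by (auto simp: collect_def)

text \<open>The loop has no bound check: it stops because some vertex of N is queued after the
  sources.\<close>

definition find :: com where
  "find = Seq (Assign 22 (Reg 23))
     (While (Equal (Cell 8 (Cell 3 (Reg 22))) (Num 0)) (Assign 22 (Plus (Reg 22) (Num 1))))"

definition climb :: "nat \<Rightarrow> nat \<Rightarrow> com" where
  "climb a lr = While (Neg (Less (Reg 22) (Reg 23)))
     (seqs [Store a (Reg lr) (Cell 3 (Reg 22)), Assign lr (Plus (Reg lr) (Num 1)), Assign 22 (Cell 4 (Reg 22))])"

definition finish :: "nat \<Rightarrow> nat \<Rightarrow> com" where
  "finish a lr = seqs [Store a (Reg lr) (Cell 3 (Reg 22)), Assign lr (Plus (Reg lr) (Num 1)),
     Store a (Reg lr) (Reg 9)]"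

definition trace_path :: "nat \<Rightarrow> nat \<Rightarrow> com" where
  "trace_path a lr = seqs [find, Store a (Num 0) (Reg 9), Assign lr (Num 1), climb a lr, finish a lr]"

lemma wr_trace_path [simp]: "wr (trace_path a lr) = {22, lr}" and wa_trace_path [simp]: "wa (trace_path a lr) = {a}"
  by (auto simp: trace_path_def find_def climb_def finish_def)

context machine
begin

lemma run_block:
  assumes inp: "inp s" and v: "regs s 9 < n"
  shows "run W block s (30 * U) (\<lambda>s'. inp s' \<and> que {regs s 9} s' [])"
  unfolding block_def seqs.simps
proof (rule run_seq[OF run_clear[OF inp], where ?T2.0 = 10])
  fix s' assume s': "inp s' \<and> (\<forall>y<n. arrs s' 5 y = 0)" and sm: "same clear s s'"
  have "regs s' 9 = regs s 9" using same_regs[OF sm] by simp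
  then show "run W (Seq (Assign 7 (Num 0)) (Store 5 (Reg 9) (Num 1))) s' 10 (\<lambda>s'. inp s' \<and> que {regs s 9} s' [])"
    by (intro run_wp) (use s' v W in \<open>auto simp: inp_def que_def\<close>)
qed simp

lemma run_collect:
  assumes inp: "inp s" and v: "regs s 9 < n" and q: "que B s Q0"
    and b: "\<And>s'. same (collect b) s s' \<Longrightarrow> bval b s' \<longleftrightarrow> F (regs s' 5)" and bc: "bcost b \<le> 20"
    and F: "\<And>y. y \<in> nb (regs s 9) \<Longrightarrow> F y \<Longrightarrow> y \<notin> set Q0 \<union> B"
  shows "run W (collect b) s (80 * (\<Delta> + 1)) (\<lambda>s'. inp s' \<and> que B s' (Q0 @ filter F (L ! regs s 9)))"
proof -
  define v where "v = regs s 9"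
  have vn: "v < n" using v by (simp add: v_def)
  define I where "I j s' \<longleftrightarrow> que B s' (Q0 @ filter F (take j (L ! v)))" for j and s' :: state
  have "run W (collect b) s (80 * (\<Delta> + 1)) (\<lambda>s'. I \<Delta> s' \<and> inp s')"
    unfolding collect_def
  proof (rule run_fadj[where Tb = 60])
    show "I 0 s" using q by (simp add: I_def)
    show "I j (s'\<lparr>regs := f\<rparr>)" if "I j s'" "\<And>y. y \<noteq> 3 \<Longrightarrow> y \<noteq> 4 \<Longrightarrow> y \<noteq> 5 \<Longrightarrow> f y = regs s' y" for j s' f
      using that by (simp add: I_def que_def)
    show "run W (Cond b (push 5) Skip) t 60 (I (Suc j))"
      if j: "j < \<Delta>" and I: "I j t" and y: "regs t 5 = L ! regs s 9 ! j"
        and sm: "same (fadj 3 4 5 9 (Cond b (push 5) Skip)) s t" for j t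
    proof (rule run_wp)
      have y5: "regs t 5 = L ! v ! j" using y by (simp add: v_def)
      have yn: "L ! v ! j < n" using nth_less[OF vn j] .
      have yv: "L ! v ! j \<in> nb v" using length_adj[OF vn] j by simp
      have tk: "take (Suc j) (L ! v) = take j (L ! v) @ [L ! v ! j]"
        using j length_adj[OF vn] by (simp add: take_Suc_conv_app_nth)
      have bF: "bval b t \<longleftrightarrow> F (L ! v ! j)" using b sm y5 by (simp add: collect_def)
      have "distinct (take (Suc j) (L ! v))" using distinct_adj[OF vn] by simp
      then have nin: "L ! v ! j \<notin> set (take j (L ! v))" unfolding tk by simp
      show "wp W (Cond b (push 5) Skip) (I (Suc j)) t"
      proof (cases "F (L ! v ! j)")
        case True
        have "wp W (push 5) (I (Suc j)) t"
        proof (rule wp_push)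
          show "que B t (Q0 @ filter F (take j (L ! v)))" using I by (simp add: I_def)
          show "regs t 5 \<notin> set (Q0 @ filter F (take j (L ! v))) \<union> B"
            using F[of "L ! v ! j"] yv True nin y5 by (auto simp: v_def)
          fix t' assume "que B t' ((Q0 @ filter F (take j (L ! v))) @ [regs t 5])"
          then show "I (Suc j) t'" using True y5 tk by (simp add: I_def)
        qed (use y5 yn in auto)
        then show ?thesis using True bF by simp
      next
        case False
        then show ?thesis using bF I tk by (simp add: I_def)
      qed
    qed (use bc in \<open>simp add: push_def\<close>)
  qed (use inp v in auto)
  then show ?thesis
    by (rule run_conseq) (use length_adj[OF vn] in \<open>auto simp: I_def v_def\<close>)
qed

lemma run_trace_path:
  assumes inp: "inp s" and a: "a \<in> {6, 7}" and lr: "lr \<in> {20, 21}"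
    and t: "bfs_tree (arrs s 3) (arrs s 4) T t0" and vr: "regs s 9 = v" "v < n"
    and all: "arrs s 3 ` {..<T} = {..<n} - {v}" and r: "regs s 23 = t0"
    and mk: "\<forall>y<n. arrs s 8 y \<noteq> 0 \<longleftrightarrow> y \<in> nb v" and ex: "\<exists>k. t0 \<le> k \<and> k < T \<and> arrs s 3 k \<in> nb v"
  shows "run W (trace_path a lr) s (120 * U) (\<lambda>s'. inp s' \<and> (\<exists>k0 l.
      hole_tree L \<Delta> pA pB (arrs s 3) (arrs s 4) T t0 v k0 l \<and>
      (\<forall>i\<le>l + 2. arrs s' a i = hole_tree.tcyc (arrs s 3) (arrs s 4) v k0 l i) \<and>
      regs s' lr = l + 2 \<and> regs s' 22 = (arrs s 4 ^^ l) k0))"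
proof -
  define q where "q = arrs s 3"
  define p where "p = arrs s 4"
  note tree = t[folded q_def p_def] and all' = all[folded q_def]
  note qn = bfs_treeD(3)[OF tree]
  have Tn: "T \<le> n"
  proof -
    have "card (q ` {..<T}) = T" using bfs_treeD(1)[OF tree] by (simp add: card_image)
    moreover have "card (q ` {..<T}) \<le> card {..<n}" unfolding all' by (intro card_mono) auto
    ultimately show ?thesis by simp
  qed
  define k0 where "k0 = (LEAST k. t0 \<le> k \<and> k < T \<and> q k \<in> nb v)"
  have k0: "t0 \<le> k0" "k0 < T" "q k0 \<in> nb v"
    using LeastI_ex[OF ex] by (simp_all add: k0_def q_def)
  have first: "q i \<notin> nb v" if "t0 \<le> i" "i < k0" for i
  proof
    assume "q i \<in> nb v"
    moreover have "i < T" using that k0 by simp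
    ultimately have "k0 \<le> i" unfolding k0_def using that by (intro Least_le) auto
    then show False using that by simp
  qed
  \<comment> \<open>Each step to a parent lowers the queue index. So a source is reached, and within
    \<open>k0\<close> steps, which bounds both \<open>l\<close> and the time.\<close>
  have dec: "(p ^^ a) k0 + a \<le> k0" if "\<forall>b<a. t0 \<le> (p ^^ b) k0" for a
    using that
  proof (induction a)
    case (Suc a)
    then have "(p ^^ a) k0 + a \<le> k0" "t0 \<le> (p ^^ a) k0" by auto
    moreover from this have "p ((p ^^ a) k0) < (p ^^ a) k0"
      using k0 by (intro bfs_treeD(4)[OF tree]) auto
    ultimately show ?case by simp
  qed simp
  have exl: "\<exists>l. (p ^^ l) k0 < t0"
  proof (rule ccontr)
    assume "\<not> ?thesis"
    then have "\<forall>b<Suc k0. t0 \<le> (p ^^ b) k0" by (simp add: not_less)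
    from dec[OF this] show False by simp
  qed
  define l where "l = (LEAST l. (p ^^ l) k0 < t0)"
  have l: "(p ^^ l) k0 < t0" "\<And>a. a < l \<Longrightarrow> t0 \<le> (p ^^ a) k0"
    using LeastI_ex[OF exl] not_less_Least[where P = "\<lambda>l. (p ^^ l) k0 < t0"]
    unfolding l_def[symmetric] by (simp, meson not_less)
  interpret hole_tree L \<Delta> pA pB q p T t0 v k0 l
    by (unfold_locales) (use tree vr(2) all' k0 first l in auto)
  have ppT: "pp a < T" if "a \<le> l" for a using pp_less_T that .
  have ln: "l \<le> n"
  proof -
    have "pp l + l \<le> k0" using dec[of l] l(2) by simp
    then show ?thesis using k0 Tn by simp
  qed
  have W': "n + 5 \<le> W" using W by auto
  have aa: "a \<noteq> 3" "a \<noteq> 4" "a \<noteq> 8" "a \<notin> {0,1}" and ll: "lr \<noteq> 22" "lr \<noteq> 23" "lr \<noteq> 9" "lr \<notin> {0, 2}"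
    using a lr by auto
  define A where "A s' \<longleftrightarrow> inp s' \<and> arrs s' 3 = q \<and> arrs s' 4 = p \<and> arrs s' 8 = arrs s 8 \<and>
    regs s' 9 = v \<and> regs s' 23 = t0" for s'
  have find: "run W find s (30 * U) (\<lambda>s'. A s' \<and> regs s' 22 = k0)"
    unfolding find_def
  proof (rule run_wp_seq[where ?T2.0 = "27 * U"])
    let ?s1 = "s\<lparr>regs := (regs s)(22 := t0)\<rparr>"
    define J where "J j s' \<longleftrightarrow> A s' \<and> regs s' 22 = t0 + j \<and> t0 + j \<le> k0" for j s'
    have "run W (While (Equal (Cell 8 (Cell 3 (Reg 22))) (Num 0)) (Assign 22 (Plus (Reg 22) (Num 1)))) ?s1 (27 * U)
       (\<lambda>s'. A s' \<and> regs s' 22 = k0)"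
    proof (rule run_while[where I = J and N = n and Tb = 4])
      show "J 0 ?s1" using inp r vr k0 by (auto simp: J_def A_def q_def p_def inp_def)
    next
      fix j s' assume J: "J j s'" and b: "bval (Equal (Cell 8 (Cell 3 (Reg 22))) (Num 0)) s'"
      have jT: "t0 + j < T" using J k0 by (simp add: J_def)
      have m: "arrs s 8 (q (t0 + j)) = 0" using J b by (simp add: J_def A_def)
      then have "q (t0 + j) \<notin> nb v" using mk qn[OF jT] by auto
      then have "t0 + j \<noteq> k0" using k0 by auto
      then have "t0 + Suc j \<le> k0" using J by (simp add: J_def)
      then have "run W (Assign 22 (Plus (Reg 22) (Num 1))) s' 4 (J (Suc j))"
        by (intro run_wp) (use J jT Tn W' in \<open>auto simp: J_def A_def inp_def\<close>)
      then show "j < n \<and> run W (Assign 22 (Plus (Reg 22) (Num 1))) s' 4 (J (Suc j))" using jT Tn by simp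
    next
      fix j s' assume J: "J j s'" and b: "\<not> bval (Equal (Cell 8 (Cell 3 (Reg 22))) (Num 0)) s'"
      have jT: "t0 + j < T" using J k0 by (simp add: J_def)
      have m: "arrs s 8 (q (t0 + j)) \<noteq> 0" using J b by (simp add: J_def A_def)
      then have "q (t0 + j) \<in> nb v" using mk qn[OF jT] by auto
      then have "t0 + j = k0" using first[of "t0 + j"] J by (fastforce simp: J_def)
      then show "A s' \<and> regs s' 22 = k0" using J by (simp add: J_def)
    qed simp
    then show "wp W (Assign 22 (Reg 23)) (\<lambda>s'. run W (While (Equal (Cell 8 (Cell 3 (Reg 22))) (Num 0))
       (Assign 22 (Plus (Reg 22) (Num 1)))) s' (27 * U) (\<lambda>s'. A s' \<and> regs s' 22 = k0)) s"
      using r k0 Tn W' by simp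
  qed simp
  define C where "C j s' \<longleftrightarrow> A s' \<and> j \<le> l \<and> regs s' 22 = pp j \<and> regs s' lr = j + 1 \<and>
     (\<forall>i\<le>j. arrs s' a i = tcyc i)" for j s'
  have climb: "run W (climb a lr) s' (30 * U) (C l)" if C0: "C 0 s'" for s'
    unfolding climb_def
  proof (rule run_while[where I = C and N = n and Tb = 12])
    show "C 0 s'" by (rule C0)
  next
    fix j t assume C: "C j t" and b: "bval (Neg (Less (Reg 22) (Reg 23))) t"
    have pj: "t0 \<le> pp j" using C b by (simp add: C_def A_def)
    then have "j \<noteq> l" using l(1) by auto
    then have j: "j < l" using C by (simp add: C_def)
    have e: "tcyc (Suc j) = q (pp j)" using j by (simp add: tcyc_def)
    have qj: "q (pp j) < n" "pp (Suc j) < T" using qn ppT[of j] ppT[of "Suc j"] j by auto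
    have "run W (seqs [Store a (Reg lr) (Cell 3 (Reg 22)), Assign lr (Plus (Reg lr) (Num 1)),
        Assign 22 (Cell 4 (Reg 22))]) t 12 (C (Suc j))"
      by (rule run_wp) (use C j e qj aa ll ln Tn W' in \<open>auto simp: C_def A_def inp_def le_Suc_eq\<close>)
    then show "j < n \<and> run W (seqs [Store a (Reg lr) (Cell 3 (Reg 22)), Assign lr (Plus (Reg lr) (Num 1)),
        Assign 22 (Cell 4 (Reg 22))]) t 12 (C (Suc j))" using j ln by simp
  next
    fix j t assume C: "C j t" and b: "\<not> bval (Neg (Less (Reg 22) (Reg 23))) t"
    have "pp j < t0" using C b by (simp add: C_def A_def)
    then have "\<not> j < l" using l(2)[of j] by auto
    then show "C l t" using C by (auto simp: C_def)
  qed (simp add: algebra_simps)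
  define R where "R s' \<longleftrightarrow> inp s' \<and> (\<forall>i\<le>l + 2. arrs s' a i = tcyc i) \<and> regs s' lr = l + 2 \<and> regs s' 22 = pp l"
    for s'
  have fin: "run W (finish a lr) s' 20 R" if C: "C l s'" for s'
  proof (rule run_wp)
    have e: "tcyc (Suc l) = q (pp l)" "tcyc (Suc (Suc l)) = v" by (simp_all add: tcyc_def)
    have ql: "q (pp l) < n" using qn ppT by blast
    show "wp W (finish a lr) R s'"
      using C e ql aa ll ln vr(2) W' by (auto simp: C_def A_def R_def finish_def inp_def le_Suc_eq)
  qed (simp add: finish_def)
  have "run W (trace_path a lr) s (60 * U + 60) R"
    unfolding trace_path_def seqs.simps
  proof (rule run_seq[OF find, where ?T2.0 = "30 * U + 40"])
    fix s1 assume s1: "A s1 \<and> regs s1 22 = k0"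
    let ?s2 = "s1\<lparr>arrs := (arrs s1)(a := (arrs s1 a)(0 := v)), regs := (regs s1)(lr := 1)\<rparr>"
    have "C 0 ?s2" using s1 aa ll by (auto simp: C_def A_def tcyc_def inp_def)
    then have r2: "run W (Seq (climb a lr) (finish a lr)) ?s2 (30 * U + 20) R"
      by (intro run_seq[OF climb fin]) auto
    have "run W (Seq (Assign lr (Num 1)) (Seq (climb a lr) (finish a lr)))
        (s1\<lparr>arrs := (arrs s1)(a := (arrs s1 a)(0 := v))\<rparr>) (30 * U + 25) R"
      by (rule run_wp_seq[where ?T2.0 = "30 * U + 20"]) (use r2 W' in auto)
    then show "run W (Seq (Store a (Num 0) (Reg 9)) (Seq (Assign lr (Num 1)) (Seq (climb a lr) (finish a lr)))) s1
        (30 * U + 40) R"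
      by (intro run_wp_seq[where ?T2.0 = "30 * U + 25"]) (use s1 vr W' in \<open>auto simp: A_def\<close>)
  qed simp
  then show ?thesis
  proof (rule run_conseq)
    fix s' assume "R s'"
    then show "inp s' \<and> (\<exists>k0 l.
      hole_tree L \<Delta> pA pB (arrs s 3) (arrs s 4) T t0 v k0 l \<and>
      (\<forall>i\<le>l + 2. arrs s' a i = hole_tree.tcyc (arrs s 3) (arrs s 4) v k0 l i) \<and>
      regs s' lr = l + 2 \<and> regs s' 22 = (arrs s 4 ^^ l) k0)"
      unfolding R_def q_def[symmetric] p_def[symmetric] using hole_tree_axioms by blast
  qed simp
qed

end

text \<open>The number of sources is saved first, since the search advances the queue tail in
  register 7.\<close>

definition grow :: "nat \<Rightarrow> nat \<Rightarrow> com" where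
  "grow a lr = seqs [Assign 23 (Reg 7), bfs, trace_path a lr]"

lemma wr_grow [simp]: "wr (grow a lr) = {3, 4, 5, 6, 7, 8, 22, 23, lr}"
  and wa_grow [simp]: "wa (grow a lr) = {3, 4, 5, a}"
  by (auto simp: grow_def)

section \<open>The two cycles when N has an edge between the colours\<close>

definition triangle :: com where
  "triangle = seqs [Store 6 (Num 0) (Reg 9), Store 6 (Num 1) (Cell 3 (Reg 22)),
     Cond (Equal (Cell 2 (Cell 3 (Reg 22))) (Cell 2 (Reg 24)))
       (Store 6 (Num 2) (Reg 25)) (Store 6 (Num 2) (Reg 24)),
     Store 6 (Num 3) (Reg 9), Assign 20 (Num 3)]"

definition common :: bexp where
  "common = Conj (Equal (Cell 10 (Reg 5)) (Num 1)) (Equal (Cell 11 (Reg 5)) (Num 1))"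

text \<open>The ends of the two-coloured edge are pushed before their common neighbours:
  \<open>good_triangle\<close> needs them at queue positions 0 and 1.\<close>

definition mixed_case :: com where
  "mixed_case = seqs [block, push 24, push 25, markv 10 24 1, markv 11 25 1,
     collect common, grow 7 21, triangle]"

lemma wr_mixed [simp]: "wr mixed_case = {3, 4, 5, 6, 7, 8, 20, 21, 22, 23}"
  and wa_mixed [simp]: "wa mixed_case = {3, 4, 5, 6, 7, 10, 11}"
  by (auto simp: mixed_case_def triangle_def)

text \<open>The first cycle is queued from its last vertex down to its first, so that
  \<open>q 0\<close> is the end of colour 0, as \<open>start_color\<close> requires.\<close>

definition load :: com where
  "load = Seq (Assign 13 (Minus (Reg 20) (Num 1))) (While (Less (Num 0) (Reg 13))
     (seqs [Assign 8 (Cell 6 (Reg 13)), push 8, Assign 13 (Minus (Reg 13) (Num 1))]))"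

lemma wr_load [simp]: "wr load = {7, 8, 13}" and wa_load [simp]: "wa load = {3, 5}"
  by (auto simp: load_def)

context machine
begin

lemma que_same: "que B s Q \<Longrightarrow> same c s s' \<Longrightarrow> 7 \<notin> wr c \<Longrightarrow> 3 \<notin> wa c \<Longrightarrow> 5 \<notin> wa c \<Longrightarrow> que B s' Q"
  by (simp add: que_def same_def)

lemma run_push:
  assumes "inp s" "que B s Q" "regs s r < n" "regs s r \<notin> set Q \<union> B" "r \<noteq> 7"
  shows "run W (push r) s 12 (\<lambda>s'. inp s' \<and> que B s' (Q @ [regs s r]))"
  by (rule run_wp[OF wp_push[OF assms(2-5)]]) (auto simp: push_def intro: inp_same[OF _ assms(1)])

definition marked :: "nat \<Rightarrow> state \<Rightarrow> bool" where
  "marked v s \<longleftrightarrow> inp s \<and> regs s 9 = v \<and> (\<forall>y<n. arrs s 8 y \<noteq> 0 \<longleftrightarrow> y \<in> nb v)"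

lemma marked_same:
  assumes "marked v s" "same c s s'" "wr c \<inter> {0, 2, 9} = {}" "wa c \<inter> {0, 1, 8} = {}"
  shows "marked v s'"
proof -
  have "inp s'" by (rule inp_same[OF assms(2)]) (use assms in \<open>auto simp: marked_def\<close>)
  moreover have "regs s' 9 = regs s 9" "arrs s' 8 = arrs s 8" using assms by (auto simp: same_def)
  ultimately show ?thesis using assms(1) by (simp add: marked_def)
qed

definition grown :: "nat \<Rightarrow> nat \<Rightarrow> nat \<Rightarrow> nat list \<Rightarrow> state \<Rightarrow> bool" where
  "grown a lr v Q0 s \<longleftrightarrow> (\<exists>T k0 l.
      hole_tree L \<Delta> pA pB (arrs s 3) (arrs s 4) T (length Q0) v k0 l \<and>
      (\<forall>i<length Q0. arrs s 3 i = Q0 ! i) \<and>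
      (\<forall>i\<le>l + 2. arrs s a i = hole_tree.tcyc (arrs s 3) (arrs s 4) v k0 l i) \<and>
      regs s lr = l + 2 \<and> regs s 22 = (arrs s 4 ^^ l) k0) \<and> regs s 23 = length Q0"

lemma run_grow:
  assumes m: "marked v s" and v: "v < n" "noncut v" and a: "a \<in> {6, 7}" and lr: "lr \<in> {20, 21}"
    and q: "que {v} s Q0" and Q0: "Q0 \<noteq> []" and ex: "\<exists>z\<in>nb v. z \<notin> set Q0"
  shows "run W (grow a lr) s (210 * U) (grown a lr v Q0)"
proof -
  define s1 where "s1 = s\<lparr>regs := (regs s)(23 := length Q0)\<rparr>"
  have inp1: "inp s1" using m by (simp add: s1_def inp_def marked_def)
  have q1: "que {v} s1 Q0" using q by (simp add: que_def s1_def)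
  have m1: "marked v s1" using m inp1 by (simp add: marked_def s1_def)
  have r7: "regs s 7 = length Q0" "length Q0 \<le> W" using q que_length[OF q] W by (auto simp: que_def)
  define R where "R = grown a lr v Q0"
  have "run W (Seq bfs (trace_path a lr)) s1 (200 * U) R"
  proof (rule run_seq[OF run_bfs[OF inp1 q1]])
    fix s2 assume s2: "inp s2 \<and> (\<exists>Q. binv {v} Q0 (length Q) s2 Q)" and sm2: "same bfs s1 s2"
    then obtain Q where Q: "binv {v} Q0 (length Q) s2 Q" by blast
    note t = binv_tree[OF Q]
    have sQ: "set Q = {..<n} - {v}" by (rule binv_noncut[OF Q Q0 v(2)])
    have m2: "marked v s2" by (rule marked_same[OF m1 sm2]) auto
    have r23: "regs s2 23 = length Q0" using same_regs[OF sm2, of 23] by (simp add: s1_def)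
    have exk: "\<exists>k. length Q0 \<le> k \<and> k < length Q \<and> arrs s2 3 k \<in> nb v"
    proof -
      obtain z where z: "z \<in> nb v" "z \<notin> set Q0" using ex by blast
      have "z \<in> {..<n} - {v}" using z adj_less[OF v(1)] adj_irrefl[OF v(1)] by auto
      then have "z \<in> arrs s2 3 ` {..<length Q}" using t(3) sQ by simp
      then obtain k where k: "k < length Q" "z = arrs s2 3 k" by auto
      have "\<not> k < length Q0" using t(2)[of k] k z(2) by auto
      then show ?thesis using k z by (intro exI[of _ k]) auto
    qed
    show "run W (trace_path a lr) s2 (120 * U) R"
    proof (rule run_conseq[OF run_trace_path[of s2 a lr "length Q" "length Q0" v]])
      fix s3 assume s3: "inp s3 \<and> (\<exists>k0 l.
        hole_tree L \<Delta> pA pB (arrs s2 3) (arrs s2 4) (length Q) (length Q0) v k0 l \<and>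
        (\<forall>i\<le>l + 2. arrs s3 a i = hole_tree.tcyc (arrs s2 3) (arrs s2 4) v k0 l i) \<and>
        regs s3 lr = l + 2 \<and> regs s3 22 = (arrs s2 4 ^^ l) k0)" and sm3: "same (trace_path a lr) s2 s3"
      have "arrs s3 3 = arrs s2 3" "arrs s3 4 = arrs s2 4" "regs s3 23 = length Q0"
        using same_arrs[OF sm3] same_regs[OF sm3] a lr r23 by auto
      then show "R s3" unfolding R_def grown_def using s3 t(2) by auto
    qed (use m2 t sQ r23 exk a lr v in \<open>auto simp: marked_def\<close>)
  qed simp
  then show ?thesis
    unfolding grow_def seqs.simps R_def[symmetric]
    by (intro run_wp_seq[where ?T2.0 = "200 * U"]) (use r7 in \<open>simp_all add: s1_def\<close>)
qed

definition ready :: "nat \<Rightarrow> (nat \<Rightarrow> nat) \<Rightarrow> state \<Rightarrow> bool" where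
  "ready v x s \<longleftrightarrow> (\<exists>c k d r. good v x c k d r \<and> (\<forall>i\<le>k. arrs s 6 i = c i) \<and> regs s 20 = k \<and>
     (\<forall>i\<le>r. arrs s 7 i = d i) \<and> regs s 21 = r)"

lemma run_mixed:
  assumes m: "marked v s" and v: "v < n" "noncut v" and x: "arrs s 2 = x"
    and z10: "\<forall>y. arrs s 10 y = 0" "\<forall>y. arrs s 11 y = 0"
    and w: "regs s 24 = w" "w \<in> nb v" and w': "regs s 25 = w'" "w' \<in> nb v \<inter> nb w" "x w' \<noteq> x w"
    and z: "\<exists>z\<in>nb v. z \<noteq> w \<and> z \<notin> nb w"
  shows "run W mixed_case s (600 * U) (ready v x)"
proof -
  have wn: "w < n" "w' < n" using w w' adj_less[OF v(1)] by auto
  have ne: "w \<noteq> v" "w' \<noteq> v" "w \<noteq> w'" using w w' adj_irrefl[OF v(1)] by auto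
  have nself: "w \<notin> nb w" "w' \<notin> nb w'" using adj_irrefl wn by auto
  define F where "F y \<longleftrightarrow> y \<in> nb w \<and> y \<in> nb w'" for y
  define Q0 where "Q0 = [w, w'] @ filter F (L ! v)"
  have Q0: "Q0 \<noteq> []" "set Q0 = {w, w'} \<union> (nb v \<inter> nb w \<inter> nb w')" "2 \<le> length Q0"
    "Q0 ! 0 = w" "Q0 ! 1 = w'" by (auto simp: Q0_def F_def)
  \<comment> \<open>The vertex of N that \<open>w\<close> misses is not \<open>w'\<close> and not a
    common neighbour, so it is no source.\<close>
  have exz: "\<exists>z\<in>nb v. z \<notin> set Q0" using z w' unfolding Q0(2) by auto
  have inp: "inp s" "regs s 9 = v" using m by (auto simp: marked_def)
  have W': "n + 5 \<le> W" using W by simp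
  have b1: "run W block s (30 * U) (\<lambda>s'. inp s' \<and> que {v} s' [])"
    using run_block[OF inp(1)] inp v by simp
  have tri: "run W triangle s' 40 (ready v x)"
    if sm: "marked v s'" "arrs s' 2 = x" "regs s' 24 = w" "regs s' 25 = w'"
      and gr: "grown 7 21 v Q0 s'" for s'
  proof -
    define q where "q = arrs s' 3"
    define p where "p = arrs s' 4"
    obtain T k0 l where H: "hole_tree L \<Delta> pA pB q p T (length Q0) v k0 l"
      and qi: "\<forall>i<length Q0. q i = Q0 ! i"
      and a7: "\<forall>i\<le>l + 2. arrs s' 7 i = hole_tree.tcyc q p v k0 l i"
      and r: "regs s' 21 = l + 2" "regs s' 22 = (p ^^ l) k0"
      using gr by (auto simp: grown_def q_def p_def)
    interpret H: hole_tree L \<Delta> pA pB q p T "length Q0" v k0 l by (rule H)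
    define u where "u = (if x (q (H.pp l)) = x w then w' else w)"
    have im: "q ` {..<length Q0} = set Q0" using qi by (auto simp: in_set_conv_nth image_iff)
    have good: "good v x (H.tri u) 3 H.tcyc (l + 2)"
    proof (rule H.good_triangle[where w = w and w' = w'])
      show "q 0 = w" "q 1 = w'" using qi Q0 by auto
    qed (use w w' Q0 im u_def in auto)
    have e: "H.tri u 0 = v" "H.tri u (Suc 0) = q (H.pp l)" "H.tri u 2 = u" "H.tri u 3 = v"
      by (auto simp: H.tri_def)
    have qn: "q (H.pp l) < n" using H.q_less H.pp_less_T by blast
    have v9: "regs s' 9 = v" using sm by (simp add: marked_def)
    have rdy: "ready v x t" if "arrs t 7 = arrs s' 7" "regs t 21 = regs s' 21" "regs t 20 = 3"
        "arrs t 6 0 = v" "arrs t 6 (Suc 0) = q (H.pp l)" "arrs t 6 2 = u" "arrs t 6 3 = v" for t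
      unfolding ready_def
    proof (intro exI conjI)
      show "good v x (H.tri u) 3 H.tcyc (l + 2)" by (rule good)
      show "\<forall>i\<le>3. arrs t 6 i = H.tri u i"
      proof (intro allI impI)
        fix i :: nat assume "i \<le> 3"
        then have "i = 0 \<or> i = Suc 0 \<or> i = 2 \<or> i = 3" by auto
        then show "arrs t 6 i = H.tri u i" using that e by auto
      qed
    qed (use that a7 r in auto)
    have a3: "arrs s' 3 (regs s' 22) = q (H.pp l)" using r by (simp add: q_def)
    have un: "w \<le> W" "w' \<le> W" "v \<le> W" "q (H.pp l) \<le> W" "3 \<le> W" using wn v qn W' by auto
    show ?thesis
    proof (rule run_wp)
      show "wp W triangle (ready v x) s'"
      proof (cases "x (q (H.pp l)) = x w")
        case True
        then have "u = w'" by (simp add: u_def)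
        then show ?thesis using True sm v9 a3 un by (simp add: triangle_def rdy)
      next
        case False
        then have "u = w" by (simp add: u_def)
        then show ?thesis using False sm v9 a3 un by (simp add: triangle_def rdy)
      qed
    qed (simp add: triangle_def)
  qed
  show ?thesis
    unfolding mixed_case_def seqs.simps
  proof (rule run_seq[OF b1, where ?T2.0 = "500 * U"])
    fix s1 assume s1: "inp s1 \<and> que {v} s1 []" and sm1: "same block s s1"
    have m1: "marked v s1" by (rule marked_same[OF m sm1]) auto
    have r1: "regs s1 24 = w" "regs s1 25 = w'" "arrs s1 2 = x" "\<forall>y. arrs s1 10 y = 0" "\<forall>y. arrs s1 11 y = 0"
      using same_regs[OF sm1] same_arrs[OF sm1] w w' x z10 by auto
    have p1: "run W (push 24) s1 12 (\<lambda>s'. inp s' \<and> que {v} s' ([] @ [regs s1 24]))"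
      by (rule run_push) (use s1 r1 wn ne in auto)
    show "run W (Seq (push 24) (Seq (push 25) (Seq (markv 10 24 1) (Seq (markv 11 25 1)
        (Seq (collect common) (Seq (grow 7 21) triangle)))))) s1 (500 * U) (ready v x)"
    proof (rule run_seq[OF p1, where ?T2.0 = "450 * U"])
      fix s2 assume s2: "inp s2 \<and> que {v} s2 ([] @ [regs s1 24])" and sm2: "same (push 24) s1 s2"
      have m2: "marked v s2" by (rule marked_same[OF m1 sm2]) auto
      have r2: "regs s2 24 = w" "regs s2 25 = w'" "arrs s2 2 = x" "\<forall>y. arrs s2 10 y = 0" "\<forall>y. arrs s2 11 y = 0"
        using same_regs[OF sm2] same_arrs[OF sm2] r1 by auto
      have p2: "run W (push 25) s2 12 (\<lambda>s'. inp s' \<and> que {v} s' ([w] @ [regs s2 25]))"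
        by (rule run_push) (use s2 r1 r2 wn ne in auto)
      show "run W (Seq (push 25) (Seq (markv 10 24 1) (Seq (markv 11 25 1)
        (Seq (collect common) (Seq (grow 7 21) triangle))))) s2 (450 * U) (ready v x)"
      proof (rule run_seq[OF p2, where ?T2.0 = "430 * U"])
        fix s3 assume s3: "inp s3 \<and> que {v} s3 ([w] @ [regs s2 25])" and sm3: "same (push 25) s2 s3"
        have m3: "marked v s3" by (rule marked_same[OF m2 sm3]) auto
        have r3: "regs s3 24 = w" "regs s3 25 = w'" "arrs s3 2 = x" "\<forall>y. arrs s3 10 y = 0" "\<forall>y. arrs s3 11 y = 0"
          using same_regs[OF sm3] same_arrs[OF sm3] r2 by auto
        have q3: "que {v} s3 [w, w']" using s3 r2 by simp
        have p3: "run W (markv 10 24 1) s3 (25 * (\<Delta> + 1))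
          (\<lambda>s'. inp s' \<and> arrs s' 10 = (\<lambda>y. if y \<in> nb (regs s3 24) then 1 else arrs s3 10 y))"
          by (rule run_markv) (use s3 r3 wn in auto)
        show "run W (Seq (markv 10 24 1) (Seq (markv 11 25 1)
          (Seq (collect common) (Seq (grow 7 21) triangle)))) s3 (430 * U) (ready v x)"
        proof (rule run_seq[OF p3, where ?T2.0 = "400 * U"])
          fix s4 assume s4: "inp s4 \<and> arrs s4 10 = (\<lambda>y. if y \<in> nb (regs s3 24) then 1 else arrs s3 10 y)"
            and sm4: "same (markv 10 24 1) s3 s4"
          have m4: "marked v s4" by (rule marked_same[OF m3 sm4]) auto
          have r4: "regs s4 24 = w" "regs s4 25 = w'" "arrs s4 2 = x" "\<forall>y. arrs s4 11 y = 0"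
            "arrs s4 10 = (\<lambda>y. if y \<in> nb w then 1 else 0)"
            using same_regs[OF sm4] same_arrs[OF sm4] r3 s4 by auto
          have q4: "que {v} s4 [w, w']" by (rule que_same[OF q3 sm4]) auto
          have p4: "run W (markv 11 25 1) s4 (25 * (\<Delta> + 1))
            (\<lambda>s'. inp s' \<and> arrs s' 11 = (\<lambda>y. if y \<in> nb (regs s4 25) then 1 else arrs s4 11 y))"
            by (rule run_markv) (use s4 r4 wn in auto)
          show "run W (Seq (markv 11 25 1) (Seq (collect common) (Seq (grow 7 21) triangle))) s4 (400 * U) (ready v x)"
          proof (rule run_seq[OF p4, where ?T2.0 = "370 * U"])
            fix s5 assume s5: "inp s5 \<and> arrs s5 11 = (\<lambda>y. if y \<in> nb (regs s4 25) then 1 else arrs s4 11 y)"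
              and sm5: "same (markv 11 25 1) s4 s5"
            have m5: "marked v s5" by (rule marked_same[OF m4 sm5]) auto
            have r5: "regs s5 24 = w" "regs s5 25 = w'" "arrs s5 2 = x" "regs s5 9 = v"
              "arrs s5 10 = (\<lambda>y. if y \<in> nb w then 1 else 0)" "arrs s5 11 = (\<lambda>y. if y \<in> nb w' then 1 else 0)"
              using same_regs[OF sm5] same_arrs[OF sm5] r4 s5 m5 by (auto simp: marked_def)
            have q5: "que {v} s5 [w, w']" by (rule que_same[OF q4 sm5]) auto
            have p5: "run W (collect common) s5 (80 * (\<Delta> + 1))
              (\<lambda>s'. inp s' \<and> que {v} s' ([w, w'] @ filter F (L ! regs s5 9)))"
            proof (rule run_collect)
              fix s' assume sm: "same (collect common) s5 s'"
              show "bval common s' \<longleftrightarrow> F (regs s' 5)"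
                using same_arrs[OF sm, of 10] same_arrs[OF sm, of 11] r5 by (simp add: common_def F_def)
            qed (use s5 v r5 q5 nself adj_irrefl[OF v(1)] in \<open>auto simp: F_def common_def\<close>)
            show "run W (Seq (collect common) (Seq (grow 7 21) triangle)) s5 (370 * U) (ready v x)"
            proof (rule run_seq[OF p5, where ?T2.0 = "270 * U"])
              fix s6 assume s6: "inp s6 \<and> que {v} s6 ([w, w'] @ filter F (L ! regs s5 9))"
                and sm6: "same (collect common) s5 s6"
              have m6: "marked v s6" by (rule marked_same[OF m5 sm6]) auto
              have r6: "regs s6 24 = w" "regs s6 25 = w'" "arrs s6 2 = x"
                using same_regs[OF sm6] same_arrs[OF sm6] r5 by auto
              have q6: "que {v} s6 Q0" using s6 r5 by (simp add: Q0_def)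
              show "run W (Seq (grow 7 21) triangle) s6 (270 * U) (ready v x)"
              proof (rule run_seq[OF run_grow[OF m6 v _ _ q6 Q0(1) exz]])
                fix s7 assume s7: "grown 7 21 v Q0 s7"
                  and sm7: "same (grow 7 21) s6 s7"
                have "marked v s7" by (rule marked_same[OF m6 sm7]) auto
                then show "run W triangle s7 40 (ready v x)"
                  using s7 same_regs[OF sm7] same_arrs[OF sm7] r6 by (intro tri) auto
              qed auto
            qed (simp add: algebra_simps)
          qed (simp add: algebra_simps)
        qed (simp add: algebra_simps)
      qed simp
    qed simp
  qed simp
qed

end

section \<open>The two cycles when no edge of N joins the colours\<close>

definition fan_step :: com where
  "fan_step = seqs [Store 7 (Reg 21) (Cell 3 (Reg 22)), Assign 21 (Plus (Reg 21) (Num 1)),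
     Assign 22 (Plus (Reg 22) (Num 1))]"

text \<open>Positions 0 and 1 of the traced path already hold \<open>v\<close> and
  \<open>q k0\<close>, as the fan requires; writing resumes at position 2 with
  \<open>q 1\<close>.\<close>

definition fan_code :: com where
  "fan_code = seqs [Assign 21 (Num 2), Assign 22 (Num 1), While (Less (Reg 22) (Reg 23)) fan_step,
     Store 7 (Reg 21) (Reg 9)]"

definition ear_step :: com where
  "ear_step = seqs [Assign 22 (Minus (Reg 22) (Num 1)), Store 7 (Reg 21) (Cell 3 (Reg 22)),
     Assign 21 (Plus (Reg 21) (Num 1))]"

text \<open>Register 21 points at the copy of \<open>v\<close> closing the traced path, so the first
  store overwrites it.\<close>

definition ear_code :: com where
  "ear_code = Seq (While (Less (Num 0) (Reg 22)) ear_step) (Store 7 (Reg 21) (Reg 9))"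

text \<open>Register 21 is \<open>l + 2\<close>, hence 3 means \<open>l = 1\<close>; register 22 is
  the source index \<open>pp l\<close>, and register 14 tells whether \<open>q k0\<close> sees
  \<open>q 1\<close>. If \<open>pp l\<close> is the last source, the traced path is already a
  cycle.\<close>

definition pick_ear :: com where
  "pick_ear = Cond (Conj (Equal (Reg 21) (Num 3)) (Conj (Equal (Reg 22) (Num 0)) (Equal (Reg 14) (Num 1))))
     fan_code (Cond (Less (Plus (Reg 22) (Num 1)) (Reg 23)) ear_code Skip)"

definition extend :: com where
  "extend = seqs [Assign 14 (Num 0), Assign 8 (Cell 7 (Num 1)),
     fadj 3 4 5 8 (Cond (Equal (Reg 5) (Cell 3 (Num 1))) (Assign 14 (Num 1)) Skip), pick_ear]"

lemma wr_extend [simp]: "wr extend = {3, 4, 5, 8, 14, 21, 22}" and wa_extend [simp]: "wa extend = {7}"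
  by (auto simp: extend_def pick_ear_def fan_code_def ear_code_def fan_step_def ear_step_def)

definition pure_case :: com where
  "pure_case = seqs [block, collect (Equal (Cell 2 (Reg 5)) (Num 0)), grow 6 20,
     block, load, grow 7 21, extend]"

lemma wr_pure [simp]: "wr pure_case = {3, 4, 5, 6, 7, 8, 13, 14, 20, 21, 22, 23}"
  and wa_pure [simp]: "wa pure_case = {3, 4, 5, 6, 7}"
  by (auto simp: pure_case_def)

context machine
begin

lemma both_colors:
  assumes v: "v < n" and x: "\<forall>u<n. x u \<le> 1" and c: "cnt x v = pB + 1"
  shows "\<exists>y\<in>nb v. x y = 0" "\<exists>y\<in>nb v. x y \<noteq> 0"
proof -
  have "card (part x 1 \<inter> nb v) = pB + 1" "card (part x 0 \<inter> nb v) = pA + 1"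
    using card_part1[OF v x] card_part0[OF v x] c degree_sum by auto
  then have "part x 1 \<inter> nb v \<noteq> {}" "part x 0 \<inter> nb v \<noteq> {}" by auto
  then show "\<exists>y\<in>nb v. x y = 0" "\<exists>y\<in>nb v. x y \<noteq> 0" by (auto simp: part_def)
qed

lemma run_load:
  assumes m: "marked v s" and q: "que {v} s []" and c: "icycle c (Suc k)" "c 0 = v"
    and a6: "\<forall>i\<le>k. arrs s 6 i = c i" and r: "regs s 20 = Suc k"
  shows "run W load s (40 * U) (\<lambda>s'. que {v} s' (map (\<lambda>i. c (k - i)) [0..<k]))"
proof -
  define lp where "lp = seqs [Assign 8 (Cell 6 (Reg 13)), push 8, Assign 13 (Minus (Reg 13) (Num 1))]"
  define s1 where "s1 = s\<lparr>regs := (regs s)(13 := k)\<rparr>"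
  have kn: "Suc k \<le> n" using icycle_le[OF c(1)] .
  have W': "n + 5 \<le> W" using W by simp
  have cn: "c i < n" if "i \<le> k" for i using c(1) that by (simp add: icycle_def)
  have inj: "c i = c j \<longleftrightarrow> i = j" if "i \<le> k" "j \<le> k" for i j
    using c(1) that unfolding icycle_def by (meson inj_onD lessThan_iff less_Suc_eq_le)
  have wrlp: "wr lp = {7, 8, 13}" "wa lp = {3, 5}" by (auto simp: lp_def)
  define J where "J j s' \<longleftrightarrow> inp s' \<and> j \<le> k \<and> regs s' 13 = k - j \<and> que {v} s' (map (\<lambda>i. c (k - i)) [0..<j])"
    for j and s' :: state
  have "run W (While (Less (Num 0) (Reg 13)) lp) s1 (35 * U) (\<lambda>s'. que {v} s' (map (\<lambda>i. c (k - i)) [0..<k]))"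
  proof (rule run_while[where I = J and N = n and Tb = 25])
    show "J 0 s1" using m q by (auto simp: J_def s1_def marked_def inp_def que_def)
  next
    fix j s' assume J: "J j s'" and sm: "same lp s1 s'" and b: "bval (Less (Num 0) (Reg 13)) s'"
    have j: "j < k" using J b by (simp add: J_def)
    have a6': "arrs s' 6 (k - j) = c (k - j)" using same_arrs[OF sm, of 6] wrlp a6 by (simp add: s1_def)
    define s2 where "s2 = s'\<lparr>regs := (regs s')(8 := c (k - j))\<rparr>"
    have q2: "que {v} s2 (map (\<lambda>i. c (k - i)) [0..<j])" using J by (simp add: J_def que_def s2_def)
    have new: "c (k - j) \<notin> set (map (\<lambda>i. c (k - i)) [0..<j]) \<union> {v}"
    proof -
      have "c (k - j) \<noteq> c (k - i)" if "i < j" for i using inj[of "k - j" "k - i"] that j by simp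
      moreover have "c (k - j) \<noteq> c 0" using inj[of "k - j" 0] j by simp
      ultimately show ?thesis unfolding c(2)[symmetric] by (simp add: image_iff)
    qed
    have "run W (Seq (push 8) (Assign 13 (Minus (Reg 13) (Num 1)))) s2 20 (J (Suc j))"
    proof (rule run_wp)
      have "wp W (push 8) (wp W (Assign 13 (Minus (Reg 13) (Num 1))) (J (Suc j))) s2"
      proof (rule wp_push[OF q2])
        fix t assume t: "que {v} t (map (\<lambda>i. c (k - i)) [0..<j] @ [regs s2 8])" and smt: "same (push 8) s2 t"
        have "inp t" by (rule inp_same[OF smt]) (use J in \<open>auto simp: J_def s2_def inp_def\<close>)
        moreover have "regs t 13 = k - j" using same_regs[OF smt, of 13] J by (simp add: J_def s2_def)
        ultimately show "wp W (Assign 13 (Minus (Reg 13) (Num 1))) (J (Suc j)) t"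
          using t j kn W' by (simp add: J_def s2_def que_def inp_def)
      qed (use cn[of "k - j"] new in \<open>auto simp: s2_def\<close>)
      then show "wp W (Seq (push 8) (Assign 13 (Minus (Reg 13) (Num 1)))) (J (Suc j)) s2" by simp
    qed (simp add: push_def)
    moreover have "regs s' 13 = k - j" using J by (simp add: J_def)
    moreover have "c (k - j) \<le> W" using cn[of "k - j"] W' by simp
    ultimately have "run W lp s' 25 (J (Suc j))"
      unfolding lp_def seqs.simps
      by (intro run_wp_seq[where ?T2.0 = 20]) (use a6' in \<open>simp_all add: s2_def\<close>)
    then show "j < n \<and> run W lp s' 25 (J (Suc j))" using j kn by simp
  next
    fix j s' assume "J j s'" "\<not> bval (Less (Num 0) (Reg 13)) s'"
    then show "que {v} s' (map (\<lambda>i. c (k - i)) [0..<k])" by (auto simp: J_def)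
  qed simp
  then show ?thesis
    unfolding load_def lp_def[symmetric]
    by (intro run_wp_seq[where ?T2.0 = "35 * U"]) (use r kn W' in \<open>simp_all add: s1_def\<close>)
qed

lemma run_fan_code:
  assumes r: "regs s 23 = t0" "regs s 9 = v" "2 \<le> t0" "t0 \<le> n" "v < n"
    and q: "\<And>i. i < t0 \<Longrightarrow> arrs s 3 i < n" and a7: "arrs s 7 0 = v" "arrs s 7 (Suc 0) = y"
  shows "run W fan_code s (60 * U) (\<lambda>s'. regs s' 21 = t0 + 1 \<and>
    (\<forall>i\<le>t0 + 1. arrs s' 7 i = (if i = 0 \<or> i = t0 + 1 then v else if i = 1 then y else arrs s 3 (i - 1))))"
proof -
  have wrlp: "wr fan_step = {21, 22}" "wa fan_step = {7}" by (auto simp: fan_step_def)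
  define s1 where "s1 = s\<lparr>regs := (regs s)(21 := 2, 22 := 1)\<rparr>"
  have W': "n + 5 \<le> W" using W by simp
  define F where "F i = (if i = 0 \<or> i = t0 + 1 then v else if i = 1 then y else arrs s 3 (i - 1))" for i
  define J where "J j s' \<longleftrightarrow> regs s' 21 = j + 2 \<and> regs s' 22 = j + 1 \<and> j + 1 \<le> t0 \<and>
    (\<forall>i<j + 2. arrs s' 7 i = F i)" for j and s' :: state
  define K where "K s' \<longleftrightarrow> regs s' 21 = t0 + 1 \<and> (\<forall>i\<le>t0. arrs s' 7 i = F i) \<and> regs s' 9 = v"
    for s' :: state
  have 1: "run W (While (Less (Reg 22) (Reg 23)) fan_step) s1 (50 * U) K"
  proof (rule run_while[where I = J and N = n and Tb = 14])
    show "J 0 s1" using r a7 by (auto simp: J_def s1_def F_def less_Suc_eq)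
  next
    fix j s' assume J: "J j s'" and sm: "same fan_step s1 s'" and b: "bval (Less (Reg 22) (Reg 23)) s'"
    have u: "regs s' 23 = t0" "arrs s' 3 = arrs s 3"
      using same_regs[OF sm, of 23] same_arrs[OF sm, of 3] wrlp r by (auto simp: s1_def)
    have j: "j + 1 < t0" using J b u by (simp add: J_def)
    have e: "F (j + 2) = arrs s 3 (j + 1)" using j by (simp add: F_def)
    have "run W fan_step s' 14 (J (Suc j))"
      by (rule run_wp) (use J j u e q[OF j] r W' in \<open>auto simp: J_def fan_step_def less_Suc_eq\<close>)
    then show "j < n \<and> run W fan_step s' 14 (J (Suc j))" using j r by simp
  next
    fix j s' assume J: "J j s'" and sm: "same fan_step s1 s'" and b: "\<not> bval (Less (Reg 22) (Reg 23)) s'"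
    have u: "regs s' 23 = t0" "regs s' 9 = v"
      using same_regs[OF sm, of 23] same_regs[OF sm, of 9] wrlp r by (auto simp: s1_def)
    then have "j + 1 = t0" using J b by (simp add: J_def)
    then show "K s'" using J u by (auto simp: J_def K_def less_Suc_eq_le)
  qed simp
  have e: "F (t0 + 1) = v" by (simp add: F_def)
  have 2: "run W (Store 7 (Reg 21) (Reg 9)) s' 3 (\<lambda>s'. regs s' 21 = t0 + 1 \<and> (\<forall>i\<le>t0 + 1. arrs s' 7 i = F i))"
    if "K s'" for s'
    by (rule run_wp) (use that r e W' in \<open>auto simp: K_def le_Suc_eq\<close>)
  have 3: "run W (Seq (While (Less (Reg 22) (Reg 23)) fan_step) (Store 7 (Reg 21) (Reg 9))) s1 (53 * U)
      (\<lambda>s'. regs s' 21 = t0 + 1 \<and> (\<forall>i\<le>t0 + 1. arrs s' 7 i = F i))"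
    by (rule run_seq[OF 1 2]) auto
  have 4: "run W (Seq (Assign 22 (Num 1)) (Seq (While (Less (Reg 22) (Reg 23)) fan_step) (Store 7 (Reg 21) (Reg 9))))
     (s\<lparr>regs := (regs s)(21 := 2)\<rparr>) (55 * U) (\<lambda>s'. regs s' 21 = t0 + 1 \<and> (\<forall>i\<le>t0 + 1. arrs s' 7 i = F i))"
    by (rule run_wp_seq[where ?T2.0 = "53 * U"]) (use 3 W' in \<open>simp_all add: s1_def\<close>)
  show ?thesis
    unfolding fan_code_def seqs.simps F_def[symmetric]
    by (rule run_wp_seq[where ?T2.0 = "55 * U"]) (use 4 W' in simp_all)
qed

lemma run_ear_code:
  assumes r: "regs s 21 = Suc k" "regs s 22 = e" "regs s 9 = v" "k \<le> n" "e < n" "v < n"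
    and q: "\<And>i. i < e \<Longrightarrow> arrs s 3 i < n" and a7: "\<forall>i\<le>k. arrs s 7 i = F i"
    and F: "\<And>i. k < i \<Longrightarrow> i \<le> k + e \<Longrightarrow> F i = arrs s 3 (e - (i - k))" "F (Suc k + e) = v"
    and ke: "k + e \<le> n + n"
  shows "run W ear_code s (60 * U) (\<lambda>s'. regs s' 21 = Suc k + e \<and> (\<forall>i\<le>Suc k + e. arrs s' 7 i = F i))"
proof -
  have wrlp: "wr ear_step = {21, 22}" "wa ear_step = {7}" by (auto simp: ear_step_def)
  \<comment> \<open>Intermediate lengths are only known to be at most twice \<open>n\<close>; degree
    at least 3 makes the word bound large enough for them.\<close>
  have "n * 3 \<le> n * \<Delta>" using degree_ge by (rule mult_le_mono2)
  then have W': "n + n + 10 \<le> W" using W by linarith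
  define J where "J j s' \<longleftrightarrow> regs s' 21 = Suc k + j \<and> regs s' 22 = e - j \<and> j \<le> e \<and>
    (\<forall>i\<le>k + j. arrs s' 7 i = F i)" for j and s' :: state
  have 1: "run W (While (Less (Num 0) (Reg 22)) ear_step) s (55 * U) (\<lambda>s'. J e s' \<and> regs s' 9 = v)"
  proof (rule run_while[where I = J and N = n and Tb = 14])
    show "J 0 s" using r a7 by (auto simp: J_def)
  next
    fix j s' assume J: "J j s'" and sm: "same ear_step s s'" and b: "bval (Less (Num 0) (Reg 22)) s'"
    have u: "arrs s' 3 = arrs s 3" using same_arrs[OF sm, of 3] wrlp by auto
    have j: "j < e" using J b by (simp add: J_def)
    have "e - (Suc k + j - k) = e - Suc j" by simp
    then have f: "F (Suc (k + j)) = arrs s 3 (e - Suc j)" using F(1)[of "Suc k + j"] j by simp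
    have g: "arrs s 3 (e - Suc j) < n" using q j by simp
    have "run W ear_step s' 14 (J (Suc j))"
      by (rule run_wp) (use J j u f g r ke W' in \<open>auto simp: J_def ear_step_def le_Suc_eq\<close>)
    then show "j < n \<and> run W ear_step s' 14 (J (Suc j))" using j r by simp
  next
    fix j s' assume J: "J j s'" and sm: "same ear_step s s'" and b: "\<not> bval (Less (Num 0) (Reg 22)) s'"
    have u: "regs s' 9 = v" using same_regs[OF sm, of 9] wrlp r by auto
    have "j = e" using J b by (simp add: J_def)
    then show "J e s' \<and> regs s' 9 = v" using J u by simp
  qed simp
  have 2: "run W (Store 7 (Reg 21) (Reg 9)) s' 3
     (\<lambda>s'. regs s' 21 = Suc k + e \<and> (\<forall>i\<le>Suc k + e. arrs s' 7 i = F i))"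
    if "J e s' \<and> regs s' 9 = v" for s'
    by (rule run_wp) (use that r F(2) ke W' in \<open>auto simp: J_def le_Suc_eq\<close>)
  show ?thesis
    unfolding ear_code_def
    by (rule run_seq[OF 1 2]) auto
qed

lemma run_extend:
  assumes H: "hole_tree L \<Delta> pA pB (arrs s 3) (arrs s 4) T t0 v k0 l" and m: "marked v s"
    and r: "regs s 23 = t0" "regs s 22 = (arrs s 4 ^^ l) k0" "regs s 21 = l + 2" "2 \<le> t0"
    and a7: "\<forall>i\<le>l + 2. arrs s 7 i = hole_tree.tcyc (arrs s 3) (arrs s 4) v k0 l i"
    and g1: "l = 1 \<Longrightarrow> (arrs s 4 ^^ l) k0 = 0 \<Longrightarrow> arrs s 3 1 \<in> nb (arrs s 3 k0) \<Longrightarrow>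
        good v x c k (hole_tree.fan (arrs s 3) t0 v k0) (Suc t0)"
    and g2: "\<not> (l = 1 \<and> (arrs s 4 ^^ l) k0 = 0 \<and> arrs s 3 1 \<in> nb (arrs s 3 k0)) \<Longrightarrow>
        Suc ((arrs s 4 ^^ l) k0) < t0 \<Longrightarrow>
        good v x c k (hole_tree.ear (arrs s 3) (arrs s 4) v k0 l) (l + 2 + (arrs s 4 ^^ l) k0)"
    and g3: "\<not> (l = 1 \<and> (arrs s 4 ^^ l) k0 = 0 \<and> arrs s 3 1 \<in> nb (arrs s 3 k0)) \<Longrightarrow>
        Suc ((arrs s 4 ^^ l) k0) = t0 \<Longrightarrow>
        good v x c k (hole_tree.tcyc (arrs s 3) (arrs s 4) v k0 l) (l + 2)"
  shows "run W extend s (150 * U) (\<lambda>s'. \<exists>d r. good v x c k d r \<and> (\<forall>i\<le>r. arrs s' 7 i = d i) \<and> regs s' 21 = r)"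
proof -
  define q where "q = arrs s 3"
  define p where "p = arrs s 4"
  interpret H: hole_tree L \<Delta> pA pB q p T t0 v k0 l using H by (simp add: q_def p_def)
  note r' = r[folded p_def] and a7' = a7[folded q_def p_def]
    and g1' = g1[folded q_def p_def] and g2' = g2[folded q_def p_def] and g3' = g3[folded q_def p_def]
  define e where "e = H.pp l"
  have W': "n + 5 \<le> W" using W by simp
  have qn: "q i < n" if "i < T" for i using H.q_less that .
  have t0T: "t0 \<le> T" using H.t0_le .
  have Tn: "T \<le> n"
  proof -
    have "card (q ` {..<T}) = T" using bfs_treeD(1)[OF H.tree] by (simp add: card_image)
    moreover have "card (q ` {..<T}) \<le> card {..<n}" unfolding H.all by (intro card_mono) auto
    ultimately show ?thesis by simp
  qed
  have el: "e < t0" using H.l(1) by (simp add: e_def)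
  have tc: "H.tcyc 0 = v" "H.tcyc (Suc 0) = q k0" using H.l_pos by (auto simp: H.tcyc_def)
  have k0n: "q k0 < n" using qn H.k0 by simp
  define R where "R s' \<longleftrightarrow> (\<exists>d r. good v x c k d r \<and> (\<forall>i\<le>r. arrs s' 7 i = d i) \<and> regs s' 21 = r)"
    for s' :: state
  define fl where "fl = (if q 1 \<in> nb (q k0) then 1 else 0 :: nat)"
  have pick: "run W pick_ear s' (80 * U) R"
    if i': "marked v s'" and r1: "regs s' 23 = t0" "regs s' 22 = e" "regs s' 21 = l + 2" "regs s' 14 = fl"
      and a: "arrs s' 3 = q" "arrs s' 7 = arrs s 7" for s'
    unfolding pick_ear_def
  proof (rule run_cond[where ?T1.0 = "68 * U"])
    have v9: "regs s' 9 = v" using i' by (simp add: marked_def)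
    let ?b = "Conj (Equal (Reg 21) (Num 3)) (Conj (Equal (Reg 22) (Num 0)) (Equal (Reg 14) (Num 1)))"
    have b: "bval ?b s' \<longleftrightarrow> l = 1 \<and> H.pp l = 0 \<and> q 1 \<in> nb (q k0)"
      using r1 by (auto simp: fl_def e_def)
    {
      assume "bval ?b s'"
      then have g: "good v x c k H.fan (Suc t0)" using b g1' by blast
      have "run W fan_code s' (60 * U) (\<lambda>s''. regs s'' 21 = t0 + 1 \<and>
          (\<forall>i\<le>t0 + 1. arrs s'' 7 i = (if i = 0 \<or> i = t0 + 1 then v else if i = 1 then q k0 else arrs s' 3 (i - 1))))"
        by (rule run_fan_code) (use r1 v9 r Tn t0T H.v qn a a7' tc in auto)
      then show "run W fan_code s' (68 * U) R"
      proof (rule run_conseq)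
        fix s'' :: state assume s'': "regs s'' 21 = t0 + 1 \<and>
          (\<forall>i\<le>t0 + 1. arrs s'' 7 i = (if i = 0 \<or> i = t0 + 1 then v else if i = 1 then q k0 else arrs s' 3 (i - 1)))"
        show "R s''" unfolding R_def
          by (intro exI[of _ H.fan] exI[of _ "Suc t0"] conjI g) (use s'' a in \<open>auto simp: H.fan_def\<close>)
      qed simp
    }
    {
      assume nb: "\<not> bval ?b s'"
      then have ns: "\<not> (l = 1 \<and> H.pp l = 0 \<and> q 1 \<in> nb (q k0))" using b by blast
      show "run W (Cond (Less (Plus (Reg 22) (Num 1)) (Reg 23)) ear_code Skip) s' (68 * U) R"
      proof (rule run_cond[where ?T1.0 = "61 * U"])
        assume "bval (Less (Plus (Reg 22) (Num 1)) (Reg 23)) s'"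
        then have "Suc (H.pp l) < t0" using r1 by (simp add: e_def)
        then have g: "good v x c k H.ear (l + 2 + H.pp l)" using g2' ns by blast
        then have "icycle H.ear (l + 2 + e)" by (simp add: good_def e_def)
        then have le: "l + 2 + e \<le> n" by (rule icycle_le)
        have "run W ear_code s' (60 * U) (\<lambda>s''. regs s'' 21 = Suc (l + 1) + e \<and> (\<forall>i\<le>Suc (l + 1) + e. arrs s'' 7 i = H.ear i))"
        proof (rule run_ear_code)
          show "\<forall>i\<le>l + 1. arrs s' 7 i = H.ear i"
            using a a7' by (auto simp: H.ear_def H.tcyc_def)
          show "H.ear i = arrs s' 3 (e - (i - (l + 1)))" if "l + 1 < i" "i \<le> l + 1 + e" for i
            using that a by (auto simp: H.ear_def e_def)
          show "H.ear (Suc (l + 1) + e) = v" by (simp add: H.ear_def e_def)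
        qed (use r1 v9 H.v qn a el t0T Tn le in auto)
        then show "run W ear_code s' (61 * U) R"
        proof (rule run_conseq)
          fix s'' :: state assume s'': "regs s'' 21 = Suc (l + 1) + e \<and> (\<forall>i\<le>Suc (l + 1) + e. arrs s'' 7 i = H.ear i)"
          show "R s''" unfolding R_def
            by (intro exI[of _ H.ear] exI[of _ "l + 2 + H.pp l"] conjI g) (use s'' in \<open>auto simp: e_def\<close>)
        qed simp
      next
        assume "\<not> bval (Less (Plus (Reg 22) (Num 1)) (Reg 23)) s'"
        then have "Suc (H.pp l) = t0" using r1 el by (simp add: e_def)
        then have g: "good v x c k H.tcyc (l + 2)" using g3' ns by blast
        have "R s'" unfolding R_def
          by (intro exI[of _ H.tcyc] exI[of _ "l + 2"] conjI g) (use r1 a a7' in auto)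
        then show "run W Skip s' (61 * U) R" by (intro run_wp) auto
      qed simp
    }
  qed simp
  define s1 where "s1 = s\<lparr>regs := (regs s)(14 := 0, 8 := q k0)\<rparr>"
  define bd where "bd = Cond (Equal (Reg 5) (Cell 3 (Num 1))) (Assign 14 (Num 1)) Skip"
  define I where "I j s' \<longleftrightarrow> regs s' 14 = (if \<exists>i<j. L ! q k0 ! i = q 1 then 1 else 0)" for j and s' :: state
  have m1: "marked v s1" using m by (simp add: marked_def s1_def inp_def)
  have "run W (fadj 3 4 5 8 bd) s1 (35 * (\<Delta> + 1)) (\<lambda>s'. I \<Delta> s' \<and> inp s')"
  proof (rule run_fadj[where Tb = 16])
    show "inp s1" using m1 by (simp add: marked_def)
    show "I 0 s1" by (simp add: I_def s1_def)
    show "I j (s'\<lparr>regs := f\<rparr>)" if "I j s'" "\<And>y. y \<noteq> 3 \<Longrightarrow> y \<noteq> 4 \<Longrightarrow> y \<noteq> 5 \<Longrightarrow> f y = regs s' y" for j s' f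
      using that by (simp add: I_def)
    show "run W bd t 16 (I (Suc j))"
      if j: "j < \<Delta>" and I: "I j t" and y: "regs t 5 = L ! regs s1 8 ! j"
        and sm: "same (fadj 3 4 5 8 bd) s1 t" for j t
    proof (rule run_wp)
      have "arrs t 3 = q" using same_arrs[OF sm, of 3] by (simp add: bd_def s1_def q_def)
      then show "wp W bd (I (Suc j)) t"
        using I y W' by (auto simp: I_def bd_def s1_def less_Suc_eq)
    qed (simp add: bd_def)
  qed (use k0n in \<open>auto simp: s1_def bd_def\<close>)
  then have "run W (Seq (fadj 3 4 5 8 bd) pick_ear) s1 (120 * U) R"
  proof (rule run_seq[where ?T2.0 = "80 * U"])
    fix s2 assume s2: "I \<Delta> s2 \<and> inp s2" and sm2: "same (fadj 3 4 5 8 bd) s1 s2"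
    have m2: "marked v s2" by (rule marked_same[OF m1 sm2]) (auto simp: bd_def)
    have "nb (q k0) = (\<lambda>i. L ! q k0 ! i) ` {..<\<Delta>}" using nb_conv[OF k0n] .
    then have "(\<exists>i<\<Delta>. L ! q k0 ! i = q 1) \<longleftrightarrow> q 1 \<in> nb (q k0)" by (force simp: image_iff)
    then have "regs s2 14 = fl" using s2 by (simp add: I_def fl_def)
    then show "run W pick_ear s2 (80 * U) R"
      using m2 same_regs[OF sm2] same_arrs[OF sm2] r'
      by (intro pick) (auto simp: bd_def s1_def q_def e_def)
  qed (simp add: algebra_simps)
  then have 2: "run W (Seq (Assign 8 (Cell 7 (Num 1))) (Seq (fadj 3 4 5 8 bd) pick_ear))
      (s\<lparr>regs := (regs s)(14 := 0)\<rparr>) (130 * U) R"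
    by (intro run_wp_seq[where ?T2.0 = "120 * U"]) (use a7' tc k0n W' in \<open>simp_all add: s1_def\<close>)
  show ?thesis
    unfolding extend_def seqs.simps bd_def[symmetric] R_def[symmetric]
    by (intro run_wp_seq[where ?T2.0 = "130 * U"]) (use 2 in simp_all)
qed

lemma run_pure:
  assumes m: "marked v s" and v: "v < n" "noncut v" and x: "arrs s 2 = x" "\<forall>u<n. x u \<le> 1"
    and cnt: "cnt x v = pB + 1"
    and same: "\<And>y w. y \<in> nb v \<Longrightarrow> w \<in> nb v \<Longrightarrow> w \<in> nb y \<Longrightarrow> x w = x y"
  shows "run W pure_case s (900 * U) (ready v x)"
proof -
  define F where "F y \<longleftrightarrow> x y = 0" for y
  define Q1 where "Q1 = filter F (L ! v)"
  have sQ1: "set Q1 = {y \<in> nb v. x y = 0}" by (auto simp: Q1_def F_def)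
  obtain y0 y1 where y: "y0 \<in> nb v" "x y0 = 0" "y1 \<in> nb v" "x y1 \<noteq> 0"
    using both_colors[OF v(1) x(2) cnt] by blast
  have Q1: "Q1 \<noteq> []" "\<exists>z\<in>nb v. z \<notin> set Q1" using y sQ1 by (auto simp: Q1_def F_def filter_empty_conv)
  have v9: "inp s" "regs s 9 = v" using m by (auto simp: marked_def)
  show ?thesis
    unfolding pure_case_def seqs.simps
  proof (rule run_seq[OF run_block, where ?T2.0 = "850 * U"])
    fix s1 assume s1: "inp s1 \<and> que {regs s 9} s1 []" and sm1: "same block s s1"
    have m1: "marked v s1" by (rule marked_same[OF m sm1]) auto
    have x1: "arrs s1 2 = x" "regs s1 9 = v" using same_arrs[OF sm1] x m1 by (auto simp: marked_def)
    have c1: "run W (collect (Equal (Cell 2 (Reg 5)) (Num 0))) s1 (80 * (\<Delta> + 1))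
        (\<lambda>s'. inp s' \<and> que {v} s' ([] @ filter F (L ! regs s1 9)))"
    proof (rule run_collect)
      fix s' assume sm: "same (collect (Equal (Cell 2 (Reg 5)) (Num 0))) s1 s'"
      show "bval (Equal (Cell 2 (Reg 5)) (Num 0)) s' \<longleftrightarrow> F (regs s' 5)"
        using same_arrs[OF sm, of 2] x1 by (simp add: F_def)
    qed (use s1 v9 v x1 adj_irrefl[OF v(1)] in auto)
    show "run W (Seq (collect (Equal (Cell 2 (Reg 5)) (Num 0))) (Seq (grow 6 20)
        (Seq block (Seq load (Seq (grow 7 21) extend))))) s1 (850 * U) (ready v x)"
    proof (rule run_seq[OF c1, where ?T2.0 = "750 * U"])
      fix s2 assume s2: "inp s2 \<and> que {v} s2 ([] @ filter F (L ! regs s1 9))"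
        and sm2: "same (collect (Equal (Cell 2 (Reg 5)) (Num 0))) s1 s2"
      have m2: "marked v s2" by (rule marked_same[OF m1 sm2]) auto
      have q2: "que {v} s2 Q1" using s2 x1 by (simp add: Q1_def)
      show "run W (Seq (grow 6 20) (Seq block (Seq load (Seq (grow 7 21) extend)))) s2 (750 * U) (ready v x)"
      proof (rule run_seq[OF run_grow[OF m2 v _ _ q2 Q1], where ?T2.0 = "500 * U"])
        fix s3 assume s3: "grown 6 20 v Q1 s3"
          and sm3: "same (grow 6 20) s2 s3"
        have m3: "marked v s3" by (rule marked_same[OF m2 sm3]) auto
        define q where "q = arrs s3 3"
        define p where "p = arrs s3 4"
        obtain T k0 l where H: "hole_tree L \<Delta> pA pB q p T (length Q1) v k0 l"
          and qi: "\<forall>i<length Q1. q i = Q1 ! i"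
          and a6: "\<forall>i\<le>l + 2. arrs s3 6 i = hole_tree.tcyc q p v k0 l i" and r20: "regs s3 20 = l + 2"
          using s3 by (auto simp: grown_def q_def p_def)
        interpret H: hole_tree L \<Delta> pA pB q p T "length Q1" v k0 l by (rule H)
        have im: "q ` {..<length Q1} = {y \<in> nb v. x y = 0}"
          unfolding sQ1[symmetric] using qi by (auto simp: in_set_conv_nth image_iff)
        define c where "c = H.tcyc"
        define k where "k = l + 1"
        have ic: "icycle c (Suc k)" "c 0 = v" using H.mixed_tcyc(1)[OF im] by (auto simp: c_def k_def H.tcyc_def)
        have ends: "x (c k) = 0" "x (c 1) \<noteq> 0" using H.mixed_tcyc(2,3)[OF im] by (auto simp: c_def k_def)
        have far: "c i \<notin> nb y" if "y \<in> nb v" "x y = 0" "0 < i" "Suc i < k" for y i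
          using H.mixed_tcyc(4)[OF im that(1-3)] that(4) by (simp add: c_def k_def)
        have a6': "\<forall>i\<le>Suc k. arrs s3 6 i = c i" using a6 by (simp add: c_def k_def)
        have k2: "2 \<le> k" using ic(1) by (simp add: icycle_def)
        define Q2 where "Q2 = map (\<lambda>i. c (k - i)) [0..<k]"
        have Q2: "Q2 \<noteq> []" "length Q2 = k" using k2 by (auto simp: Q2_def)
        \<comment> \<open>The first cycle is induced, so it meets N only in \<open>c 1\<close> and
          \<open>c k\<close>. As \<Delta> \<ge> 3, a vertex of N remains for the second
          search.\<close>
        have exz: "\<exists>z\<in>nb v. z \<notin> set Q2"
        proof (rule ccontr)
          assume "\<not> ?thesis"
          then have sub: "nb v \<subseteq> set Q2" by blast
          have "nb v \<subseteq> {c 1, c k}"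
          proof
            fix z assume z: "z \<in> nb v"
            then obtain i where i: "i < k" "z = c (k - i)" using sub by (auto simp: Q2_def)
            have "c j \<in> nb (c 0) \<longleftrightarrow> j = Suc 0 \<or> 0 = Suc j \<or> Suc j = Suc k \<or> j = 0 \<and> Suc 0 = Suc k"
              if "j < Suc k" for j using ic(1) that unfolding icycle_def by blast
            from this[of "k - i"] have "k - i = 1 \<or> k - i = k" using z i ic(2) k2 by auto
            then show "z \<in> {c 1, c k}" using i by auto
          qed
          then have "card (nb v) \<le> card {c 1, c k}" by (intro card_mono) auto
          also have "\<dots> \<le> 2" by (simp add: card_insert_if)
          finally show False using card_nb[OF v(1)] degree_ge by simp
        qed
        show "run W (Seq block (Seq load (Seq (grow 7 21) extend))) s3 (500 * U) (ready v x)"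
        proof (rule run_seq[OF run_block, where ?T2.0 = "450 * U"])
          fix s4 assume s4: "inp s4 \<and> que {regs s3 9} s4 []" and sm4: "same block s3 s4"
          have m4: "marked v s4" by (rule marked_same[OF m3 sm4]) auto
          have q4: "que {v} s4 []" using s4 m3 by (simp add: marked_def)
          have a4: "\<forall>i\<le>k. arrs s4 6 i = c i" "regs s4 20 = Suc k" "arrs s4 6 = arrs s3 6"
            using same_arrs[OF sm4, of 6] same_regs[OF sm4, of 20] a6' r20 by (auto simp: k_def)
          show "run W (Seq load (Seq (grow 7 21) extend)) s4 (450 * U) (ready v x)"
          proof (rule run_seq[OF run_load[OF m4 q4 ic a4(1,2)], where ?T2.0 = "400 * U"])
            fix s5 assume s5: "que {v} s5 (map (\<lambda>i. c (k - i)) [0..<k])" and sm5: "same load s4 s5"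
            have m5: "marked v s5" by (rule marked_same[OF m4 sm5]) auto
            have q5: "que {v} s5 Q2" using s5 by (simp add: Q2_def)
            show "run W (Seq (grow 7 21) extend) s5 (400 * U) (ready v x)"
            proof (rule run_seq[OF run_grow[OF m5 v _ _ q5 Q2(1) exz], where ?T2.0 = "150 * U"])
              fix s6 assume s6: "grown 7 21 v Q2 s6"
                and sm6: "same (grow 7 21) s5 s6"
              have m6: "marked v s6" by (rule marked_same[OF m5 sm6]) auto
              obtain T' k0' l' where H': "hole_tree L \<Delta> pA pB (arrs s6 3) (arrs s6 4) T' k v k0' l'"
                and q6: "\<forall>i<k. arrs s6 3 i = Q2 ! i"
                and a7: "\<forall>i\<le>l' + 2. arrs s6 7 i = hole_tree.tcyc (arrs s6 3) (arrs s6 4) v k0' l' i"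
                and r6: "regs s6 21 = l' + 2" "regs s6 22 = (arrs s6 4 ^^ l') k0'" "regs s6 23 = k"
                using s6 unfolding grown_def Q2(2) by blast
              have src: "arrs s6 3 i = c (k - i)" if "i < k" for i using q6 that by (simp add: Q2_def)
              have c6: "\<forall>i\<le>Suc k. arrs s6 6 i = c i" "regs s6 20 = Suc k"
                using same_arrs[OF sm6, of 6] same_arrs[OF sm5, of 6] same_regs[OF sm6, of 20]
                  same_regs[OF sm5, of 20] a4 a6' by auto
              show "run W extend s6 (150 * U) (ready v x)"
              proof (rule run_conseq[OF run_extend[OF H' m6 r6(3,2,1) k2 a7, where x = x and c = c and k = "Suc k"]])
                fix s7 assume s7: "\<exists>d r. good v x c (Suc k) d r \<and> (\<forall>i\<le>r. arrs s7 7 i = d i) \<and> regs s7 21 = r"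
                  and sm7: "same extend s6 s7"
                have "arrs s7 6 = arrs s6 6" "regs s7 20 = Suc k"
                  using same_arrs[OF sm7, of 6] same_regs[OF sm7, of 20] c6 by auto
                then have c7: "\<forall>i\<le>Suc k. arrs s7 6 i = c i" "regs s7 20 = Suc k" using c6 by auto
                obtain d r where "good v x c (Suc k) d r" "\<forall>i\<le>r. arrs s7 7 i = d i" "regs s7 21 = r"
                  using s7 by blast
                then show "ready v x s7" unfolding ready_def using c7 by blast
              next
                assume asm: "l' = 1" "(arrs s6 4 ^^ l') k0' = 0" "arrs s6 3 1 \<in> nb (arrs s6 3 k0')"
                show "good v x c (Suc k) (hole_tree.fan (arrs s6 3) k v k0') (Suc k)"
                  by (rule hole_tree.good_fan[OF H' ic src ends far same]) (assumption | rule asm)+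
              next
                assume asm: "\<not> (l' = 1 \<and> (arrs s6 4 ^^ l') k0' = 0 \<and> arrs s6 3 1 \<in> nb (arrs s6 3 k0'))"
                  "Suc ((arrs s6 4 ^^ l') k0') < k"
                show "good v x c (Suc k) (hole_tree.ear (arrs s6 3) (arrs s6 4) v k0' l')
                    (l' + 2 + (arrs s6 4 ^^ l') k0')"
                  by (rule hole_tree.good_ear[OF H' ic src ends far same]) (assumption | rule asm)+
              next
                assume asm: "\<not> (l' = 1 \<and> (arrs s6 4 ^^ l') k0' = 0 \<and> arrs s6 3 1 \<in> nb (arrs s6 3 k0'))"
                  "Suc ((arrs s6 4 ^^ l') k0') = k"
                show "good v x c (Suc k) (hole_tree.tcyc (arrs s6 3) (arrs s6 4) v k0' l') (l' + 2)"
                  by (rule hole_tree.good_ear_end[OF H' ic src ends far same]) (assumption | rule asm)+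
              qed simp
            qed auto
          qed simp
        qed (use m3 v in \<open>auto simp: marked_def\<close>)
      qed auto
    qed (simp add: algebra_simps)
  qed (use v9 v in auto)
qed

end

section \<open>The complete program\<close>

definition select :: com where
  "select = seqs [markv 8 9 1, detect, Cond (Equal (Reg 13) (Num 0)) pure_case mixed_case]"

lemma wr_select [simp]: "wr select = {3, 4, 5, 6, 7, 8, 13, 14, 15, 16, 17, 18, 20, 21, 22, 23, 24, 25}"
  and wa_select [simp]: "wa select = {3, 4, 5, 6, 7, 8, 9, 10, 11}"
  by (auto simp: select_def)

definition repair :: com where
  "repair = Cond (Equal (Reg 12) (Num 0)) (Seq select rots) Skip"

definition order_from :: "nat \<Rightarrow> com" where
  "order_from r = seqs [Assign 7 (Num 0), push r, bfs]"

lemma wr_order_from [simp]: "wr (order_from r) = {3, 4, 5, 6, 7, 8}"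
  and wa_order_from [simp]: "wa (order_from r) = {3, 4, 5}"
  by (auto simp: order_from_def)

text \<open>Register 8 is initially 0, so the first search starts at vertex 0; it only serves to
  find \<open>v\<close> as its last vertex. The second search is rooted at \<open>v\<close>, so that
  colouring in reverse order leaves \<open>v\<close> as the hole.\<close>

definition main_prog :: com where
  "main_prog = seqs [order_from 8, Assign 9 (Cell 3 (Minus (Reg 0) (Num 1))), clear, order_from 9,
     greedy, Assign 11 (Reg 9), place, repair]"

context machine
begin

lemma run_select:
  assumes inp: "inp s" and v: "regs s 9 = v" "v < n" "noncut v" and x: "arrs s 2 = x" "\<forall>u<n. x u \<le> 1"
    and cnt: "cnt x v = pB + 1"
    and z: "\<forall>y. arrs s 8 y = 0" "\<forall>y. arrs s 9 y = 0" "\<forall>y. arrs s 10 y = 0" "\<forall>y. arrs s 11 y = 0"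
  shows "run W select s (1200 * U) (ready v x)"
  unfolding select_def seqs.simps
proof (rule run_seq[OF run_markv, where ?T2.0 = "1150 * U"])
  fix s1 assume s1: "inp s1 \<and> arrs s1 8 = (\<lambda>y. if y \<in> nb (regs s 9) then 1 else arrs s 8 y)"
    and sm1: "same (markv 8 9 1) s s1"
  have m1: "marked v s1" using s1 same_regs[OF sm1, of 9] v z by (simp add: marked_def)
  have r1: "regs s1 9 = v" "arrs s1 2 = x" "\<forall>y. arrs s1 9 y = 0" "\<forall>y. arrs s1 10 y = 0" "\<forall>y. arrs s1 11 y = 0"
    using same_regs[OF sm1, of 9] same_arrs[OF sm1] v x z by auto
  show "run W (Seq detect (Cond (Equal (Reg 13) (Num 0)) pure_case mixed_case)) s1 (1150 * U) (ready v x)"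
  proof (rule run_seq[OF run_detect, where ?T2.0 = "960 * U"])
    fix s2 assume s2: "inp s2 \<and>
      detected (regs s1 9) (arrs s1 2) s2"
      and sm2: "same detect s1 s2"
    have m2: "marked v s2" by (rule marked_same[OF m1 sm2]) auto
    have r2: "arrs s2 2 = x" "\<forall>y. arrs s2 10 y = 0" "\<forall>y. arrs s2 11 y = 0"
      using same_arrs[OF sm2] r1 by auto
    show "run W (Cond (Equal (Reg 13) (Num 0)) pure_case mixed_case) s2 (960 * U) (ready v x)"
    proof (rule run_cond[where ?T1.0 = "950 * U"])
      assume "bval (Equal (Reg 13) (Num 0)) s2"
      then have none: "z \<in> nb w" if "w \<in> nb v" "y \<in> nb v" "y \<in> nb w" "x y \<noteq> x w" "z \<in> nb v" "z \<noteq> w" for w y z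
      proof -
        have "\<forall>w\<in>nb v. \<forall>y\<in>nb v. \<forall>z\<in>nb v. y \<in> nb w \<longrightarrow> x y \<noteq> x w \<longrightarrow> z \<noteq> w \<longrightarrow> z \<in> nb w"
          using s2 \<open>bval (Equal (Reg 13) (Num 0)) s2\<close> unfolding detected_def r1(1,2) bval.simps aval.simps by blast
        then show ?thesis using that by blast
      qed
      have eq: "x w = x y" if "y \<in> nb v" "w \<in> nb v" "w \<in> nb y" for y w
        by (rule no_mixed_edges[of v x y w, OF v(2) _ that]) (rule none)
      have "run W pure_case s2 (900 * U) (ready v x)"
        by (rule run_pure[OF m2 v(2,3) r2(1) x(2) cnt]) (rule eq)
      then show "run W pure_case s2 (950 * U) (ready v x)" by (rule run_conseq) simp_all
    next
      assume "\<not> bval (Equal (Reg 13) (Num 0)) s2"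
      then have h: "regs s2 24 \<in> nb v" "regs s2 25 \<in> nb v \<inter> nb (regs s2 24)" "x (regs s2 25) \<noteq> x (regs s2 24)"
        "\<exists>z\<in>nb v. z \<noteq> regs s2 24 \<and> z \<notin> nb (regs s2 24)"
        using s2 unfolding detected_def r1(1,2) bval.simps aval.simps by blast+
      show "run W mixed_case s2 (950 * U) (ready v x)"
        by (rule run_conseq[OF run_mixed[OF m2 v(2,3) r2 refl h(1) refl h(2,3,4)]]) auto
    qed simp
  qed (use s1 r1 v in auto)
qed (use inp v in auto)

lemma run_order_from:
  assumes inp: "inp s" and r: "regs s r < n" "r \<noteq> 7" and z: "\<forall>y<n. arrs s 5 y = 0"
  shows "run W (order_from r) s (100 * U) (\<lambda>s'. inp s' \<and> bfs_tree (arrs s' 3) (arrs s' 4) n 1 \<and>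
    arrs s' 3 ` {..<n} = {..<n} \<and> arrs s' 3 0 = regs s r)"
proof -
  define s1 where "s1 = s\<lparr>regs := (regs s)(7 := 0)\<rparr>"
  have i1: "inp s1" using inp by (simp add: s1_def inp_def)
  have q1: "que {} s1 []" using z by (simp add: que_def s1_def)
  have p1: "run W (push r) s1 12 (\<lambda>s'. inp s' \<and> que {} s' ([] @ [regs s1 r]))"
    by (rule run_push[OF i1 q1]) (use r in \<open>auto simp: s1_def\<close>)
  define R where "R s' \<longleftrightarrow> inp s' \<and> bfs_tree (arrs s' 3) (arrs s' 4) n 1 \<and>
    arrs s' 3 ` {..<n} = {..<n} \<and> arrs s' 3 0 = regs s r" for s'
  have "run W (Seq (push r) bfs) s1 (95 * U) R"
  proof (rule run_seq[OF p1])
    fix s2 assume s2: "inp s2 \<and> que {} s2 ([] @ [regs s1 r])"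
    then have q2: "que {} s2 [regs s r]" using r by (simp add: s1_def)
    show "run W bfs s2 (80 * U) R"
    proof (rule run_conseq[OF run_bfs[OF _ q2]])
      fix s3 assume "inp s3 \<and> (\<exists>Q. binv {} [regs s r] (length Q) s3 Q)"
      then obtain Q where i3: "inp s3" and Q: "binv {} [regs s r] (length Q) s3 Q" by blast
      show "R s3" unfolding R_def
        using i3 binv_tree(1,3)[OF Q] binv_tree(2)[OF Q, of 0] binv_all[OF Q] by simp
    qed (use s2 in auto)
  qed simp
  then show ?thesis
    unfolding order_from_def seqs.simps R_def[symmetric]
    by (intro run_wp_seq[where ?T2.0 = "95 * U"]) (simp_all add: s1_def)
qed

lemma run_main_prog:
  assumes inp: "inp s" and z: "\<And>a y. a \<notin> {0, 1} \<Longrightarrow> arrs s a y = 0" and r: "regs s 8 = 0" "regs s 12 = 0"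
  shows "run W main_prog s (2500 * U) (\<lambda>s'. full (arrs s' 2))"
  unfolding main_prog_def seqs.simps
proof (rule run_seq[OF run_order_from, where ?T2.0 = "2400 * U"])
  have W': "n + 5 \<le> W" using W by simp
  fix s1 assume s1: "inp s1 \<and> bfs_tree (arrs s1 3) (arrs s1 4) n 1 \<and>
    arrs s1 3 ` {..<n} = {..<n} \<and> arrs s1 3 0 = regs s 8" and sm1: "same (order_from 8) s s1"
  define v where "v = arrs s1 3 (n - 1)"
  have nc: "noncut v" unfolding v_def using s1 by (intro noncut_last) auto
  have vn: "v < n"
  proof -
    have "v \<in> arrs s1 3 ` {..<n}" using n_pos by (auto simp: v_def)
    then show ?thesis using s1 by simp
  qed
  define s2 where "s2 = s1\<lparr>regs := (regs s1)(9 := v)\<rparr>"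
  have i2: "inp s2" using s1 by (simp add: s2_def inp_def)
  have z2: "arrs s2 a y = 0" if "a \<in> {2, 8, 9, 10, 11}" for a y
    using same_arrs[OF sm1, of a] z that by (auto simp: s2_def)
  have r2: "regs s2 9 = v" "regs s2 12 = 0" using same_regs[OF sm1, of 12] r by (auto simp: s2_def)
  have "run W (Seq clear (Seq (order_from 9) (Seq greedy (Seq (Assign 11 (Reg 9)) (Seq place repair))))) s2
      (2390 * U) (\<lambda>s'. full (arrs s' 2))"
  proof (rule run_seq[OF run_clear[OF i2], where ?T2.0 = "2350 * U"])
    fix s3 assume s3: "inp s3 \<and> (\<forall>y<n. arrs s3 5 y = 0)" and sm3: "same clear s2 s3"
    have r3: "regs s3 9 = v" "regs s3 12 = 0" using same_regs[OF sm3] r2 by auto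
    show "run W (Seq (order_from 9) (Seq greedy (Seq (Assign 11 (Reg 9)) (Seq place repair)))) s3
      (2350 * U) (\<lambda>s'. full (arrs s' 2))"
    proof (rule run_seq[OF run_order_from, where ?T2.0 = "2250 * U"])
      fix s4 assume s4: "inp s4 \<and> bfs_tree (arrs s4 3) (arrs s4 4) n 1 \<and>
        arrs s4 3 ` {..<n} = {..<n} \<and> arrs s4 3 0 = regs s3 9" and sm4: "same (order_from 9) s3 s4"
      have r4: "regs s4 9 = v" "regs s4 12 = 0" using same_regs[OF sm4] r3 by auto
      have z4: "arrs s4 a y = 0" if "a \<in> {2, 8, 9, 10, 11}" for a y
        using same_arrs[OF sm4, of a] same_arrs[OF sm3, of a] z2[OF that] that by auto
      show "run W (Seq greedy (Seq (Assign 11 (Reg 9)) (Seq place repair))) s4 (2250 * U) (\<lambda>s'. full (arrs s' 2))"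
      proof (rule run_seq[OF run_greedy, where ?T2.0 = "2100 * U"])
        fix s5 assume s5: "inp s5 \<and> valid (arrs s5 2) (arrs s4 3 0)" and sm5: "same greedy s4 s5"
        have val: "valid (arrs s5 2) v" using s5 s4 r3 by simp
        define s6 where "s6 = s5\<lparr>regs := (regs s5)(11 := v)\<rparr>"
        have r6: "regs s6 9 = v" "regs s6 12 = 0" "regs s6 11 = v" "inp s6" "valid (arrs s6 2) v"
          using same_regs[OF sm5] r4 s5 val by (auto simp: s6_def inp_def)
        have z6: "arrs s6 a y = 0" if "a \<in> {8, 9, 10, 11}" for a y
          using same_arrs[OF sm5, of a] z4[of a] that by (auto simp: s6_def)
        have "run W (Seq place repair) s6 (2050 * U) (\<lambda>s'. full (arrs s' 2))"
        proof (rule run_seq[OF run_place, where ?T2.0 = "1900 * U"])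
          fix s7 assume s7: "inp s7 \<and> (regs s7 12 = 1 \<and> full (arrs s7 2) \<or>
            regs s7 12 = 0 \<and> arrs s7 2 = arrs s6 2 \<and> cnt (arrs s6 2) (regs s6 11) = pB + 1)"
            and sm7: "same place s6 s7"
          have v7: "regs s7 9 = v" using same_regs[OF sm7, of 9] r6 by simp
          have z7: "arrs s7 a y = 0" if "a \<in> {8, 9, 10, 11}" for a y
            using same_arrs[OF sm7, of a] z6[OF that] that by auto
          show "run W repair s7 (1900 * U) (\<lambda>s'. full (arrs s' 2))"
            unfolding repair_def
          proof (rule run_cond[where ?T1.0 = "1800 * U"])
            assume "bval (Equal (Reg 12) (Num 0)) s7"
            then have h: "regs s7 12 = 0" "arrs s7 2 = arrs s6 2" "cnt (arrs s7 2) v = pB + 1"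
              using s7 r6 by auto
            have v1: "valid (arrs s7 2) v" using h r6 by simp
            then have x1: "\<forall>u<n. arrs s7 2 u \<le> 1" by (simp add: valid_def)
            have sel: "run W select s7 (1200 * U) (ready v (arrs s7 2))"
              by (rule run_select) (use s7 v7 vn nc x1 h z7 in auto)
            show "run W (Seq select rots) s7 (1800 * U) (\<lambda>s'. full (arrs s' 2))"
            proof (rule run_seq[OF sel])
              fix s8 assume s8: "ready v (arrs s7 2) s8" and sm8: "same select s7 s8"
              then obtain c k d l where g: "good v (arrs s7 2) c k d l" "\<forall>i\<le>k. arrs s8 6 i = c i"
                "regs s8 20 = k" "\<forall>i\<le>l. arrs s8 7 i = d i" "regs s8 21 = l" by (auto simp: ready_def)
              have "inp s8" by (rule inp_same[OF sm8]) (use s7 in auto)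
              moreover have "arrs s8 2 = arrs s7 2" "regs s8 12 = 0"
                using same_arrs[OF sm8, of 2] same_regs[OF sm8, of 12] h by auto
              ultimately show "run W rots s8 (560 * U) (\<lambda>s'. full (arrs s' 2))"
                using run_rots[OF _ g(1) _ v1 g(2-5)] by simp
            qed simp
          next
            assume "\<not> bval (Equal (Reg 12) (Num 0)) s7"
            then show "run W Skip s7 (1800 * U) (\<lambda>s'. full (arrs s' 2))"
              using s7 by (intro run_wp) auto
          qed simp
        qed (use r6 vn in \<open>auto simp: algebra_simps\<close>)
        moreover have "regs s5 9 = v" using same_regs[OF sm5, of 9] r4 by simp
        ultimately show "run W (Seq (Assign 11 (Reg 9)) (Seq place repair)) s5 (2100 * U) (\<lambda>s'. full (arrs s' 2))"
          by (intro run_wp_seq[where ?T2.0 = "2050 * U"]) (use vn W' in \<open>simp_all add: s6_def\<close>)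
      qed (use s4 z4 in auto)
    qed (use s3 r3 vn in auto)
  qed simp
  moreover have "regs s1 0 = n" using s1 by (simp add: inp_def)
  ultimately show "run W (Seq (Assign 9 (Cell 3 (Minus (Reg 0) (Num 1)))) (Seq clear (Seq (order_from 9)
      (Seq greedy (Seq (Assign 11 (Reg 9)) (Seq place repair)))))) s1 (2400 * U) (\<lambda>s'. full (arrs s' 2))"
    by (intro run_wp_seq[where ?T2.0 = "2390 * U"]) (use vn W' in \<open>simp_all add: s2_def v_def\<close>)
qed (use inp r z n_pos in auto)

end

section \<open>From graphs to adjacency lists and back\<close>

lemma degenerate_induced:
  assumes adj: "regular_adjacency L \<Delta> pA pB"
    and nb: "\<And>v. v < length L \<Longrightarrow> set (L ! v) = {u. (v, u) \<in> parcs G}"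
    and A: "A \<subseteq> {..<length L}" and d: "regular_adjacency.degen L p A"
  shows "degenerate p (with_proj G \<restriction> A)"
  unfolding degenerate_def
proof (intro allI impI)
  interpret regular_adjacency L \<Delta> pA pB by (rule adj)
  fix H assume H: "subgraph H (with_proj G \<restriction> A) \<and> graph H \<and> verts H \<noteq> {}"
  then have sub: "subgraph H (with_proj G \<restriction> A)" and HA: "verts H \<subseteq> A" and ne: "verts H \<noteq> {}"
    by (auto simp: subgraph_def)
  have ends: "tail H = fst" "head H = snd" using sub by (auto simp: subgraph_def compatible_def)
  have arcs: "arcs H \<subseteq> parcs G" using sub by (auto simp: subgraph_def)
  have wf: "wf_digraph H" using sub by (simp add: subgraph_def)
  obtain u where u: "u \<in> verts H" "card (verts H \<inter> nb u) \<le> p"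
    using d HA ne unfolding degen_def by blast
  have un: "u < n" using u HA A by auto
  \<comment> \<open>\<open>H\<close> may omit arcs, but each arc leaving \<open>u\<close> has its
    own head among the neighbours of \<open>u\<close> in \<open>verts H\<close>.\<close>
  have "card (out_arcs H u) \<le> card (verts H \<inter> nb u)"
  proof (rule card_inj_on_le[where f = snd])
    show "inj_on snd (out_arcs H u)" by (auto simp: inj_on_def ends)
    show "snd ` out_arcs H u \<subseteq> verts H \<inter> nb u"
    proof
      fix y assume "y \<in> snd ` out_arcs H u"
      then have e: "(u, y) \<in> arcs H" by (auto simp: ends)
      then have "y \<in> verts H" using wf_digraph.head_in_verts[OF wf e] by (simp add: ends)
      moreover have "y \<in> nb u" using e arcs nb[OF un] by auto
      ultimately show "y \<in> verts H \<inter> nb u" by simp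
    qed
  qed simp
  then have "out_degree H u \<le> p" using u(2) by (simp add: out_degree_def)
  then show "\<exists>v\<in>verts H. out_degree H v \<le> p" using u(1) by blast
qed

lemma regular_adjacency_of_graph:
  assumes G: "pair_graph G" and conn: "connected (with_proj G)" and reg: "regular \<Delta> (with_proj G)"
    and D: "3 \<le> \<Delta>" and K: "\<not> complete_digraph (\<Delta> + 1) (with_proj G)"
    and p: "pA + pB = \<Delta> - 2" and adj: "adjacency_lists G L"
  shows "regular_adjacency L \<Delta> pA pB"
proof -
  interpret pair_graph G by (rule G)
  define n where "n = length L"
  have V: "pverts G = {..<n}" and dist: "\<And>v. v < n \<Longrightarrow> distinct (L ! v)"
    and nb: "\<And>v. v < n \<Longrightarrow> set (L ! v) = {u. (v, u) \<in> parcs G}"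
    using adj by (auto simp: adjacency_lists_def n_def)
  have sym: "(y, u) \<in> parcs G" if "(u, y) \<in> parcs G" for u y
    using that pair_sym_arcs by (auto simp: symmetric_def sym_def)
  have irr: "(u, u) \<notin> parcs G" for u using pair_no_loops[of "(u, u)"] by auto
  have inV: "u < n" "y < n" if "(u, y) \<in> parcs G" for u y
    using in_arcsD1[OF that] in_arcsD2[OF that] V by auto
  have len: "length (L ! u) = \<Delta>" if u: "u < n" for u
  proof -
    have "out_arcs (with_proj G) u = Pair u ` {y. (u, y) \<in> parcs G}" by auto
    then have "card (set (L ! u)) = out_degree (with_proj G) u"
      unfolding out_degree_def nb[OF u] by (simp add: card_image inj_on_def)
    also have "\<dots> = \<Delta>" using reg u V by (simp add: regular_def)
    finally show ?thesis using dist[OF u] by (simp add: distinct_card)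
  qed
  have closed: "S = {..<n}"
    if S: "S \<subseteq> {..<n}" "S \<noteq> {}" and cl: "\<And>u y. u \<in> S \<Longrightarrow> y \<in> set (L ! u) \<Longrightarrow> y \<in> S" for S
  proof -
    obtain u where u: "u \<in> S" using S by blast
    \<comment> \<open>The library defines connectedness through the symmetric closure, which adds no
      arcs here.\<close>
    have par: "parcs (mk_symmetric (with_proj G)) = parcs G"
      using sym by (auto simp: parcs_mk_symmetric)
    have "y \<in> S" if y: "y < n" for y
    proof -
      have "u \<in> pverts G" "y \<in> pverts G" using u S y V by auto
      then have "u \<rightarrow>\<^sup>*\<^bsub>with_proj (mk_symmetric (with_proj G))\<^esub> y"
        using conn by (simp add: connected_def strongly_connected_def)
      then have "(u, y) \<in> rtrancl_on {..<n} (parcs G)"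
        unfolding reachable_def by (simp add: par V)
      then have "u \<in> S \<longrightarrow> y \<in> S"
      proof (induction rule: rtrancl_on.induct)
        case (rtrancl_on_into_rtrancl_on a b c)
        then show ?case using cl[of b c] nb[of b] inV[of b c] by auto
      qed simp
      then show ?thesis using u by simp
    qed
    then show ?thesis using S by blast
  qed
  have nclique: "\<exists>x\<in>set (L ! u). \<exists>z\<in>set (L ! u). x \<noteq> z \<and> z \<notin> set (L ! x)" if u: "u < n" for u
  proof (rule ccontr)
    assume "\<not> ?thesis"
    then have all: "z \<in> set (L ! x)" if "x \<in> set (L ! u)" "z \<in> set (L ! u)" "x \<noteq> z" for x z
      using that by blast
    define S where "S = insert u (set (L ! u))"
    have Sn: "S \<subseteq> {..<n}" using u nb[OF u] inV by (auto simp: S_def)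
    have "card (set (L ! u)) = \<Delta>" using distinct_card[OF dist[OF u]] len[OF u] by simp
    moreover have "u \<notin> set (L ! u)" using nb[OF u] irr by simp
    ultimately have cS: "card S = \<Delta> + 1" by (simp add: S_def)
    \<comment> \<open>If N is a clique, each \<open>x\<close> in \<open>S\<close> is adjacent to the
      other \<Delta> vertices of \<open>S\<close>, which exhausts its degree. So \<open>S\<close> is
      closed, hence everything, and the graph is complete.\<close>
    have eq: "set (L ! x) = S - {x}" if x: "x \<in> S" for x
    proof -
      have xn: "x < n" using x Sn by auto
      have "S - {x} \<subseteq> set (L ! x)"
      proof
        fix z assume z: "z \<in> S - {x}"
        show "z \<in> set (L ! x)"
        proof (cases "x = u \<or> z = u")
          case True
          then show ?thesis using x z sym nb[OF u] nb[OF xn] by (auto simp: S_def)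
        next
          case False
          then show ?thesis using x z all by (auto simp: S_def)
        qed
      qed
      moreover have "card (set (L ! x)) = card (S - {x})"
        using len[OF xn] dist[OF xn] cS x by (simp add: distinct_card)
      ultimately show ?thesis by (metis List.finite_set card_subset_eq)
    qed
    have Sall: "S = {..<n}"
    proof (rule closed[OF Sn])
      show "S \<noteq> {}" by (simp add: S_def)
      show "y \<in> S" if "x \<in> S" "y \<in> set (L ! x)" for x y using eq[OF that(1)] that(2) by blast
    qed
    have "parcs G = {(a, b). (a, b) \<in> pverts G \<times> pverts G \<and> a \<noteq> b}"
    proof -
      have "(a, b) \<in> parcs G \<longleftrightarrow> a < n \<and> b < n \<and> a \<noteq> b" for a b
      proof (cases "a < n")
        case True
        then have "set (L ! a) = {..<n} - {a}" using eq Sall by auto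
        then show ?thesis using True nb[OF True] by auto
      next
        case False
        then show ?thesis using inV[of a b] by auto
      qed
      then show ?thesis using V by auto
    qed
    moreover have "card (pverts G) = \<Delta> + 1" using cS Sall V by simp
    moreover have "graph (with_proj G)" by unfold_locales
    ultimately show False using K by (simp add: complete_digraph_def)
  qed
  have ne: "n \<noteq> 0"
  proof
    assume "n = 0"
    then have "pverts G = {}" using V by simp
    then show False using conn by (simp add: connected_def strongly_connected_def)
  qed
  show ?thesis
  proof
    show "length (L ! u) = \<Delta>" "distinct (L ! u)" "u \<notin> set (L ! u)"
      "\<exists>x\<in>set (L ! u). \<exists>z\<in>set (L ! u). x \<noteq> z \<and> z \<notin> set (L ! x)" if "u < length L" for u
      using len dist nb irr nclique that by (auto simp: n_def)
    show "y < length L" "u \<in> set (L ! y)" if "u < length L" "y \<in> set (L ! u)" for u y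
      using that nb[of u] nb[of y] inV[of u y] sym[of u y] by (auto simp: n_def)
    show "S = {..<length L}" if "S \<subseteq> {..<length L}" "S \<noteq> {}"
      "\<And>u y. u \<in> S \<Longrightarrow> y \<in> set (L ! u) \<Longrightarrow> y \<in> S" for S
      using closed[of S] that by (simp add: n_def)
    show "pA + pB + 2 = \<Delta>" "3 \<le> \<Delta>" "L \<noteq> []" using p D ne by (auto simp: n_def)
  qed
qed

text \<open>There are \<open>length L * \<Delta>\<close> arcs, and an edge arises from at most two
  of them.\<close>

lemma degree_count:
  assumes G: "pair_graph G" and reg: "regular_adjacency L \<Delta> pA pB" and adj: "adjacency_lists G L"
  shows "length L * \<Delta> \<le> 2 * num_edges (with_proj G)"
proof -
  interpret pair_graph G by (rule G)
  interpret regular_adjacency L \<Delta> pA pB by (rule reg)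
  have V: "pverts G = {..<n}" and nb: "\<And>v. v < n \<Longrightarrow> nb v = {u. (v, u) \<in> parcs G}"
    using adj by (auto simp: adjacency_lists_def)
  define E where "E = {{u, v} | u v. (u, v) \<in> parcs G}"
  have E: "E = (\<lambda>(u, v). {u, v}) ` parcs G" by (auto simp: E_def)
  have fin: "finite E" unfolding E by simp
  have "(a, b) \<in> parcs G \<longleftrightarrow> a < n \<and> b \<in> nb a" for a b
    using nb[of a] in_arcsD1[of a b] V by auto
  then have "parcs G = Sigma {..<n} nb" by (simp add: set_eq_iff)
  then have cp: "card (parcs G) = n * \<Delta>" by (simp add: card_nb)
  have sub: "parcs G \<subseteq> (\<Union>e\<in>E. {a. {fst a, snd a} = e})"
  proof
    fix a assume "a \<in> parcs G"
    then have "{fst a, snd a} \<in> E" unfolding E by (intro image_eqI[of _ _ a]) (auto simp: case_prod_beta)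
    then show "a \<in> (\<Union>e\<in>E. {a. {fst a, snd a} = e})" by blast
  qed
  have fe: "finite {a. {fst a, snd a} = e} \<and> card {a. {fst a, snd a} = e} \<le> 2" if "e \<in> E" for e
  proof -
    obtain u v where e: "e = {u, v}" using \<open>e \<in> E\<close> by (auto simp: E_def)
    have sub: "{a. {fst a, snd a} = e} \<subseteq> set [(u, v), (v, u)]"
      by (auto simp: e doubleton_eq_iff)
    have "card {a. {fst a, snd a} = e} \<le> card (set [(u, v), (v, u)])"
      using sub by (rule card_mono[rotated]) (rule List.finite_set)
    also have "\<dots> \<le> 2" using card_length[of "[(u, v), (v, u)]"] by simp
    finally show ?thesis using finite_subset[OF sub List.finite_set] by blast
  qed
  have "finite (\<Union>e\<in>E. {a. {fst a, snd a} = e})" using fin fe by blast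
  then have "n * \<Delta> \<le> card (\<Union>e\<in>E. {a. {fst a, snd a} = e})"
    unfolding cp[symmetric] using sub by (rule card_mono)
  also have "\<dots> \<le> (\<Sum>e\<in>E. card {a. {fst a, snd a} = e})" by (rule card_UN_le[OF fin])
  also have "\<dots> \<le> (\<Sum>e\<in>E. 2)" by (rule sum_mono) (use fe in auto)
  also have "\<dots> = 2 * num_edges (with_proj G)" by (simp add: num_edges_def E_def)
  finally show ?thesis .
qed

context machine
begin

lemma length_concat_take: "v \<le> n \<Longrightarrow> length (concat (take v L)) = v * \<Delta>"
proof (induction v)
  case (Suc v)
  then have "take (Suc v) L = take v L @ [L ! v]" by (simp add: take_Suc_conv_app_nth)
  then show ?case using Suc length_adj[of v] by simp
qed simp

lemma nth_concat:
  assumes "u < n" "j < \<Delta>"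
  shows "concat L ! (u * \<Delta> + j) = L ! u ! j" "u * \<Delta> + j < length (concat L)"
proof -
  have "concat L = concat (take u L @ L ! u # drop (Suc u) L)"
    using id_take_nth_drop[OF assms(1)] by simp
  then show "concat L ! (u * \<Delta> + j) = L ! u ! j"
    using length_concat_take[of u] length_adj[of u] assms by (simp add: nth_append)
  show "u * \<Delta> + j < length (concat L)"
    using length_concat_take[of n] adj_idx(1)[OF assms] by simp
qed

lemma inp_input_state: "inp (input_state L pA pB)"
  unfolding inp_def input_state_def using length_concat_take nth_concat by simp

end

theorem theorem4:
  shows "\<exists>(prog :: com) (k :: nat) (C :: nat).
    \<forall>(G :: nat pair_pre_digraph) (L :: nat list list) (n :: nat) (m :: nat)
      (\<Delta> :: nat) (pA :: nat) (pB :: nat).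
      pair_graph G \<and> connected (with_proj G) \<and> regular \<Delta> (with_proj G) \<and> \<Delta> \<ge> 3 \<and>
      \<not> complete_digraph (\<Delta> + 1) (with_proj G) \<and>
      n = card (pverts G) \<and> m = num_edges (with_proj G) \<and>
      pA \<le> pB \<and> pA + pB = \<Delta> - 2 \<and>
      adjacency_lists G L \<longrightarrow>
      (\<exists>t s A B.
         exec ((n + m) ^ k) prog (input_state L pA pB) t s \<and> t \<le> C * (n + m) \<and>
         outputs_partition s (pverts G) A B \<and>
         degenerate pA (with_proj G \<restriction> A) \<and> degenerate pB (with_proj G \<restriction> B))"
proof (rule exI[of _ main_prog], rule exI[of _ 2], rule exI[of _ 5000], intro allI impI)
  fix G :: "nat pair_pre_digraph" and L :: "nat list list" and n m \<Delta> pA pB :: nat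
  assume "pair_graph G \<and> connected (with_proj G) \<and> regular \<Delta> (with_proj G) \<and> \<Delta> \<ge> 3 \<and>
      \<not> complete_digraph (\<Delta> + 1) (with_proj G) \<and>
      n = card (pverts G) \<and> m = num_edges (with_proj G) \<and>
      pA \<le> pB \<and> pA + pB = \<Delta> - 2 \<and> adjacency_lists G L"
  then have h: "pair_graph G" "connected (with_proj G)" "regular \<Delta> (with_proj G)" "3 \<le> \<Delta>"
    "\<not> complete_digraph (\<Delta> + 1) (with_proj G)" "pA + pB = \<Delta> - 2" "adjacency_lists G L"
    and n: "n = card (pverts G)" and m: "m = num_edges (with_proj G)" by auto
  have reg: "regular_adjacency L \<Delta> pA pB" by (rule regular_adjacency_of_graph[OF h])
  interpret R: regular_adjacency L \<Delta> pA pB by (rule reg)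
  have V: "pverts G = {..<length L}" and nb: "\<And>v. v < length L \<Longrightarrow> set (L ! v) = {u. (v, u) \<in> parcs G}"
    using h(7) by (auto simp: adjacency_lists_def)
  have nL: "n = length L" using n V by simp
  have nm: "n * \<Delta> \<le> 2 * m" using degree_count[OF h(1) reg h(7)] nL m by simp
  have Dn: "\<Delta> < n" using R.degree_less nL by simp
  have n4: "4 \<le> n" using Dn h(4) by simp
  have "4 * 3 \<le> n * \<Delta>" using n4 h(4) by (intro mult_le_mono) auto
  then have m6: "6 \<le> m" using nm by simp
  \<comment> \<open>The exponent 2 suffices: \<open>n + m\<close> is at least 10, and
    \<open>n * \<Delta> + n + 10\<close> is at most \<open>2 * m + n + 10\<close>.\<close>
  have "10 * (n + m) \<le> (n + m) * (n + m)" using n4 m6 by (intro mult_le_mono1) simp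
  then have W: "n * \<Delta> + n + 10 \<le> (n + m) ^ 2" using nm n4 by (simp add: power2_eq_square)
  interpret machine L \<Delta> pA pB "(n + m) ^ 2"
    by unfold_locales (use W nL in simp)
  have "run ((n + m) ^ 2) main_prog (input_state L pA pB) (2500 * ((length L + 1) * (\<Delta> + 1)))
      (\<lambda>s'. R.full (arrs s' 2))"
    by (rule run_main_prog[OF inp_input_state]) (auto simp: input_state_def)
  then obtain t s where t: "exec ((n + m) ^ 2) main_prog (input_state L pA pB) t s"
      "t \<le> 2500 * ((n + 1) * (\<Delta> + 1))" and full: "R.full (arrs s 2)"
    unfolding run_def nL by blast
  \<comment> \<open>Expanding gives at most \<open>2 * m + n + (\<Delta> + 1)\<close>, and the last
    summand is at most \<open>n\<close>. This doubles 2500 to 5000.\<close>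
  have "(n + 1) * (\<Delta> + 1) \<le> 2 * (n + m)" using nm Dn by simp
  then have tb: "t \<le> 5000 * (n + m)" using t(2) by linarith
  define A where "A = R.part (arrs s 2) 0"
  define B where "B = R.part (arrs s 2) 1"
  have x1: "\<forall>u<length L. arrs s 2 u \<le> 1" and dA: "R.degen pA A" and dB: "R.degen pB B"
    using full by (auto simp: R.full_def A_def B_def)
  have AB: "A \<subseteq> {..<length L}" "B \<subseteq> {..<length L}" by (auto simp: A_def B_def R.part_def)
  have "outputs_partition s (pverts G) A B"
    unfolding outputs_partition_def V
  proof (intro conjI)
    show "A \<union> B = {..<length L}"
    proof
      show "{..<length L} \<subseteq> A \<union> B"
      proof
        fix u assume "u \<in> {..<length L}"
        then have u: "u < length L" "arrs s 2 u \<le> 1" using x1 by auto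
        then have "arrs s 2 u = 0 \<or> arrs s 2 u = 1" by linarith
        then show "u \<in> A \<union> B" using u by (auto simp: A_def B_def R.part_def)
      qed
    qed (use AB in auto)
  qed (auto simp: A_def B_def R.part_def)
  moreover have "degenerate pA (with_proj G \<restriction> A)" by (rule degenerate_induced[OF reg nb AB(1) dA])
  moreover have "degenerate pB (with_proj G \<restriction> B)" by (rule degenerate_induced[OF reg nb AB(2) dB])
  ultimately show "\<exists>t s A B.
         exec ((n + m) ^ 2) main_prog (input_state L pA pB) t s \<and> t \<le> 5000 * (n + m) \<and>
         outputs_partition s (pverts G) A B \<and>
         degenerate pA (with_proj G \<restriction> A) \<and> degenerate pB (with_proj G \<restriction> B)"
    using t(1) tb by blast
qed

end
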